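(* Let $\sigma$ be an operator-valued symbol on $P\times\widehat P$ with $\sigma(b,a,\vartheta,\pi_i^j)\in S_2(C_i^j)$, such that $D_i^j\sigma(b,a,\vartheta,\pi_i^j)\in S_2(C_i^j)$ for all $(b,a,\vartheta)\in P$, $i,j=1,2$, and $$\int_P\|D_i^j\sigma(b,a,\vartheta,\pi_i^j)\|_{S_2(C_i^j)}^2\,\frac{db\,da\,d\vartheta}{a^3}<\infty,\qquad i,j=1,2.$$ Then the Weyl transform $W_\sigma:L^2(P)\to L^2(P)$ is a bounded operator.
   Context: The affine Poincar\'e group is $P=\{(b,a,\vartheta):b\in\mathbb R^2,\ a>0,\ \vartheta\in\mathbb R\}$ with product $(b,a,\vartheta)*(b',a',\vartheta')=(b+a\Lambda_\vartheta b',\,aa',\,\vartheta+\vartheta')$, where $\Lambda_\vartheta=\begin{pmatrix}\cosh\vartheta&\sinh\vartheta\\ \sinh\vartheta&\cosh\vartheta\end{pmatrix}$. Its left Haar measure is $d\mu(b,a,\vartheta)=\frac{db\,da\,d\vartheta}{a^3}$; $L^2(P)$ is taken with respect to $\mu$. Every $\xi=(b,a,\vartheta)\in P$ has the square root $\xi^{1/2}=\Big(\frac{b+\sqrt a\,\Lambda_{-\vartheta/2}b}{1+a+2\sqrt a\cosh(\vartheta/2)},\sqrt a,\frac\vartheta2\Big)$, satisfying $\xi^{1/2}*\xi^{1/2}=\xi$. $\langle x;y\rangle=x_1y_1-x_2y_2$ is the Minkowski form on $\mathbb R^2$. The four cones are $C_1^1=\{x_1^2>x_2^2,\ x_1>0\}$,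 $C_2^1=\{x_1^2>x_2^2,\ x_1<0\}$, $C_1^2=\{x_1^2<x_2^2,\ x_2>0\}$, $C_2^2=\{x_1^2<x_2^2,\ x_2<0\}$ in $\mathbb R^2$. For $i,j=1,2$, $\pi_i^j$ is the unitary representation of $P$ on $L^2(C_i^j)$ given by $(\pi_i^j(b,a,\vartheta)\varphi)(x)=a\,e^{i\langle x;b\rangle}\varphi(a\Lambda_{-\vartheta}x)$, and $\widehat P=\{\pi_i^j:i,j=1,2\}$. The Duflo--Moore operators are the unbounded operators $(D_i^j\varphi)(x)=\frac1{2\pi}|\langle x;x\rangle|^{1/2}\varphi(x)$ on $L^2(C_i^j)$. $S_2(C_i^j)$ denotes the Hilbert--Schmidt operators on $L^2(C_i^j)$. For $F\in L^1(P)\cap L^2(P)$ the group Fourier transform is the Hilbert--Schmidt operator $(\widehat F(\pi_i^j)\varphi)(x)=\int_P F(\xi)\,(\pi_i^j(\xi)D_i^j\varphi)(x)\,d\mu(\xi)$ on $L^2(C_i^j)$, extended by continuity to $F\in L^2(P)$. The Wigner transform of $f,g\in L^2(P)$ is the operator-valued function on $P\times\widehat P$ $$(W(f,g)(w,\pi_i^j)\varphi)(x)=\int_P f(\xi^{1/2}*w)\,\overline{g(w^{-1}*\xi^{1/2})}\,(\pi_i^j(\xi)D_i^j\varphi)(x)\,d\mu(\xi),\quad w\in P,\ \varphi\in L^2(C_i^j),$$ i.e. $W(f,g)(w,\pi_i^j)$ is the group Fourier transform at $\pi_i^j$ of $\xi\mapsto f(\xi^{1/2}*w)\overline{g(w^{-1}*\xi^{1/2})}$.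 The Weyl transform $W_\sigma$ associated with an operator-valued symbol $\sigma$ is defined by $$\langle W_\sigma f,g\rangle_{L^2(P)}=\int_P\sum_{i,j=1}^2\mathrm{Tr}\big[D_i^j\,\sigma(b,a,\vartheta,\pi_i^j)\,W(f,g)(b,a,\vartheta,\pi_i^j)\big]\frac{db\,da\,d\vartheta}{a^3},\qquad f,g\in L^2(P).$$ *)

theory Defs
  imports "HOL-Analysis.Analysis"
begin

section \<open>Square-integrable functions and operators on them\<close>

text \<open>
  Elements of \<open>L\<^sup>2(M)\<close> are represented by functions; statements about them are understood
  up to equality almost everywhere, and operators act on representatives.  A linear operator with a
  norm bound automatically respects almost-everywhere equality.
\<close>

definition L2 :: "'a measure \<Rightarrow> ('a \<Rightarrow> complex) set" where
  "L2 M = {f \<in> borel_measurable M. integrable M (\<lambda>x. (cmod (f x))\<^sup>2)}"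

definition L2_inner :: "'a measure \<Rightarrow> ('a \<Rightarrow> complex) \<Rightarrow> ('a \<Rightarrow> complex) \<Rightarrow> complex" where
  "L2_inner M f g = (\<integral>x. f x * cnj (g x) \<partial>M)"

definition L2_norm :: "'a measure \<Rightarrow> ('a \<Rightarrow> complex) \<Rightarrow> real" where
  "L2_norm M f = sqrt (\<integral>x. (cmod (f x))\<^sup>2 \<partial>M)"

definition L2_bounded_operator ::
    "'a measure \<Rightarrow> (('a \<Rightarrow> complex) \<Rightarrow> 'a \<Rightarrow> complex) \<Rightarrow> bool" where
  "L2_bounded_operator M T \<longleftrightarrow>
     (\<forall>f\<in>L2 M. T f \<in> L2 M) \<and>
     (\<forall>f\<in>L2 M. \<forall>g\<in>L2 M. \<forall>c d. AE x in M. T (\<lambda>y. c * f y + d * g y) x = c * T f x + d * T g x) \<and>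
     (\<exists>C. \<forall>f\<in>L2 M. L2_norm M (T f) \<le> C * L2_norm M f)"

text \<open>
  Orthonormal bases are indexed by the natural numbers; this is the appropriate notion for the
  spaces \<open>L\<^sup>2(C)\<close> below, which are separable and infinite-dimensional because the cones are
  nonempty open subsets of the plane.
\<close>

definition orthonormal_basis :: "'a measure \<Rightarrow> (nat \<Rightarrow> 'a \<Rightarrow> complex) \<Rightarrow> bool" where
  "orthonormal_basis M e \<longleftrightarrow>
     (\<forall>n. e n \<in> L2 M) \<and>
     (\<forall>m n. L2_inner M (e m) (e n) = (if m = n then 1 else 0)) \<and>
     (\<forall>f\<in>L2 M. (\<forall>n. L2_inner M f (e n) = 0) \<longrightarrow> (AE x in M. f x = 0))"

text \<open>
  The Hilbert--Schmidt property and norm, and the trace of a trace-class operator, do not depend on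
  the orthonormal basis used to compute them, so one basis is fixed for each measure.
\<close>

definition some_basis :: "'a measure \<Rightarrow> nat \<Rightarrow> 'a \<Rightarrow> complex" where
  "some_basis M = (SOME e. orthonormal_basis M e)"

definition hilbert_schmidt ::
    "'a measure \<Rightarrow> (('a \<Rightarrow> complex) \<Rightarrow> 'a \<Rightarrow> complex) \<Rightarrow> bool" where
  "hilbert_schmidt M T \<longleftrightarrow>
     L2_bounded_operator M T \<and> summable (\<lambda>n. (L2_norm M (T (some_basis M n)))\<^sup>2)"

definition hs_norm :: "'a measure \<Rightarrow> (('a \<Rightarrow> complex) \<Rightarrow> 'a \<Rightarrow> complex) \<Rightarrow> real" where
  "hs_norm M T = sqrt (\<Sum>n. (L2_norm M (T (some_basis M n)))\<^sup>2)"

definition op_trace :: "'a measure \<Rightarrow> (('a \<Rightarrow> complex) \<Rightarrow> 'a \<Rightarrow> complex) \<Rightarrow> complex" where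
  "op_trace M T = (\<Sum>n. L2_inner M (T (some_basis M n)) (some_basis M n))"


section \<open>The affine Poincare group\<close>

type_synonym plane = "real \<times> real"

text \<open>The triple \<open>(b, a, \<theta>)\<close>, a group element when \<open>a > 0\<close>.\<close>
type_synonym poincare = "plane \<times> real \<times> real"

definition poincare_group :: "poincare set" where
  "poincare_group = {(b, a, \<theta>). a > 0}"

definition boost :: "real \<Rightarrow> plane \<Rightarrow> plane" where
  "boost \<theta> x = (cosh \<theta> * fst x + sinh \<theta> * snd x, sinh \<theta> * fst x + cosh \<theta> * snd x)"

definition pmult :: "poincare \<Rightarrow> poincare \<Rightarrow> poincare" (infixl "\<star>" 70) where
  "pmult = (\<lambda>(b, a, \<theta>) (b', a', \<theta>'). (b + a *\<^sub>R boost \<theta> b', a * a', \<theta> + \<theta>'))"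

definition pone :: poincare where
  "pone = (0, 1, 0)"

definition pinv :: "poincare \<Rightarrow> poincare" where
  "pinv = (\<lambda>(b, a, \<theta>). (- ((1 / a) *\<^sub>R boost (- \<theta>) b), 1 / a, - \<theta>))"

definition psqrt :: "poincare \<Rightarrow> poincare" where
  "psqrt = (\<lambda>(b, a, \<theta>).
     ((1 / (1 + a + 2 * sqrt a * cosh (\<theta> / 2))) *\<^sub>R (b + sqrt a *\<^sub>R boost (- \<theta> / 2) b),
      sqrt a, \<theta> / 2))"

lemma boost_add: "boost \<theta> (x + y) = boost \<theta> x + boost \<theta> y"
  by (simp add: boost_def algebra_simps)

lemma boost_scaleR: "boost \<theta> (c *\<^sub>R x) = c *\<^sub>R boost \<theta> x"
  by (simp add: boost_def algebra_simps)

lemma boost_minus: "boost \<theta> (- x) = - boost \<theta> x"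
  by (simp add: boost_def)

lemma boost_boost: "boost \<theta> (boost \<theta>' x) = boost (\<theta> + \<theta>') x"
  by (simp add: boost_def cosh_add sinh_add algebra_simps)

lemma boost_0: "boost 0 x = x"
  by (simp add: boost_def)

lemma pmult_assoc: "(u \<star> v) \<star> w = u \<star> (v \<star> w)"
  by (cases u; cases v; cases w)
    (simp add: pmult_def boost_add boost_scaleR boost_boost scaleR_add_right)

lemma pmult_pone: "u \<star> pone = u" "pone \<star> u = u"
  by (cases u; simp add: pmult_def pone_def boost_def flip: zero_prod_def)+

lemma pmult_pinv:
  assumes "w \<in> poincare_group"
  shows "w \<star> pinv w = pone" "pinv w \<star> w = pone"
  using assms
  by (auto simp: poincare_group_def pmult_def pinv_def pone_def boost_0 boost_boost boost_minus
      boost_scaleR simp del: uminus_Pair)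

lemma psqrt_square:
  assumes "w \<in> poincare_group"
  shows "psqrt w \<star> psqrt w = w"
proof -
  obtain b a \<theta> where w: "w = (b, a, \<theta>)" and a: "a > 0"
    using assms by (auto simp: poincare_group_def)
  define s where "s = sqrt a"
  define N where "N = 1 + a + 2 * s * cosh (\<theta> / 2)"
  have s: "s * s = a" "s > 0" using a by (auto simp: s_def)
  have "N > 0" using s a by (simp add: N_def add_pos_pos)
  have bb: "boost (\<theta> / 2) b + boost (- \<theta> / 2) b = (2 * cosh (\<theta> / 2)) *\<^sub>R b"
    by (simp add: boost_def scaleR_prod_def algebra_simps)
  have "(b + s *\<^sub>R boost (- \<theta> / 2) b) + s *\<^sub>R boost (\<theta> / 2) (b + s *\<^sub>R boost (- \<theta> / 2) b)
      = (1 + a) *\<^sub>R b + s *\<^sub>R (boost (\<theta> / 2) b + boost (- \<theta> / 2) b)"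
    by (simp add: boost_add boost_scaleR boost_boost boost_0 s algebra_simps)
  also have "\<dots> = N *\<^sub>R b"
    unfolding bb by (simp add: N_def algebra_simps)
  finally have "(b + s *\<^sub>R boost (- \<theta> / 2) b) + s *\<^sub>R boost (\<theta> / 2) (b + s *\<^sub>R boost (- \<theta> / 2) b)
      = N *\<^sub>R b" .
  then have "(1 / N) *\<^sub>R ((b + s *\<^sub>R boost (- \<theta> / 2) b)
      + s *\<^sub>R boost (\<theta> / 2) (b + s *\<^sub>R boost (- \<theta> / 2) b)) = b"
    using \<open>N > 0\<close> by simp
  then have "(1 / N) *\<^sub>R (b + s *\<^sub>R boost (- \<theta> / 2) b)
      + s *\<^sub>R boost (\<theta> / 2) ((1 / N) *\<^sub>R (b + s *\<^sub>R boost (- \<theta> / 2) b)) = b"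
    by (simp only: scaleR_add_right boost_scaleR boost_add) (simp add: scaleR_left_commute mult.commute)
  with s show ?thesis
    by (simp add: w psqrt_def pmult_def s_def[symmetric] N_def)
qed

text \<open>Left Haar measure \<open>db da d\<theta> / a\<^sup>3\<close>; its space is the group.\<close>
definition haar :: "poincare measure" where
  "haar = density (restrict_space lborel poincare_group) (\<lambda>(b, a, \<theta>). ennreal (1 / a ^ 3))"


section \<open>Cones, representations and Duflo--Moore operators\<close>

definition minkowski :: "plane \<Rightarrow> plane \<Rightarrow> real" where
  "minkowski x y = fst x * fst y - snd x * snd y"

text \<open>\<open>cone i j\<close> is the cone with lower index \<open>i\<close> and upper index \<open>j\<close>; only \<open>i, j \<in> {1, 2}\<close> matter.\<close>
definition cone :: "nat \<Rightarrow> nat \<Rightarrow> plane set" where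
  "cone i j =
     (if j = 1
      then {x. (fst x)\<^sup>2 > (snd x)\<^sup>2 \<and> (if i = 1 then fst x > 0 else fst x < 0)}
      else {x. (fst x)\<^sup>2 < (snd x)\<^sup>2 \<and> (if i = 1 then snd x > 0 else snd x < 0)})"

definition cone_measure :: "nat \<Rightarrow> nat \<Rightarrow> plane measure" where
  "cone_measure i j = restrict_space lborel (cone i j)"

text \<open>
  The representations \<open>\<pi>\<^sub>i\<^sup>j\<close>, and likewise the operators \<open>D\<^sub>i\<^sup>j\<close>, are given by a formula
  independent of \<open>i\<close> and \<open>j\<close>; the indices enter through the space \<open>L2 (cone_measure i j)\<close>.  Each
  cone is invariant under positive dilations and boosts.
\<close>

definition rep :: "poincare \<Rightarrow> (plane \<Rightarrow> complex) \<Rightarrow> plane \<Rightarrow> complex" where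
  "rep = (\<lambda>(b, a, \<theta>) \<phi> x.
     of_real a * exp (\<i> * of_real (minkowski x b)) * \<phi> (a *\<^sub>R boost (- \<theta>) x))"

text \<open>
  \<open>duflo_moore\<close> is unbounded, with domain all \<open>\<phi> \<in> L2 (cone_measure i j)\<close> such that
  \<open>duflo_moore \<phi> \<in> L2 (cone_measure i j)\<close>.
\<close>

definition duflo_moore :: "(plane \<Rightarrow> complex) \<Rightarrow> plane \<Rightarrow> complex" where
  "duflo_moore \<phi> x = of_real (1 / (2 * pi) * sqrt \<bar>minkowski x x\<bar>) * \<phi> x"


section \<open>Group Fourier transform, Wigner transform, Weyl transform\<close>

text \<open>
  For \<open>F \<in> L\<^sup>1 \<inter> L\<^sup>2\<close> the transform is the Hilbert--Schmidt operator given by the integral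
  formula.  For \<open>\<phi>\<close> outside the domain of the Duflo--Moore operator the integral need not converge,
  so the formula is imposed on that dense domain, which determines the bounded operator \<open>T\<close>.
\<close>

definition is_fourier_L1_L2 ::
    "nat \<Rightarrow> nat \<Rightarrow> (poincare \<Rightarrow> complex) \<Rightarrow> ((plane \<Rightarrow> complex) \<Rightarrow> plane \<Rightarrow> complex) \<Rightarrow> bool" where
  "is_fourier_L1_L2 i j F T \<longleftrightarrow>
     integrable haar F \<and> F \<in> L2 haar \<and> hilbert_schmidt (cone_measure i j) T \<and>
     (\<forall>\<phi>\<in>L2 (cone_measure i j). duflo_moore \<phi> \<in> L2 (cone_measure i j) \<longrightarrow>
        (AE x in cone_measure i j.
           integrable haar (\<lambda>\<xi>. F \<xi> * rep \<xi> (duflo_moore \<phi>) x) \<and>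
           T \<phi> x = (\<integral>\<xi>. F \<xi> * rep \<xi> (duflo_moore \<phi>) x \<partial>haar)))"

definition is_fourier ::
    "nat \<Rightarrow> nat \<Rightarrow> (poincare \<Rightarrow> complex) \<Rightarrow> ((plane \<Rightarrow> complex) \<Rightarrow> plane \<Rightarrow> complex) \<Rightarrow> bool" where
  "is_fourier i j F T \<longleftrightarrow>
     F \<in> L2 haar \<and> hilbert_schmidt (cone_measure i j) T \<and>
     (\<exists>Fn Tn. (\<forall>n. is_fourier_L1_L2 i j (Fn n) (Tn n)) \<and>
        (\<lambda>n. L2_norm haar (\<lambda>\<xi>. Fn n \<xi> - F \<xi>)) \<longlonglongrightarrow> 0 \<and>
        (\<lambda>n. hs_norm (cone_measure i j) (\<lambda>\<phi> x. Tn n \<phi> x - T \<phi> x)) \<longlonglongrightarrow> 0)"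

text \<open>
  The value \<open>0\<close> outside \<open>L\<^sup>2\<close> is a convention: in the Wigner transform the function being
  transformed is in \<open>L\<^sup>2\<close> only for almost every \<open>w\<close>.
\<close>

definition group_fourier ::
    "nat \<Rightarrow> nat \<Rightarrow> (poincare \<Rightarrow> complex) \<Rightarrow> (plane \<Rightarrow> complex) \<Rightarrow> plane \<Rightarrow> complex" where
  "group_fourier i j F =
     (if F \<in> L2 haar then SOME T. is_fourier i j F T else (\<lambda>\<phi> x. 0))"

definition wigner ::
    "(poincare \<Rightarrow> complex) \<Rightarrow> (poincare \<Rightarrow> complex) \<Rightarrow> poincare \<Rightarrow> nat \<Rightarrow> nat \<Rightarrow>
      (plane \<Rightarrow> complex) \<Rightarrow> plane \<Rightarrow> complex" where
  "wigner f g w i j = group_fourier i j (\<lambda>\<xi>. f (psqrt \<xi> \<star> w) * cnj (g (pinv w \<star> psqrt \<xi>)))"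

text \<open>A symbol assigns to \<open>w\<close> in the group and to indices \<open>i, j\<close> an operator on \<open>L2 (cone_measure i j)\<close>.\<close>
type_synonym symbol = "poincare \<Rightarrow> nat \<Rightarrow> nat \<Rightarrow> (plane \<Rightarrow> complex) \<Rightarrow> plane \<Rightarrow> complex"

definition measurable_symbol :: "symbol \<Rightarrow> bool" where
  "measurable_symbol \<sigma> \<longleftrightarrow>
     (\<forall>i\<in>{1, 2}. \<forall>j\<in>{1, 2}. \<forall>\<phi>\<in>L2 (cone_measure i j). \<forall>\<psi>\<in>L2 (cone_measure i j).
        (\<lambda>w. L2_inner (cone_measure i j) (\<sigma> w i j \<phi>) \<psi>) \<in> borel_measurable haar)"

definition weyl_integrand ::
    "symbol \<Rightarrow> (poincare \<Rightarrow> complex) \<Rightarrow> (poincare \<Rightarrow> complex) \<Rightarrow> poincare \<Rightarrow> complex" where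
  "weyl_integrand \<sigma> f g w =
     (\<Sum>i\<in>{1, 2}. \<Sum>j\<in>{1, 2}.
        op_trace (cone_measure i j) (\<lambda>\<phi>. duflo_moore (\<sigma> w i j (wigner f g w i j \<phi>))))"

text \<open>
  The defining relation determines \<open>weyl_transform \<sigma> f\<close> up to equality almost everywhere, provided
  that some such \<open>h\<close> exists.
\<close>

definition weyl_transform :: "symbol \<Rightarrow> (poincare \<Rightarrow> complex) \<Rightarrow> poincare \<Rightarrow> complex" where
  "weyl_transform \<sigma> f =
     (SOME h. h \<in> L2 haar \<and>
        (\<forall>g\<in>L2 haar. L2_inner haar h g = (\<integral>w. weyl_integrand \<sigma> f g w \<partial>haar)))"

end

theory Submission
  imports Defs "HOL-Probability.Characteristic_Functions"
begin

text \<open>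
  For fixed \<open>w\<close> the Wigner transform of \<open>f\<close> and \<open>g\<close> is the group Fourier transform of the function
  \<open>F\<^sub>w(\<xi>) = f(\<xi>\<^sup>1\<^sup>/\<^sup>2 w) cnj (g(w\<inverse> \<xi>\<^sup>1\<^sup>/\<^sup>2))\<close>.  The substitution \<open>u = \<xi>\<^sup>1\<^sup>/\<^sup>2 w\<close>, \<open>v = w\<inverse> \<xi>\<^sup>1\<^sup>/\<^sup>2 = u\<inverse> \<xi>\<close>
  preserves the product Haar measure because it is made of left translations, so the integral of
  \<open>\<parallel>F\<^sub>w\<parallel>\<^sup>2\<close> over \<open>w\<close> is \<open>\<parallel>f\<parallel>\<^sup>2 \<parallel>g\<parallel>\<^sup>2\<close> (\<open>nn_integral_wigner_function\<close>).  The Fourier transform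
  does not increase norms: \<open>\<parallel>F(\<pi>)\<parallel>\<close> in the Hilbert--Schmidt norm is at most \<open>\<parallel>F\<parallel>\<close> (\<open>fourier_hs_norm_le\<close>).
  Two applications of the Cauchy--Schwarz inequality, one to the trace of a product and one to
  the integral over \<open>w\<close>, bound \<open>\<langle>W\<^sub>\<sigma> f, g\<rangle>\<close> by a multiple of \<open>\<parallel>f\<parallel> \<parallel>g\<parallel>\<close>, and the Riesz representation
  theorem turns the bounded sesquilinear form into a bounded operator.

  The norm bound for the Fourier transform rests on two facts.  Integrating first over the
  translations \<open>b\<close>, the transform of \<open>F\<close> becomes an operator
  \<open>\<phi> \<mapsto> \<integral> G(x; a, \<theta>) a (D \<phi>)(a \<Lambda>\<^sub>-\<^sub>\<theta> x) da d\<theta> / a\<^sup>3\<close> whose kernel \<open>G\<close> is the Euclidean Fourier transform of \<open>F\<close> in \<open>b\<close>.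
  First, dilations and boosts act simply transitively on the cone, and \<open>D\<close> carries exactly the weight
  which makes \<open>\<phi> \<mapsto> 2\<pi> a (D \<phi>)(a \<Lambda>\<^sub>-\<^sub>\<theta> x)\<close> isometric for every single \<open>x\<close> (\<open>orbit_lift_inner\<close>).
  Bessel's inequality at each \<open>x\<close> then bounds the Hilbert--Schmidt norm by \<open>\<parallel>G\<parallel> / 2\<pi>\<close>.  Second, the
  Plancherel inequality in the plane (\<open>plane_Plancherel\<close>) gives \<open>\<parallel>G\<parallel> \<le> 2\<pi> \<parallel>F\<parallel>\<close>.

  The Wigner transform picks a representative of an operator for every \<open>w\<close> by a choice operator, so
  measurability and linearity of the integrand have to be read off from invariants.  These are the matrix
  coefficients: each of them is integration of \<open>F\<^sub>w\<close> against a fixed square-integrable function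
  (\<open>fourier_matrix_coeff\<close>), and the trace is a double series in them (\<open>op_trace_compose\<close>).
  The series refers to an orthonormal basis over each cone, whose existence is proved from a
  countable total family of indicator functions (\<open>some_basis_cone\<close>).
\<close>

section \<open>Square-integrable functions\<close>

lemma L2_D:
  assumes "f \<in> L2 M"
  shows "f \<in> borel_measurable M" "integrable M (\<lambda>x. (cmod (f x))\<^sup>2)"
  using assms by (auto simp: L2_def)

lemma L2_iff_nn_integral:
  "f \<in> L2 M \<longleftrightarrow> f \<in> borel_measurable M \<and> (\<integral>\<^sup>+x. ennreal ((cmod (f x))\<^sup>2) \<partial>M) < \<infinity>"
  by (auto simp: L2_def integrable_iff_bounded)

lemma L2_norm_nonneg [simp]: "0 \<le> L2_norm M f"
  by (simp add: L2_norm_def)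

lemma L2_norm_sq: "(L2_norm M f)\<^sup>2 = (\<integral>x. (cmod (f x))\<^sup>2 \<partial>M)"
  by (simp add: L2_norm_def)

lemma L2_norm_sq_nn_integral:
  assumes "f \<in> L2 M"
  shows "(\<integral>\<^sup>+x. ennreal ((cmod (f x))\<^sup>2) \<partial>M) = ennreal ((L2_norm M f)\<^sup>2)"
  using L2_D[OF assms] by (simp add: L2_norm_sq nn_integral_eq_integral)

lemma L2_I_nn_integral:
  assumes "f \<in> borel_measurable M" "(\<integral>\<^sup>+x. ennreal ((cmod (f x))\<^sup>2) \<partial>M) \<le> ennreal c" "0 \<le> c"
  shows "f \<in> L2 M" "(L2_norm M f)\<^sup>2 \<le> c"
proof -
  show *: "f \<in> L2 M"
    using assms by (auto simp: L2_iff_nn_integral intro: le_less_trans)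
  show "(L2_norm M f)\<^sup>2 \<le> c"
    using L2_norm_sq_nn_integral[OF *] assms by simp
qed

lemma L2_zero [simp]: "(\<lambda>x. 0) \<in> L2 M"
  by (simp add: L2_def)

lemma L2_cmult: "f \<in> L2 M \<Longrightarrow> (\<lambda>x. c * f x) \<in> L2 M"
  by (auto simp: L2_def norm_mult power_mult_distrib)

lemma borel_measurable_cnj [measurable (raw)]:
  "f \<in> borel_measurable M \<Longrightarrow> (\<lambda>x. cnj (f x)) \<in> borel_measurable M"
  by (rule measurable_compose[OF _ borel_measurable_continuous_onI]) (auto intro: continuous_intros)

lemma L2_cnj: "f \<in> L2 M \<Longrightarrow> (\<lambda>x. cnj (f x)) \<in> L2 M"
  by (auto simp: L2_def)

lemma cmod_add_sq_le: "(cmod (a + b))\<^sup>2 \<le> 2 * (cmod a)\<^sup>2 + 2 * (cmod b)\<^sup>2"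
proof -
  have "(cmod (a + b))\<^sup>2 \<le> (cmod a + cmod b)\<^sup>2"
    by (intro power_mono norm_triangle_ineq) auto
  also have "\<dots> \<le> 2 * (cmod a)\<^sup>2 + 2 * (cmod b)\<^sup>2"
    using sum_squares_bound[of "cmod a" "cmod b"] by (simp add: power2_sum)
  finally show ?thesis .
qed

lemma L2_add:
  assumes "f \<in> L2 M" "g \<in> L2 M"
  shows "(\<lambda>x. f x + g x) \<in> L2 M"
proof -
  note [measurable] = L2_D(1)[OF assms(1)] L2_D(1)[OF assms(2)]
  have "integrable M (\<lambda>x. (cmod (f x + g x))\<^sup>2)"
  proof (rule Bochner_Integration.integrable_bound)
    show "integrable M (\<lambda>x. 2 * (cmod (f x))\<^sup>2 + 2 * (cmod (g x))\<^sup>2)"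
      using L2_D(2)[OF assms(1)] L2_D(2)[OF assms(2)] by auto
  qed (use cmod_add_sq_le in auto)
  then show ?thesis by (simp add: L2_def)
qed

lemma L2_uminus: "f \<in> L2 M \<Longrightarrow> (\<lambda>x. - f x) \<in> L2 M"
  by (auto simp: L2_def)

lemma L2_diff: "f \<in> L2 M \<Longrightarrow> g \<in> L2 M \<Longrightarrow> (\<lambda>x. f x - g x) \<in> L2 M"
  using L2_add[of f M "\<lambda>x. - g x"] L2_uminus[of g M] by simp

lemma L2_lincomb: "f \<in> L2 M \<Longrightarrow> g \<in> L2 M \<Longrightarrow> (\<lambda>x. c * f x + d * g x) \<in> L2 M"
  by (intro L2_add L2_cmult)

lemma L2_sum: "(\<And>i. i \<in> I \<Longrightarrow> f i \<in> L2 M) \<Longrightarrow> (\<lambda>x. \<Sum>i\<in>I. f i x) \<in> L2 M"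
  by (induction I rule: infinite_finite_induct) (auto intro!: L2_add)

lemma L2_dominated:
  assumes "f \<in> L2 M" "g \<in> borel_measurable M" "\<And>x. x \<in> space M \<Longrightarrow> cmod (g x) \<le> cmod (f x)"
  shows "g \<in> L2 M"
proof -
  have "(\<integral>\<^sup>+x. ennreal ((cmod (g x))\<^sup>2) \<partial>M) \<le> (\<integral>\<^sup>+x. ennreal ((cmod (f x))\<^sup>2) \<partial>M)"
    by (intro nn_integral_mono ennreal_leI power_mono) (use assms in auto)
  then show ?thesis using assms by (auto simp: L2_iff_nn_integral intro: le_less_trans)
qed

lemma L2_mult_integrable:
  assumes "f \<in> L2 M" "g \<in> L2 M"
  shows "integrable M (\<lambda>x. f x * g x)"
proof (rule Bochner_Integration.integrable_bound)
  note [measurable] = L2_D(1)[OF assms(1)] L2_D(1)[OF assms(2)]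
  show "integrable M (\<lambda>x. (cmod (f x))\<^sup>2 + (cmod (g x))\<^sup>2)"
    using L2_D(2)[OF assms(1)] L2_D(2)[OF assms(2)] by auto
  show "(\<lambda>x. f x * g x) \<in> borel_measurable M" by measurable
  have "cmod (f x * g x) \<le> (cmod (f x))\<^sup>2 + (cmod (g x))\<^sup>2" for x
    using sum_squares_bound[of "cmod (f x)" "cmod (g x)"]
      mult_nonneg_nonneg[OF norm_ge_zero[of "f x"] norm_ge_zero[of "g x"]]
    unfolding norm_mult by linarith
  then show "AE x in M. norm (f x * g x) \<le> norm ((cmod (f x))\<^sup>2 + (cmod (g x))\<^sup>2)"
    by auto
qed

lemma L2_inner_integrable:
  "f \<in> L2 M \<Longrightarrow> g \<in> L2 M \<Longrightarrow> integrable M (\<lambda>x. f x * cnj (g x))"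
  by (intro L2_mult_integrable L2_cnj)

lemma L2_inner_commute: "L2_inner M g f = cnj (L2_inner M f g)"
  unfolding L2_inner_def by (simp only: Bochner_Integration.integral_cnj[symmetric]) (simp add: mult.commute)

lemma L2_inner_lincomb_left:
  assumes "f \<in> L2 M" "g \<in> L2 M" "h \<in> L2 M"
  shows "L2_inner M (\<lambda>x. c * f x + d * g x) h = c * L2_inner M f h + d * L2_inner M g h"
  using L2_inner_integrable[OF assms(1,3)] L2_inner_integrable[OF assms(2,3)]
  by (simp add: L2_inner_def algebra_simps)

lemma L2_inner_lincomb_right:
  assumes "f \<in> L2 M" "g \<in> L2 M" "h \<in> L2 M"
  shows "L2_inner M h (\<lambda>x. c * f x + d * g x) = cnj c * L2_inner M h f + cnj d * L2_inner M h g"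
  using L2_inner_lincomb_left[OF assms] by (simp add: L2_inner_commute[of M h])

lemma L2_inner_add_left:
  "f \<in> L2 M \<Longrightarrow> g \<in> L2 M \<Longrightarrow> h \<in> L2 M \<Longrightarrow>
   L2_inner M (\<lambda>x. f x + g x) h = L2_inner M f h + L2_inner M g h"
  using L2_inner_lincomb_left[of f M g h 1 1] by simp

lemma L2_inner_diff_left:
  "f \<in> L2 M \<Longrightarrow> g \<in> L2 M \<Longrightarrow> h \<in> L2 M \<Longrightarrow>
   L2_inner M (\<lambda>x. f x - g x) h = L2_inner M f h - L2_inner M g h"
  using L2_inner_lincomb_left[of f M g h 1 "-1"] by simp

lemma L2_inner_cmult_left: "L2_inner M (\<lambda>x. c * f x) h = c * L2_inner M f h"
  by (simp add: L2_inner_def mult.assoc)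

lemma L2_inner_cmult_right: "L2_inner M h (\<lambda>x. c * f x) = cnj c * L2_inner M h f"
  by (simp add: L2_inner_def mult.assoc mult.left_commute)

lemma L2_inner_zero [simp]: "L2_inner M (\<lambda>x. 0) h = 0" "L2_inner M h (\<lambda>x. 0) = 0"
  by (simp_all add: L2_inner_def)

lemma L2_inner_sum_left:
  assumes "\<And>i. i \<in> I \<Longrightarrow> f i \<in> L2 M" "h \<in> L2 M"
  shows "L2_inner M (\<lambda>x. \<Sum>i\<in>I. f i x) h = (\<Sum>i\<in>I. L2_inner M (f i) h)"
  using assms
  by (induction I rule: infinite_finite_induct) (simp_all add: L2_inner_add_left L2_sum)

lemma L2_inner_cong_AE:
  assumes "f \<in> borel_measurable M" "f' \<in> borel_measurable M"
    "g \<in> borel_measurable M" "g' \<in> borel_measurable M"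
    "AE x in M. f x = f' x" "AE x in M. g x = g' x"
  shows "L2_inner M f g = L2_inner M f' g'"
proof -
  note [measurable] = assms(1-4)
  show ?thesis unfolding L2_inner_def
    by (rule integral_cong_AE) (use assms(5,6) in \<open>measurable, auto\<close>)
qed

lemma L2_norm_cong_AE:
  assumes "f \<in> borel_measurable M" "g \<in> borel_measurable M" "AE x in M. f x = g x"
  shows "L2_norm M f = L2_norm M g"
proof -
  note [measurable] = assms(1-2)
  show ?thesis unfolding L2_norm_def
    by (intro arg_cong[where f = sqrt] integral_cong_AE) (use assms(3) in \<open>measurable, auto\<close>)
qed

lemma L2_inner_self: "L2_inner M f f = of_real ((L2_norm M f)\<^sup>2)"
  unfolding L2_norm_sq L2_inner_def
  by (simp only: complex_norm_square[symmetric] integral_complex_of_real)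

lemma L2_norm_eq_0_iff:
  assumes "f \<in> L2 M"
  shows "L2_norm M f = 0 \<longleftrightarrow> (AE x in M. f x = 0)"
  using L2_D[OF assms] integral_nonneg_eq_0_iff_AE[of M "\<lambda>x. (cmod (f x))\<^sup>2"]
  by (auto simp: L2_norm_def)

lemma ennreal_le_if_sq_le:
  assumes "x\<^sup>2 \<le> (ennreal c)\<^sup>2" "0 \<le> c"
  shows "x \<le> ennreal c"
proof (cases x)
  case (real r)
  with assms show ?thesis by (simp add: ennreal_power abs_le_square_iff[symmetric])
next
  case top
  with assms show ?thesis by (simp add: ennreal_power top_unique)
qed

lemma L2_Cauchy_Schwarz_abs:
  assumes "f \<in> L2 M" "g \<in> L2 M"
  shows "(\<integral>\<^sup>+x. ennreal (cmod (f x) * cmod (g x)) \<partial>M) \<le> ennreal (L2_norm M f * L2_norm M g)"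
proof -
  note [measurable] = L2_D(1)[OF assms(1)] L2_D(1)[OF assms(2)]
  have "(\<integral>\<^sup>+x. ennreal (cmod (f x)) * ennreal (cmod (g x)) \<partial>M)\<^sup>2
      \<le> (\<integral>\<^sup>+x. (ennreal (cmod (f x)))\<^sup>2 \<partial>M) * (\<integral>\<^sup>+x. (ennreal (cmod (g x)))\<^sup>2 \<partial>M)"
    by (rule Cauchy_Schwarz_nn_integral) measurable
  also have "\<dots> = ennreal ((L2_norm M f)\<^sup>2) * ennreal ((L2_norm M g)\<^sup>2)"
    by (simp add: ennreal_power L2_norm_sq_nn_integral[OF assms(1)] L2_norm_sq_nn_integral[OF assms(2)])
  also have "\<dots> = (ennreal (L2_norm M f * L2_norm M g))\<^sup>2"
    by (simp add: ennreal_power power_mult_distrib flip: ennreal_mult)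
  finally show ?thesis by (intro ennreal_le_if_sq_le) (simp_all add: ennreal_mult)
qed

lemma L2_integral_mult_le:
  assumes "f \<in> L2 M" "g \<in> L2 M"
  shows "cmod (\<integral>x. f x * g x \<partial>M) \<le> L2_norm M f * L2_norm M g"
proof -
  have "ennreal (cmod (\<integral>x. f x * g x \<partial>M)) \<le> (\<integral>\<^sup>+x. ennreal (cmod (f x * g x)) \<partial>M)"
    by (rule integral_norm_bound_ennreal) (rule L2_mult_integrable[OF assms])
  also have "\<dots> \<le> ennreal (L2_norm M f * L2_norm M g)"
    using L2_Cauchy_Schwarz_abs[OF assms] by (simp add: norm_mult)
  finally show ?thesis by simp
qed

lemma L2_norm_cnj: "L2_norm M (\<lambda>x. cnj (f x)) = L2_norm M f"
  by (simp add: L2_norm_def)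

lemma L2_Cauchy_Schwarz:
  assumes "f \<in> L2 M" "g \<in> L2 M"
  shows "cmod (L2_inner M f g) \<le> L2_norm M f * L2_norm M g"
  using L2_integral_mult_le[OF assms(1) L2_cnj[OF assms(2)]]
  by (simp add: L2_inner_def L2_norm_cnj)

lemma L2_norm_cmult: "L2_norm M (\<lambda>x. c * f x) = cmod c * L2_norm M f"
  by (simp add: L2_norm_def norm_mult power_mult_distrib real_sqrt_mult)

lemma L2_norm_add_sq:
  assumes "f \<in> L2 M" "g \<in> L2 M"
  shows "(L2_norm M (\<lambda>x. f x + g x))\<^sup>2
    = (L2_norm M f)\<^sup>2 + 2 * Re (L2_inner M f g) + (L2_norm M g)\<^sup>2"
proof -
  have r: "Re (L2_inner M h h) = (L2_norm M h)\<^sup>2" for h by (simp add: L2_inner_self)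
  have "L2_inner M (\<lambda>x. f x + g x) (\<lambda>x. f x + g x)
     = L2_inner M f f + L2_inner M f g + (cnj (L2_inner M f g) + L2_inner M g g)"
    using assms L2_inner_lincomb_right[OF assms(1,2), of _ 1 1]
    by (simp add: L2_inner_add_left L2_add L2_inner_commute[of M f g])
  then have "Re (L2_inner M (\<lambda>x. f x + g x) (\<lambda>x. f x + g x))
     = Re (L2_inner M f f) + 2 * Re (L2_inner M f g) + Re (L2_inner M g g)"
    by simp
  then show ?thesis unfolding r .
qed

lemma L2_norm_diff_sq:
  assumes "f \<in> L2 M" "g \<in> L2 M"
  shows "(L2_norm M (\<lambda>x. f x - g x))\<^sup>2
    = (L2_norm M f)\<^sup>2 - 2 * Re (L2_inner M f g) + (L2_norm M g)\<^sup>2"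
  using L2_norm_add_sq[OF assms(1) L2_cmult[OF assms(2), of "-1"]] L2_norm_cmult[of M "-1" g]
    L2_inner_cmult_right[of M f "-1" g] by simp

lemma L2_norm_triangle:
  assumes "f \<in> L2 M" "g \<in> L2 M"
  shows "L2_norm M (\<lambda>x. f x + g x) \<le> L2_norm M f + L2_norm M g"
proof (rule power2_le_imp_le)
  have "Re (L2_inner M f g) \<le> L2_norm M f * L2_norm M g"
    using L2_Cauchy_Schwarz[OF assms] complex_Re_le_cmod order_trans by blast
  then show "(L2_norm M (\<lambda>x. f x + g x))\<^sup>2 \<le> (L2_norm M f + L2_norm M g)\<^sup>2"
    unfolding L2_norm_add_sq[OF assms] by (simp add: power2_sum)
qed simp

lemma L2_norm_diff_commute: "L2_norm M (\<lambda>x. f x - g x) = L2_norm M (\<lambda>x. g x - f x)"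
  by (simp add: L2_norm_def norm_minus_commute)

lemma L2_norm_diff_triangle:
  assumes "f \<in> L2 M" "g \<in> L2 M" "h \<in> L2 M"
  shows "L2_norm M (\<lambda>x. f x - h x) \<le> L2_norm M (\<lambda>x. f x - g x) + L2_norm M (\<lambda>x. g x - h x)"
  using L2_norm_triangle[OF L2_diff[OF assms(1,2)] L2_diff[OF assms(2,3)]] by simp

lemma L2_norm_le_add_diff:
  assumes "f \<in> L2 M" "g \<in> L2 M"
  shows "L2_norm M f \<le> L2_norm M g + L2_norm M (\<lambda>x. f x - g x)"
  using L2_norm_triangle[OF assms(2) L2_diff[OF assms]] by simp

lemma L2_norm_sq_le_double:
  assumes "f \<in> L2 M" "g \<in> L2 M"
  shows "(L2_norm M f)\<^sup>2 \<le> 2 * (L2_norm M g)\<^sup>2 + 2 * (L2_norm M (\<lambda>x. f x - g x))\<^sup>2"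
proof -
  have "(L2_norm M f)\<^sup>2 \<le> (L2_norm M g + L2_norm M (\<lambda>x. f x - g x))\<^sup>2"
    by (intro power_mono L2_norm_le_add_diff assms) simp
  also have "\<dots> \<le> 2 * (L2_norm M g)\<^sup>2 + 2 * (L2_norm M (\<lambda>x. f x - g x))\<^sup>2"
    using sum_squares_bound[of "L2_norm M g" "L2_norm M (\<lambda>x. f x - g x)"] by (simp add: power2_sum)
  finally show ?thesis .
qed

lemma L2_inner_tendsto:
  assumes "\<And>n. F n \<in> L2 M" "f \<in> L2 M" "g \<in> L2 M"
    and "(\<lambda>n. L2_norm M (\<lambda>x. F n x - f x)) \<longlonglongrightarrow> 0"
  shows "(\<lambda>n. L2_inner M (F n) g) \<longlonglongrightarrow> L2_inner M f g"
proof (rule Lim_transform_bound[where g = "\<lambda>n. L2_norm M (\<lambda>x. F n x - f x) * L2_norm M g", THEN LIM_zero_cancel])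
  show "\<forall>\<^sub>F n in sequentially. norm (L2_inner M (F n) g - L2_inner M f g)
      \<le> norm (L2_norm M (\<lambda>x. F n x - f x) * L2_norm M g)"
    using L2_Cauchy_Schwarz[OF L2_diff[OF assms(1,2)] assms(3)]
    by (simp add: L2_inner_diff_left assms)
  show "(\<lambda>n. L2_norm M (\<lambda>x. F n x - f x) * L2_norm M g) \<longlonglongrightarrow> 0"
    using tendsto_mult_right[OF assms(4), of "L2_norm M g"] by simp
qed

lemma L2_norm_tendsto:
  assumes "\<And>n. F n \<in> L2 M" "f \<in> L2 M"
    and "(\<lambda>n. L2_norm M (\<lambda>x. F n x - f x)) \<longlonglongrightarrow> 0"
  shows "(\<lambda>n. L2_norm M (F n)) \<longlonglongrightarrow> L2_norm M f"
proof (rule Lim_transform_bound[OF _ assms(3), THEN LIM_zero_cancel])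
  show "\<forall>\<^sub>F n in sequentially. norm (L2_norm M (F n) - L2_norm M f)
      \<le> norm (L2_norm M (\<lambda>x. F n x - f x))"
    using L2_norm_le_add_diff[OF assms(1,2)] L2_norm_le_add_diff[OF assms(2,1)]
    by (simp add: L2_norm_diff_commute[of M f] abs_le_iff algebra_simps)
qed

text \<open>Dominated convergence for cut-offs.  It supplies both dense subspaces of the proof: the domain of the
  Duflo--Moore operator and the integrable functions on the group.\<close>

lemma L2_cutoff_tendsto:
  assumes f: "f \<in> L2 M" and A: "\<And>n::nat. A n \<in> sets M"
    and ev: "\<And>x. x \<in> space M \<Longrightarrow> f x \<noteq> 0 \<Longrightarrow> \<forall>\<^sub>F n in sequentially. x \<in> A n"
  shows "(\<lambda>n. L2_norm M (\<lambda>x. indicator (A n) x * f x - f x)) \<longlonglongrightarrow> 0"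
proof -
  note [measurable] = L2_D(1)[OF f] A
  have "(\<lambda>n. \<integral>x. (cmod (indicator (A n) x * f x - f x))\<^sup>2 \<partial>M) \<longlonglongrightarrow> (\<integral>x. 0 \<partial>M)"
  proof (rule integral_dominated_convergence)
    show "integrable M (\<lambda>x. (cmod (f x))\<^sup>2)" by (rule L2_D(2)[OF f])
    show "AE x in M. (\<lambda>n. (cmod (indicator (A n) x * f x - f x))\<^sup>2) \<longlonglongrightarrow> 0"
    proof (rule AE_I2)
      fix x assume "x \<in> space M"
      then have "\<forall>\<^sub>F n in sequentially. (cmod (indicator (A n) x * f x - f x))\<^sup>2 = 0"
        using ev[of x] by (cases "f x = 0") (auto elim!: eventually_mono)
      then show "(\<lambda>n. (cmod (indicator (A n) x * f x - f x))\<^sup>2) \<longlonglongrightarrow> 0"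
        by (rule tendsto_eventually)
    qed
    show "AE x in M. norm ((cmod (indicator (A n) x * f x - f x))\<^sup>2) \<le> (cmod (f x))\<^sup>2" for n
      by (rule AE_I2) (auto simp: indicator_def)
  qed measurable
  from tendsto_real_sqrt[OF this] show ?thesis by (simp add: L2_norm_def)
qed

section \<open>Completeness and the Riesz representation theorem\<close>

text \<open>A sequence whose steps are square-summable with geometric weights converges almost everywhere:
  the weights turn square-summability of the steps into absolute summability.\<close>

lemma summable_norm_of_weighted_squares:
  fixes d :: "nat \<Rightarrow> complex"
  assumes "(\<Sum>n. ennreal (2 ^ n * (cmod (d n))\<^sup>2)) < \<infinity>"
  shows "summable d"
proof -
  have s1: "summable (\<lambda>n. 2 ^ n * (cmod (d n))\<^sup>2)"
    using assms by (intro summable_suminf_not_top) auto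
  have s2: "summable (\<lambda>n. (1/2::real) ^ n)" by (rule summable_geometric) simp
  show ?thesis
  proof (rule summable_comparison_test')
    show "summable (\<lambda>n. 2 ^ n * (cmod (d n))\<^sup>2 + (1/2::real) ^ n)" by (rule summable_add[OF s1 s2])
    show "cmod (d n) \<le> 2 ^ n * (cmod (d n))\<^sup>2 + (1/2::real) ^ n" if "0 \<le> n" for n
    proof -
      have p: "(2::real) ^ n * (1/2) ^ n = 1" by (simp add: power_one_over)
      have "0 \<le> 2 ^ n * (cmod (d n) - (1/2) ^ n)\<^sup>2" by simp
      also have "\<dots> = 2 ^ n * (cmod (d n))\<^sup>2 - 2 * (2 ^ n * (1/2) ^ n) * cmod (d n)
          + (2 ^ n * (1/2) ^ n) * (1/2) ^ n"
        by (simp add: power2_diff algebra_simps power2_eq_square)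
      also have "\<dots> = 2 ^ n * (cmod (d n))\<^sup>2 - 2 * cmod (d n) + (1/2) ^ n" by (simp add: p)
      finally show ?thesis using norm_ge_zero[of "d n"] by linarith
    qed
  qed
qed

text \<open>The Riesz--Fischer theorem.  A subsequence with geometrically small steps converges almost everywhere, and
  Fatou's lemma shows that the pointwise limit is also the limit in norm.\<close>

lemma L2_complete:
  assumes F: "\<And>n. F n \<in> L2 M"
    and Cauchy: "\<And>e. e > 0 \<Longrightarrow> \<exists>N. \<forall>m\<ge>N. \<forall>n\<ge>N. L2_norm M (\<lambda>x. F m x - F n x) < e"
  shows "\<exists>g\<in>L2 M. (\<lambda>n. L2_norm M (\<lambda>x. F n x - g x)) \<longlonglongrightarrow> 0"
proof -
  have "\<exists>N. \<forall>k. \<forall>m\<ge>N k. \<forall>n\<ge>N k. L2_norm M (\<lambda>x. F m x - F n x) < (1/2) ^ k"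
    using Cauchy[of "(1/2) ^ k" for k] by (intro choice) auto
  then obtain N where N: "\<And>k m n. m \<ge> N k \<Longrightarrow> n \<ge> N k \<Longrightarrow> L2_norm M (\<lambda>x. F m x - F n x) < (1/2) ^ k"
    by blast
  define r where "r k = (\<Sum>i\<le>k. N i)" for k
  have rN: "N k \<le> r k" for k unfolding r_def by (rule member_le_sum) auto
  have r_mono: "r k \<le> r l" if "k \<le> l" for k l
    unfolding r_def by (rule sum_mono2) (use that in auto)
  define G where "G k = F (r k)" for k
  have [measurable]: "F n \<in> borel_measurable M" for n by (rule L2_D[OF F])
  have G: "G k \<in> L2 M" for k by (simp add: G_def F)
  have [measurable]: "G n \<in> borel_measurable M" for n by (simp add: G_def)
  define d where "d k x = G (Suc k) x - G k x" for k x
  have d: "d k \<in> L2 M" for k unfolding d_def by (intro L2_diff G)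
  have [measurable]: "d n \<in> borel_measurable M" for n by (rule L2_D[OF d])
  have dn: "(L2_norm M (d k))\<^sup>2 \<le> (1/4) ^ k" for k
  proof -
    have "L2_norm M (d k) \<le> (1/2) ^ k"
      unfolding d_def G_def
      by (rule less_imp_le, rule N) (use rN[of k] r_mono[of k "Suc k"] in auto)
    then have "(L2_norm M (d k))\<^sup>2 \<le> ((1/2) ^ k)\<^sup>2" by (intro power_mono) auto
    then show ?thesis by (simp add: power_mult[symmetric] power_mult mult.commute power2_eq_square flip: power_mult_distrib)
  qed
  have "(\<integral>\<^sup>+x. (\<Sum>k. ennreal (2 ^ k * (cmod (d k x))\<^sup>2)) \<partial>M)
      = (\<Sum>k. \<integral>\<^sup>+x. ennreal (2 ^ k * (cmod (d k x))\<^sup>2) \<partial>M)"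
    by (rule nn_integral_suminf) measurable
  also have "\<dots> = (\<Sum>k. ennreal (2 ^ k * (L2_norm M (d k))\<^sup>2))"
    by (simp add: ennreal_mult nn_integral_cmult L2_norm_sq_nn_integral[OF d])
  also have "\<dots> \<le> (\<Sum>k. ennreal ((1/2) ^ k))"
  proof (intro suminf_le ennreal_leI)
    show "2 ^ k * (L2_norm M (d k))\<^sup>2 \<le> (1/2) ^ k" for k
    proof -
      have "2 ^ k * (L2_norm M (d k))\<^sup>2 \<le> 2 ^ k * (1/4) ^ k" using dn by (intro mult_left_mono) auto
      also have "\<dots> = (1/2) ^ k" by (simp flip: power_mult_distrib)
      finally show ?thesis .
    qed
  qed auto
  also have "\<dots> < \<infinity>"
    by (subst suminf_ennreal2) (auto intro: summable_geometric)
  finally have "AE x in M. (\<Sum>k. ennreal (2 ^ k * (cmod (d k x))\<^sup>2)) \<noteq> \<infinity>"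
    by (intro nn_integral_PInf_AE) auto
  then have conv: "AE x in M. convergent (\<lambda>k. G k x)"
  proof (rule AE_mp, intro AE_I2 impI)
    fix x assume "(\<Sum>k. ennreal (2 ^ k * (cmod (d k x))\<^sup>2)) \<noteq> \<infinity>"
    then have "summable (\<lambda>k. d k x)"
      by (intro summable_norm_of_weighted_squares) (auto simp: top.not_eq_extremum)
    then have "convergent (\<lambda>k. \<Sum>i<k. d i x)" by (simp add: summable_iff_convergent)
    moreover have "(\<Sum>i<k. d i x) = G k x - G 0 x" for k
      unfolding d_def by (rule sum_lessThan_telescope)
    ultimately have "convergent (\<lambda>k. G k x - G 0 x)" by simp
    then have "convergent (\<lambda>k. (G k x - G 0 x) + G 0 x)"
      by (intro convergent_add convergent_const)
    then show "convergent (\<lambda>k. G k x)" by simp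
  qed
  define g where "g x = lim (\<lambda>k. G k x)" for x
  have [measurable]: "g \<in> borel_measurable M"
    unfolding g_def by (rule borel_measurable_lim_metric) auto
  have lim: "AE x in M. (\<lambda>k. G k x) \<longlonglongrightarrow> g x"
    using conv by eventually_elim (simp add: g_def convergent_LIMSEQ_iff)
  (* Fatou's lemma turns the Cauchy estimate into an estimate for the distance to the limit. *)
  have bound: "(\<integral>\<^sup>+x. ennreal ((cmod (F m x - g x))\<^sup>2) \<partial>M) \<le> ennreal (((1/2) ^ k)\<^sup>2)"
    if m: "m \<ge> N k" for m k
  proof -
    have "(\<integral>\<^sup>+x. ennreal ((cmod (F m x - g x))\<^sup>2) \<partial>M)
      \<le> (\<integral>\<^sup>+x. liminf (\<lambda>n. ennreal ((cmod (F m x - G n x))\<^sup>2)) \<partial>M)"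
    proof (rule nn_integral_mono_AE)
      show "AE x in M. ennreal ((cmod (F m x - g x))\<^sup>2)
          \<le> liminf (\<lambda>n. ennreal ((cmod (F m x - G n x))\<^sup>2))"
        using lim
      proof eventually_elim
        case (elim x)
        then have "(\<lambda>n. ennreal ((cmod (F m x - G n x))\<^sup>2)) \<longlonglongrightarrow> ennreal ((cmod (F m x - g x))\<^sup>2)"
          by (intro tendsto_ennrealI tendsto_intros)
        from lim_imp_Liminf[OF _ this] show ?case by simp
      qed
    qed
    also have "\<dots> \<le> liminf (\<lambda>n. \<integral>\<^sup>+x. ennreal ((cmod (F m x - G n x))\<^sup>2) \<partial>M)"
      by (rule nn_integral_liminf) measurable
    also have "\<dots> \<le> ennreal (((1/2) ^ k)\<^sup>2)"
    proof (rule Liminf_le)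
      show "\<forall>\<^sub>F n in sequentially. (\<integral>\<^sup>+x. ennreal ((cmod (F m x - G n x))\<^sup>2) \<partial>M) \<le> ennreal (((1/2) ^ k)\<^sup>2)"
        using eventually_ge_at_top[of k]
      proof eventually_elim
        case (elim n)
        have "L2_norm M (\<lambda>x. F m x - G n x) \<le> (1/2) ^ k"
          unfolding G_def
          by (rule less_imp_le, rule N[OF m]) (use rN[of k] r_mono[OF elim] in auto)
        then have "(L2_norm M (\<lambda>x. F m x - G n x))\<^sup>2 \<le> ((1/2) ^ k)\<^sup>2"
          by (intro power_mono) auto
        then show ?case
          using L2_norm_sq_nn_integral[OF L2_diff[OF F G]] by (simp add: ennreal_leI)
      qed
    qed simp
    finally show ?thesis .
  qed
  have diff: "(\<lambda>x. F m x - g x) \<in> L2 M \<and> L2_norm M (\<lambda>x. F m x - g x) \<le> (1/2) ^ k" if "m \<ge> N k" for m k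
  proof -
    have "(\<lambda>x. F m x - g x) \<in> L2 M \<and> (L2_norm M (\<lambda>x. F m x - g x))\<^sup>2 \<le> ((1/2) ^ k)\<^sup>2"
      using bound[OF that] by (intro conjI L2_I_nn_integral[of _ _ "((1/2) ^ k)\<^sup>2"]) auto
    then show ?thesis by (auto intro: power2_le_imp_le)
  qed
  have "g \<in> L2 M"
    using L2_diff[OF F diff[THEN conjunct1, OF order_refl], of "N 0" 0] by simp
  moreover have "(\<lambda>n. L2_norm M (\<lambda>x. F n x - g x)) \<longlonglongrightarrow> 0"
  proof (rule LIMSEQ_I)
    fix e :: real assume "e > 0"
    then obtain k where k: "(1/2::real) ^ k < e" using real_arch_pow_inv[of e "1/2"] by auto
    show "\<exists>no. \<forall>n\<ge>no. norm (L2_norm M (\<lambda>x. F n x - g x) - 0) < e"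
      using diff[of k] k by (intro exI[of _ "N k"]) force
  qed
  ultimately show ?thesis by blast
qed

text \<open>The Riesz theorem, obtained by minimising \<open>\<parallel>h\<parallel>\<^sup>2 - 2 Re (\<Phi> h)\<close>: the parallelogram law makes
  minimising sequences Cauchy.  Working on a subspace \<open>V\<close> that need not be closed allows functionals that
  are only defined on a dense set, such as those given by integrals over integrable functions.\<close>

lemma L2_Riesz_representation:
  assumes V: "V \<subseteq> L2 M" "(\<lambda>x. 0) \<in> V"
    "\<And>f g c d. f \<in> V \<Longrightarrow> g \<in> V \<Longrightarrow> (\<lambda>x. c * f x + d * g x) \<in> V"
    and lin: "\<And>f g c d. f \<in> V \<Longrightarrow> g \<in> V \<Longrightarrow> \<Phi> (\<lambda>x. c * f x + d * g x) = c * \<Phi> f + d * \<Phi> g"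
    and bdd: "\<And>f. f \<in> V \<Longrightarrow> cmod (\<Phi> f) \<le> C * L2_norm M f"
  shows "\<exists>h\<in>L2 M. \<forall>f\<in>V. \<Phi> f = L2_inner M f h"
proof -
  define J where "J h = (L2_norm M h)\<^sup>2 - 2 * Re (\<Phi> h)" for h
  have VL: "h \<in> L2 M" if "h \<in> V" for h using V that by auto
  have J_bdd: "J h \<ge> - (C\<^sup>2)" if "h \<in> V" for h
  proof -
    have "Re (\<Phi> h) \<le> C * L2_norm M h" using bdd[OF that] complex_Re_le_cmod order_trans by blast
    moreover have "0 \<le> (L2_norm M h - C)\<^sup>2" by simp
    ultimately show ?thesis by (simp add: J_def power2_diff mult.commute)
  qed
  have J_bdd_below: "bdd_below (J ` V)" using J_bdd by (intro bdd_belowI2[where m = "- (C\<^sup>2)"]) auto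
  define m where "m = Inf (J ` V)"
  have m_le: "m \<le> J h" if "h \<in> V" for h
    unfolding m_def by (rule cInf_lower) (use that J_bdd_below in auto)
  have "\<exists>h\<in>V. J h < m + 1 / real (Suc n)" for n
  proof -
    have "Inf (J ` V) < m + 1 / real (Suc n)" by (simp add: m_def)
    then show ?thesis using V J_bdd_below by (subst (asm) cInf_less_iff) auto
  qed
  then obtain H where HV: "\<And>n. H n \<in> V" and HJ: "\<And>n. J (H n) < m + 1 / real (Suc n)"
    by metis
  have H: "H n \<in> L2 M" for n by (rule VL[OF HV])
  have par: "(L2_norm M (\<lambda>x. f x - g x))\<^sup>2 \<le> 2 * (J f - m) + 2 * (J g - m)" if f: "f \<in> V" and g: "g \<in> V" for f g
  proof -
    let ?a = "\<lambda>x. (1/2) * f x + (1/2) * g x"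
    have fg: "f \<in> L2 M" "g \<in> L2 M" using f g VL by auto
    have "m \<le> J ?a" by (intro m_le V f g)
    also have "J ?a = (L2_norm M (\<lambda>x. f x + g x))\<^sup>2 / 4 - Re (\<Phi> f) - Re (\<Phi> g)"
    proof -
      have "(\<lambda>x. (1/2) * f x + (1/2) * g x) = (\<lambda>x. (1/2) * (f x + g x))"
        by (simp add: add_divide_distrib)
      then have n: "L2_norm M ?a = L2_norm M (\<lambda>x. f x + g x) / 2"
        by (simp only: L2_norm_cmult) simp
      show ?thesis unfolding J_def lin[OF f g] n by (simp add: power_divide)
    qed
    finally have "m \<le> (L2_norm M (\<lambda>x. f x + g x))\<^sup>2 / 4 - Re (\<Phi> f) - Re (\<Phi> g)" .
    then show ?thesis
      unfolding J_def L2_norm_add_sq[OF fg] L2_norm_diff_sq[OF fg] by argo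
  qed
  have "\<exists>h\<in>L2 M. (\<lambda>n. L2_norm M (\<lambda>x. H n x - h x)) \<longlonglongrightarrow> 0"
  proof (rule L2_complete[OF H])
    fix e :: real assume e: "e > 0"
    then obtain N where N: "1 / real (Suc N) < e\<^sup>2 / 4"
      using reals_Archimedean[of "e\<^sup>2/4"] by (auto simp: inverse_eq_divide)
    show "\<exists>N. \<forall>p\<ge>N. \<forall>q\<ge>N. L2_norm M (\<lambda>x. H p x - H q x) < e"
    proof (intro exI allI impI)
      fix p q assume pq: "p \<ge> N" "q \<ge> N"
      have quarter: "x < c" if "x \<le> 2 * a + 2 * b" "a < c / 4" "b < c / 4" for x a b c :: real
        using that by linarith
      have *: "J (H k) - m < e\<^sup>2 / 4" if "k \<ge> N" for k
      proof -
        have "1 / real (Suc k) \<le> 1 / real (Suc N)" using that by (intro divide_left_mono) auto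
        then show ?thesis using HJ[of k] N by linarith
      qed
      have "(L2_norm M (\<lambda>x. H p x - H q x))\<^sup>2 < e\<^sup>2"
        by (rule quarter[OF par[OF HV HV] *[OF pq(1)] *[OF pq(2)]])
      then show "L2_norm M (\<lambda>x. H p x - H q x) < e"
        by (rule power2_less_imp_less) (use e in auto)
    qed
  qed
  then obtain h where h: "h \<in> L2 M" and Hh: "(\<lambda>n. L2_norm M (\<lambda>x. H n x - h x)) \<longlonglongrightarrow> 0" by auto
  (* The first variation vanishes at the minimiser.  It is computed along the minimising sequence
     because the limit h need not belong to V, where the functional is defined. *)
  have var: "Re (L2_inner M g h) = Re (\<Phi> g)" if g: "g \<in> V" for g
  proof -
    have gL: "g \<in> L2 M" by (rule VL[OF g])
    have ineq: "0 \<le> 2 * t * (Re (L2_inner M h g) - Re (\<Phi> g)) + t\<^sup>2 * (L2_norm M g)\<^sup>2" for t :: real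
    proof (rule LIMSEQ_le)
      show "(\<lambda>n. - (1 / real (Suc n))) \<longlonglongrightarrow> 0"
        using LIMSEQ_inverse_real_of_nat tendsto_minus by (fastforce simp: inverse_eq_divide)
      show "(\<lambda>n. 2 * t * (Re (L2_inner M (H n) g) - Re (\<Phi> g)) + t\<^sup>2 * (L2_norm M g)\<^sup>2)
        \<longlonglongrightarrow> 2 * t * (Re (L2_inner M h g) - Re (\<Phi> g)) + t\<^sup>2 * (L2_norm M g)\<^sup>2"
        by (intro tendsto_intros L2_inner_tendsto H h gL Hh)
      show "\<exists>N. \<forall>n\<ge>N. - (1 / real (Suc n))
          \<le> 2 * t * (Re (L2_inner M (H n) g) - Re (\<Phi> g)) + t\<^sup>2 * (L2_norm M g)\<^sup>2"
      proof (intro exI allI impI)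
        fix n
        have eq: "(\<lambda>x. 1 * H n x + of_real t * g x) = (\<lambda>x. H n x + of_real t * g x)" by simp
        have "m \<le> J (\<lambda>x. 1 * H n x + of_real t * g x)" by (intro m_le V HV g)
        also have "\<dots> = J (H n) + 2 * t * (Re (L2_inner M (H n) g) - Re (\<Phi> g)) + t\<^sup>2 * (L2_norm M g)\<^sup>2"
          unfolding J_def lin[OF HV g]
          unfolding eq L2_norm_add_sq[OF H L2_cmult[OF gL]] L2_inner_cmult_right L2_norm_cmult
          by (simp add: power_mult_distrib algebra_simps)
        finally show "- (1 / real (Suc n))
          \<le> 2 * t * (Re (L2_inner M (H n) g) - Re (\<Phi> g)) + t\<^sup>2 * (L2_norm M g)\<^sup>2"
          using HJ[of n] by linarith
      qed
    qed
    define A where "A = Re (L2_inner M h g) - Re (\<Phi> g)"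
    define B where "B = (L2_norm M g)\<^sup>2 + 1"
    have B: "B > 0" by (simp add: B_def add_nonneg_pos)
    (* The value t = - A / B nearly minimises the quadratic; the summand 1 in B covers the case that g has norm 0. *)
    have "0 \<le> 2 * (- A / B) * A + (- A / B)\<^sup>2 * (L2_norm M g)\<^sup>2"
      using ineq[of "- A / B"] by (simp add: A_def)
    also have "\<dots> \<le> 2 * (- A / B) * A + (- A / B)\<^sup>2 * B"
      by (intro add_left_mono mult_left_mono) (auto simp: B_def)
    also have "\<dots> = - (A\<^sup>2 / B)" using B by (simp add: power2_eq_square field_simps)
    finally have "A\<^sup>2 \<le> 0" using B by (simp add: divide_le_0_iff)
    then have "A = 0" by simp
    moreover have "Re (L2_inner M h g) = Re (L2_inner M g h)" by (simp add: L2_inner_commute[of M h g])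
    ultimately show ?thesis by (simp add: A_def)
  qed
  have "\<Phi> f = L2_inner M f h" if f: "f \<in> V" for f
  proof (rule complex_eqI)
    show "Re (\<Phi> f) = Re (L2_inner M f h)" using var[OF f] by simp
    have g: "(\<lambda>x. (- \<i>) * f x + 0 * f x) \<in> V" by (intro V f)
    show "Im (\<Phi> f) = Im (L2_inner M f h)"
      using var[OF g] lin[OF f f, of "- \<i>" 0] L2_inner_cmult_left[of M "- \<i>" f h] by simp
  qed
  then show ?thesis using h by blast
qed

section \<open>Orthonormal bases\<close>

definition orthonormal_family :: "'a measure \<Rightarrow> 'i set \<Rightarrow> ('i \<Rightarrow> 'a \<Rightarrow> complex) \<Rightarrow> bool" where
  "orthonormal_family M I e \<longleftrightarrow>
     (\<forall>i\<in>I. e i \<in> L2 M) \<and> (\<forall>i\<in>I. \<forall>j\<in>I. L2_inner M (e i) (e j) = (if i = j then 1 else 0))"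

lemma orthonormal_family_L2: "orthonormal_family M I e \<Longrightarrow> i \<in> I \<Longrightarrow> e i \<in> L2 M"
  by (simp add: orthonormal_family_def)

lemma orthonormal_family_subset: "orthonormal_family M I e \<Longrightarrow> J \<subseteq> I \<Longrightarrow> orthonormal_family M J e"
  by (simp add: orthonormal_family_def subset_iff)

lemma orthonormal_family_inner:
  "orthonormal_family M I e \<Longrightarrow> i \<in> I \<Longrightarrow> j \<in> I \<Longrightarrow> L2_inner M (e i) (e j) = (if i = j then 1 else 0)"
  by (simp add: orthonormal_family_def)

lemma orthonormal_sum_L2:
  "orthonormal_family M I e \<Longrightarrow> (\<lambda>x. \<Sum>i\<in>I. c i * e i x) \<in> L2 M"
  by (intro L2_sum L2_cmult orthonormal_family_L2)

lemma orthonormal_sum_coefficient: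
  assumes "orthonormal_family M I e" "finite J" "J \<subseteq> I" "k \<in> I"
  shows "L2_inner M (\<lambda>x. \<Sum>i\<in>J. c i * e i x) (e k) = (if k \<in> J then c k else 0)"
proof -
  have "L2_inner M (\<lambda>x. \<Sum>i\<in>J. c i * e i x) (e k) = (\<Sum>i\<in>J. c i * L2_inner M (e i) (e k))"
    using assms by (subst L2_inner_sum_left) (auto intro!: L2_cmult orthonormal_family_L2 simp: L2_inner_cmult_left)
  also have "\<dots> = (\<Sum>i\<in>J. if i = k then c k else 0)"
    using assms by (intro sum.cong) (auto simp: orthonormal_family_inner)
  finally show ?thesis using assms by simp
qed

lemma inner_orthonormal_sum:
  assumes "orthonormal_family M I e" "finite I" "f \<in> L2 M"
  shows "L2_inner M f (\<lambda>x. \<Sum>i\<in>I. c i * e i x) = (\<Sum>i\<in>I. cnj (c i) * L2_inner M f (e i))"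
proof -
  have "L2_inner M (\<lambda>x. \<Sum>i\<in>I. c i * e i x) f = (\<Sum>i\<in>I. c i * L2_inner M (e i) f)"
    using assms by (subst L2_inner_sum_left) (auto intro!: L2_cmult orthonormal_family_L2 simp: L2_inner_cmult_left)
  from arg_cong[OF this, of cnj] show ?thesis
    by (simp add: L2_inner_commute[symmetric])
qed

lemma orthonormal_sum_norm_sq:
  assumes "orthonormal_family M I e" "finite I"
  shows "(L2_norm M (\<lambda>x. \<Sum>i\<in>I. c i * e i x))\<^sup>2 = (\<Sum>i\<in>I. (cmod (c i))\<^sup>2)"
proof -
  have "L2_inner M (\<lambda>x. \<Sum>i\<in>I. c i * e i x) (\<lambda>x. \<Sum>i\<in>I. c i * e i x) = (\<Sum>i\<in>I. of_real ((cmod (c i))\<^sup>2))"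
    unfolding inner_orthonormal_sum[OF assms orthonormal_sum_L2[OF assms(1)]]
    by (intro sum.cong refl) (use assms in \<open>simp add: orthonormal_sum_coefficient complex_norm_square mult.commute del: of_real_power\<close>)
  then have "complex_of_real ((L2_norm M (\<lambda>x. \<Sum>i\<in>I. c i * e i x))\<^sup>2) = of_real (\<Sum>i\<in>I. (cmod (c i))\<^sup>2)"
    unfolding L2_inner_self by simp
  then show ?thesis unfolding of_real_eq_iff .
qed

lemma Bessel_identity:
  assumes "orthonormal_family M I e" "finite I" "f \<in> L2 M"
  shows "(L2_norm M (\<lambda>x. f x - (\<Sum>i\<in>I. L2_inner M f (e i) * e i x)))\<^sup>2
    = (L2_norm M f)\<^sup>2 - (\<Sum>i\<in>I. (cmod (L2_inner M f (e i)))\<^sup>2)"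
proof -
  have "L2_inner M f (\<lambda>x. \<Sum>i\<in>I. L2_inner M f (e i) * e i x) = (\<Sum>i\<in>I. of_real ((cmod (L2_inner M f (e i)))\<^sup>2))"
    unfolding inner_orthonormal_sum[OF assms]
    by (intro sum.cong refl) (simp add: complex_norm_square mult.commute del: of_real_power)
  then have "Re (L2_inner M f (\<lambda>x. \<Sum>i\<in>I. L2_inner M f (e i) * e i x)) = (\<Sum>i\<in>I. (cmod (L2_inner M f (e i)))\<^sup>2)"
    by (simp del: of_real_power)
  then show ?thesis
    by (simp add: L2_norm_diff_sq[OF assms(3) orthonormal_sum_L2[OF assms(1)]] orthonormal_sum_norm_sq[OF assms(1,2)])
qed

lemma Bessel_finite:
  assumes "orthonormal_family M I e" "finite I" "f \<in> L2 M"
  shows "(\<Sum>i\<in>I. (cmod (L2_inner M f (e i)))\<^sup>2) \<le> (L2_norm M f)\<^sup>2"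
  using Bessel_identity[OF assms] zero_le_power2[of "L2_norm M (\<lambda>x. f x - (\<Sum>i\<in>I. L2_inner M f (e i) * e i x))"]
  by linarith

lemma Bessel_ennreal:
  fixes e :: "nat \<Rightarrow> 'a \<Rightarrow> complex"
  assumes "orthonormal_family M UNIV e" "f \<in> L2 M"
  shows "(\<Sum>n. ennreal ((cmod (L2_inner M f (e n)))\<^sup>2)) \<le> ennreal ((L2_norm M f)\<^sup>2)"
proof (rule suminf_le_const)
  show "sum (\<lambda>n. ennreal ((cmod (L2_inner M f (e n)))\<^sup>2)) {..<n} \<le> ennreal ((L2_norm M f)\<^sup>2)" for n
    using Bessel_finite[OF orthonormal_family_subset[OF assms(1)], of "{..<n}" f] assms(2)
    by (simp add: sum_ennreal ennreal_leI)
qed auto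

lemma orthonormal_basis_family: "orthonormal_basis M e \<Longrightarrow> orthonormal_family M I e"
  by (simp add: orthonormal_basis_def orthonormal_family_def)

text \<open>The partial sums are Cauchy by Bessel's inequality; their limit has the same coefficients as \<open>f\<close>, so totality
  identifies the two.\<close>

lemma orthonormal_basis_expansion:
  assumes e: "orthonormal_basis M e" and f: "f \<in> L2 M"
  shows "(\<lambda>N. L2_norm M (\<lambda>x. (\<Sum>k<N. L2_inner M f (e k) * e k x) - f x)) \<longlonglongrightarrow> 0"
proof -
  define c where "c k = L2_inner M f (e k)" for k
  define s where "s N x = (\<Sum>k<N. c k * e k x)" for N x
  note ON = orthonormal_basis_family[OF e]
  have eL: "e k \<in> L2 M" for k using ON[of UNIV] by (auto simp: orthonormal_family_def)
  have s: "s N \<in> L2 M" for N unfolding s_def by (rule orthonormal_sum_L2[OF ON])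
  have sc: "L2_inner M (s N) (e k) = (if k < N then c k else 0)" for N k
    unfolding s_def using orthonormal_sum_coefficient[OF ON[of UNIV], of "{..<N}"] by simp
  have "(\<Sum>k<N. (cmod (c k))\<^sup>2) \<le> (L2_norm M f)\<^sup>2" for N
    unfolding c_def by (rule Bessel_finite[OF ON _ f]) simp
  then have "(\<Sum>k\<le>N. (cmod (c k))\<^sup>2) \<le> (L2_norm M f)\<^sup>2" for N
    unfolding lessThan_Suc_atMost[symmetric] .
  then have "summable (\<lambda>k. (cmod (c k))\<^sup>2)" by (rule bounded_imp_summable[rotated]) simp
  then have Cau: "Cauchy (\<lambda>N. \<Sum>k<N. (cmod (c k))\<^sup>2)"
    by (simp add: summable_iff_convergent Cauchy_convergent_iff)
  have dist: "(L2_norm M (\<lambda>x. s n x - s m x))\<^sup>2 = (\<Sum>k<n. (cmod (c k))\<^sup>2) - (\<Sum>k<m. (cmod (c k))\<^sup>2)" if "m \<le> n" for m n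
  proof -
    have "(L2_norm M (\<lambda>x. s n x - (\<Sum>k<m. L2_inner M (s n) (e k) * e k x)))\<^sup>2
      = (L2_norm M (s n))\<^sup>2 - (\<Sum>k<m. (cmod (L2_inner M (s n) (e k)))\<^sup>2)"
      by (rule Bessel_identity[OF ON _ s]) simp
    moreover have "(\<Sum>k<m. L2_inner M (s n) (e k) * e k x) = s m x" for x
      unfolding s_def[of m] using that by (intro sum.cong) (auto simp: sc)
    moreover have "(\<Sum>k<m. (cmod (L2_inner M (s n) (e k)))\<^sup>2) = (\<Sum>k<m. (cmod (c k))\<^sup>2)"
      using that by (intro sum.cong) (auto simp: sc)
    moreover have "(L2_norm M (s n))\<^sup>2 = (\<Sum>k<n. (cmod (c k))\<^sup>2)"
      unfolding s_def by (rule orthonormal_sum_norm_sq[OF ON]) simp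
    ultimately show ?thesis by simp
  qed
  have "\<exists>g\<in>L2 M. (\<lambda>n. L2_norm M (\<lambda>x. s n x - g x)) \<longlonglongrightarrow> 0"
  proof (rule L2_complete[OF s])
    fix r :: real assume r: "r > 0"
    then obtain N where N: "\<And>m n. m \<ge> N \<Longrightarrow> n \<ge> N \<Longrightarrow>
        \<bar>(\<Sum>k<m. (cmod (c k))\<^sup>2) - (\<Sum>k<n. (cmod (c k))\<^sup>2)\<bar> < r\<^sup>2"
      using CauchyD[OF Cau, of "r\<^sup>2"] by auto
    have *: "L2_norm M (\<lambda>x. s m x - s n x) < r" if "m \<ge> N" "n \<ge> N" "n \<le> m" for m n
      by (rule power2_less_imp_less) (use dist[of n m] N[of m n] that r in auto)
    show "\<exists>N. \<forall>m\<ge>N. \<forall>n\<ge>N. L2_norm M (\<lambda>x. s m x - s n x) < r"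
      using * L2_norm_diff_commute by (metis nle_le)
  qed
  then obtain g where g: "g \<in> L2 M" and sg: "(\<lambda>n. L2_norm M (\<lambda>x. s n x - g x)) \<longlonglongrightarrow> 0" by auto
  have "L2_inner M g (e k) = c k" for k
  proof (rule LIMSEQ_unique[OF L2_inner_tendsto[OF s g eL sg]])
    show "(\<lambda>n. L2_inner M (s n) (e k)) \<longlonglongrightarrow> c k"
      by (rule tendsto_eventually) (use eventually_gt_at_top[of k] in \<open>eventually_elim, simp add: sc\<close>)
  qed
  then have "AE x in M. g x - f x = 0"
    using e L2_diff[OF g f] unfolding orthonormal_basis_def
    by (auto simp: L2_inner_diff_left[OF g f eL] c_def)
  then have "L2_norm M (\<lambda>x. s n x - g x) = L2_norm M (\<lambda>x. s n x - f x)" for n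
    by (intro L2_norm_cong_AE L2_D(1)[OF L2_diff] s g f) auto
  then show ?thesis using sg unfolding s_def c_def by simp
qed

lemma Parseval:
  assumes e: "orthonormal_basis M e" and f: "f \<in> L2 M"
  shows "(\<lambda>k. (cmod (L2_inner M f (e k)))\<^sup>2) sums (L2_norm M f)\<^sup>2"
proof -
  note ON = orthonormal_basis_family[OF e]
  have "(L2_norm M (\<lambda>x. (\<Sum>k<N. L2_inner M f (e k) * e k x) - f x))\<^sup>2
      = (L2_norm M f)\<^sup>2 - (\<Sum>k<N. (cmod (L2_inner M f (e k)))\<^sup>2)" for N
    using Bessel_identity[OF ON _ f, of "{..<N}"] by (simp add: L2_norm_diff_commute[of M _ f])
  then have "(\<lambda>N. (L2_norm M f)\<^sup>2 - (\<Sum>k<N. (cmod (L2_inner M f (e k)))\<^sup>2)) \<longlonglongrightarrow> 0"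
    using tendsto_power[OF orthonormal_basis_expansion[OF e f], of 2] by simp
  from tendsto_diff[OF tendsto_const[of "(L2_norm M f)\<^sup>2"] this]
  show ?thesis by (simp add: sums_def)
qed

lemma Parseval_ennreal:
  assumes "orthonormal_basis M e" "f \<in> L2 M"
  shows "(\<Sum>k. ennreal ((cmod (L2_inner M f (e k)))\<^sup>2)) = ennreal ((L2_norm M f)\<^sup>2)"
  using Parseval[OF assms] by (subst suminf_ennreal2) (auto simp: sums_iff)

text \<open>Existence: a maximal orthonormal set is total.  It is countable because every member has
  a non-zero coefficient against one of countably many total vectors, and by Bessel each vector has
  only countably many non-zero coefficients.  It is infinite because
  summing the Parseval identities of \<open>N + 1\<close> orthonormal vectors against a basis of \<open>N\<close>
  elements would give \<open>N + 1 \<le> N\<close>.\<close>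

lemma orthonormal_basis_exists:
  fixes v g :: "nat \<Rightarrow> 'a \<Rightarrow> complex"
  assumes v: "\<And>k. v k \<in> L2 M"
    and total: "\<And>f. f \<in> L2 M \<Longrightarrow> (\<And>k. L2_inner M f (v k) = 0) \<Longrightarrow> AE x in M. f x = 0"
    and g: "orthonormal_family M UNIV g"
  shows "\<exists>e. orthonormal_basis M e"
proof -
  let ?ON = "\<lambda>E. orthonormal_family M E (\<lambda>f. f)"
  have "\<exists>E\<in>{E. ?ON E}. \<forall>X\<in>{E. ?ON E}. E \<subseteq> X \<longrightarrow> X = E"
  proof (rule subset_Zorn')
    fix C assume C: "subset.chain {E. ?ON E} C"
    have C1: "?ON E" if "E \<in> C" for E using C that by (auto simp: subset.chain_def)
    have C2: "E \<subseteq> F \<or> F \<subseteq> E" if "E \<in> C" "F \<in> C" for E F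
      using C that by (auto simp: subset.chain_def)
    have "L2_inner M a b = (if a = b then 1 else 0)" if ab: "a \<in> \<Union>C" "b \<in> \<Union>C" for a b
    proof -
      from ab obtain E F where EF: "E \<in> C" "a \<in> E" "F \<in> C" "b \<in> F" by auto
      then have "\<exists>G\<in>C. a \<in> G \<and> b \<in> G" using C2[of E F] by auto
      then show ?thesis using C1 orthonormal_family_inner by fastforce
    qed
    moreover have "a \<in> L2 M" if "a \<in> \<Union>C" for a
      using that C1 by (auto simp: orthonormal_family_def)
    ultimately show "\<Union>C \<in> {E. ?ON E}" unfolding orthonormal_family_def by auto
  qed
  then obtain E where E: "?ON E" and max: "\<And>X. ?ON X \<Longrightarrow> E \<subseteq> X \<Longrightarrow> X = E" by auto
  have EL: "f \<in> L2 M" if "f \<in> E" for f using E that by (auto simp: orthonormal_family_def)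
  have Etotal: "AE x in M. f x = 0" if f: "f \<in> L2 M" and orth: "\<And>h. h \<in> E \<Longrightarrow> L2_inner M f h = 0" for f
  proof (rule ccontr)
    assume "\<not> (AE x in M. f x = 0)"
    then have n: "L2_norm M f \<noteq> 0" using L2_norm_eq_0_iff[OF f] by simp
    define u where "u x = of_real (1 / L2_norm M f) * f x" for x
    have u: "u \<in> L2 M" unfolding u_def by (rule L2_cmult[OF f])
    have "L2_norm M u = 1" unfolding u_def by (simp only: L2_norm_cmult norm_of_real) (use n in simp)
    then have uu: "L2_inner M u u = 1" by (simp add: L2_inner_self)
    have uh: "L2_inner M u h = 0" if "h \<in> E" for h
      unfolding u_def by (simp only: L2_inner_cmult_left) (simp add: orth that)
    have hu: "L2_inner M h u = 0" if "h \<in> E" for h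
      using uh[OF that] by (simp add: L2_inner_commute[of M h u])
    have "u \<notin> E" using uu uh by fastforce
    moreover have "?ON (insert u E)"
      using E u uu uh hu \<open>u \<notin> E\<close> unfolding orthonormal_family_def by auto
    then have "insert u E = E" by (rule max) auto
    ultimately show False by auto
  qed
  have "countable E"
  proof -
    have "countable {h\<in>E. L2_inner M (v k) h \<noteq> 0}" for k
    proof -
      define S where "S n = {h\<in>E. (cmod (L2_inner M (v k) h))\<^sup>2 \<ge> 1 / real (Suc n)}" for n
      have "finite (S n)" for n
      proof (rule ccontr)
        assume inf: "infinite (S n)"
        obtain p :: nat where p: "real p > real (Suc n) * (L2_norm M (v k))\<^sup>2" using reals_Archimedean2 by blast
        obtain F where F: "F \<subseteq> S n" "finite F" "card F = p"
          using infinite_arbitrarily_large[OF inf] by blast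
        have "real p * (1 / real (Suc n)) = (\<Sum>h\<in>F. 1 / real (Suc n))" using F by simp
        also have "\<dots> \<le> (\<Sum>h\<in>F. (cmod (L2_inner M (v k) h))\<^sup>2)" using F by (intro sum_mono) (auto simp: S_def)
        also have "\<dots> \<le> (L2_norm M (v k))\<^sup>2"
          by (rule Bessel_finite[OF orthonormal_family_subset[OF E] F(2) v]) (use F in \<open>auto simp: S_def\<close>)
        finally show False using p by (simp add: field_simps)
      qed
      then have "countable (\<Union>n. S n)" by (intro countable_UN) (auto intro: countable_finite)
      moreover have "{h\<in>E. L2_inner M (v k) h \<noteq> 0} \<subseteq> (\<Union>n. S n)"
      proof safe
        fix h assume h: "h \<in> E" "L2_inner M (v k) h \<noteq> 0"
        then have "0 < (cmod (L2_inner M (v k) h))\<^sup>2" by simp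
        then obtain n where "1 / real (Suc n) < (cmod (L2_inner M (v k) h))\<^sup>2"
          using reals_Archimedean[of "(cmod (L2_inner M (v k) h))\<^sup>2"] by (auto simp: inverse_eq_divide)
        then show "h \<in> (\<Union>n. S n)" using h by (auto simp: S_def intro!: exI[of _ n])
      qed
      ultimately show ?thesis by (rule countable_subset[rotated])
    qed
    then have "countable (\<Union>k. {h\<in>E. L2_inner M (v k) h \<noteq> 0})" by auto
    moreover have "E \<subseteq> (\<Union>k. {h\<in>E. L2_inner M (v k) h \<noteq> 0})"
    proof
      fix h assume h: "h \<in> E"
      have "\<not> (AE x in M. h x = 0)"
        using orthonormal_family_inner[OF E h h] L2_norm_eq_0_iff[OF EL[OF h]] by (auto simp: L2_inner_self)
      then obtain k where "L2_inner M h (v k) \<noteq> 0" using total[OF EL[OF h]] by auto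
      then have "L2_inner M (v k) h \<noteq> 0" by (subst L2_inner_commute) simp
      then show "h \<in> (\<Union>k. {h\<in>E. L2_inner M (v k) h \<noteq> 0})" using h by auto
    qed
    ultimately show ?thesis by (rule countable_subset[rotated])
  qed
  moreover have "infinite E"
  proof
    assume fin: "finite E"
    define N where "N = card E"
    have gL: "g k \<in> L2 M" for k using g by (auto simp: orthonormal_family_def)
    have 1: "(\<Sum>h\<in>E. (cmod (L2_inner M (g k) h))\<^sup>2) = 1" for k
    proof -
      let ?r = "\<lambda>x. g k x - (\<Sum>h\<in>E. L2_inner M (g k) h * h x)"
      have r: "?r \<in> L2 M" by (intro L2_diff gL orthonormal_sum_L2[OF E])
      have "AE x in M. ?r x = 0"
      proof (rule Etotal[OF r])
        fix h assume "h \<in> E"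
        then show "L2_inner M ?r h = 0"
          using orthonormal_sum_coefficient[OF E fin, of h]
          by (simp add: L2_inner_diff_left[OF gL orthonormal_sum_L2[OF E] EL])
      qed
      then have "L2_norm M ?r = 0" using L2_norm_eq_0_iff[OF r] by simp
      then have "(L2_norm M (g k))\<^sup>2 = (\<Sum>h\<in>E. (cmod (L2_inner M (g k) h))\<^sup>2)"
        using Bessel_identity[OF E fin gL, of k] by simp
      moreover have "complex_of_real ((L2_norm M (g k))\<^sup>2) = 1"
        using orthonormal_family_inner[OF g, of k k] unfolding L2_inner_self by simp
      then have "(L2_norm M (g k))\<^sup>2 = 1" unfolding of_real_eq_1_iff .
      ultimately show ?thesis by simp
    qed
    have "real (Suc N) = (\<Sum>k<Suc N. \<Sum>h\<in>E. (cmod (L2_inner M (g k) h))\<^sup>2)" by (simp add: 1)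
    also have "\<dots> = (\<Sum>h\<in>E. \<Sum>k<Suc N. (cmod (L2_inner M h (g k)))\<^sup>2)"
      by (subst sum.swap) (simp add: L2_inner_commute[of M "g _"])
    also have "\<dots> \<le> (\<Sum>h\<in>E. 1)"
    proof (rule sum_mono)
      fix h assume h: "h \<in> E"
      have "complex_of_real ((L2_norm M h)\<^sup>2) = 1"
        using orthonormal_family_inner[OF E h h] unfolding L2_inner_self by simp
      then have "(L2_norm M h)\<^sup>2 = 1" unfolding of_real_eq_1_iff .
      then show "(\<Sum>k<Suc N. (cmod (L2_inner M h (g k)))\<^sup>2) \<le> 1"
        using Bessel_finite[OF orthonormal_family_subset[OF g] _ EL[OF h], of "{..<Suc N}"] by simp
    qed
    also have "\<dots> = real N" by (simp add: N_def)
    finally show False by simp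
  qed
  ultimately have bij: "bij_betw (from_nat_into E) UNIV E" by (rule bij_betw_from_nat_into)
  have "orthonormal_basis M (from_nat_into E)"
    unfolding orthonormal_basis_def
  proof (intro conjI allI ballI impI)
    have inE: "from_nat_into E n \<in> E" for n using bij by (auto simp: bij_betw_def)
    show "from_nat_into E n \<in> L2 M" for n by (rule EL[OF inE])
    show "L2_inner M (from_nat_into E m) (from_nat_into E n) = (if m = n then 1 else 0)" for m n
      using orthonormal_family_inner[OF E inE inE, of m n] bij by (auto simp: bij_betw_def inj_def)
    fix f assume f: "f \<in> L2 M" "\<forall>n. L2_inner M f (from_nat_into E n) = 0"
    show "AE x in M. f x = 0"
    proof (rule Etotal[OF f(1)])
      fix h assume "h \<in> E"
      then obtain n where "h = from_nat_into E n" using bij by (auto simp: bij_betw_def)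
      then show "L2_inner M f h = 0" using f(2) by simp
    qed
  qed
  then show ?thesis by blast
qed

section \<open>Hilbert--Schmidt operators\<close>

lemma L2_bounded_operator_L2: "L2_bounded_operator M T \<Longrightarrow> f \<in> L2 M \<Longrightarrow> T f \<in> L2 M"
  by (simp add: L2_bounded_operator_def)

lemma L2_bounded_operator_lincomb:
  "L2_bounded_operator M T \<Longrightarrow> f \<in> L2 M \<Longrightarrow> g \<in> L2 M \<Longrightarrow>
   AE x in M. T (\<lambda>y. c * f y + d * g y) x = c * T f x + d * T g x"
  by (simp add: L2_bounded_operator_def)

lemma L2_bounded_operator_zero:
  assumes "L2_bounded_operator M T"
  shows "AE x in M. T (\<lambda>x. 0) x = 0"
  using L2_bounded_operator_lincomb[OF assms L2_zero L2_zero, of 0 0] by simp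

lemma L2_bounded_operator_diff:
  assumes "L2_bounded_operator M T" "f \<in> L2 M" "g \<in> L2 M"
  shows "AE x in M. T (\<lambda>y. f y - g y) x = T f x - T g x"
  using L2_bounded_operator_lincomb[OF assms, of 1 "-1"] by simp

lemma L2_bounded_operator_sum:
  assumes T: "L2_bounded_operator M T" and "\<And>i. i \<in> I \<Longrightarrow> f i \<in> L2 M"
  shows "AE x in M. T (\<lambda>y. \<Sum>i\<in>I. c i * f i y) x = (\<Sum>i\<in>I. c i * T (f i) x)"
  using assms(2)
proof (induction I rule: infinite_finite_induct)
  case (insert i I)
  have s: "(\<lambda>y. \<Sum>i\<in>I. c i * f i y) \<in> L2 M" using insert by (intro L2_sum L2_cmult) auto
  have "AE x in M. T (\<lambda>y. \<Sum>i\<in>I. c i * f i y) x = (\<Sum>i\<in>I. c i * T (f i) x)"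
    using insert by auto
  moreover have "AE x in M. T (\<lambda>y. c i * f i y + 1 * (\<Sum>i\<in>I. c i * f i y)) x
      = c i * T (f i) x + 1 * T (\<lambda>y. \<Sum>i\<in>I. c i * f i y) x"
    by (rule L2_bounded_operator_lincomb[OF T _ s]) (use insert in auto)
  ultimately show ?case by eventually_elim (use insert in simp)
qed (use L2_bounded_operator_zero[OF T] in auto)

lemma L2_bounded_operator_tendsto:
  assumes T: "L2_bounded_operator M T" and F: "\<And>n. F n \<in> L2 M" "f \<in> L2 M"
    and lim: "(\<lambda>n. L2_norm M (\<lambda>x. F n x - f x)) \<longlonglongrightarrow> 0"
  shows "(\<lambda>n. L2_norm M (\<lambda>x. T (F n) x - T f x)) \<longlonglongrightarrow> 0"
proof -
  obtain C where C: "\<And>f. f \<in> L2 M \<Longrightarrow> L2_norm M (T f) \<le> C * L2_norm M f"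
    using T unfolding L2_bounded_operator_def by blast
  show ?thesis
  proof (rule Lim_null_comparison)
    show "(\<lambda>n. C * L2_norm M (\<lambda>x. F n x - f x)) \<longlonglongrightarrow> 0"
      using tendsto_mult_left[OF lim, of C] by simp
    have "L2_norm M (\<lambda>x. T (F n) x - T f x) = L2_norm M (T (\<lambda>x. F n x - f x))" for n
      by (intro L2_norm_cong_AE L2_D(1)[OF L2_diff] L2_D(1) L2_bounded_operator_L2[OF T] L2_diff F)
        (rule AE_symmetric[OF L2_bounded_operator_diff[OF T F]])
    then show "\<forall>\<^sub>F n in sequentially. norm (L2_norm M (\<lambda>x. T (F n) x - T f x)) \<le> C * L2_norm M (\<lambda>x. F n x - f x)"
      using C[OF L2_diff[OF F]] by simp
  qed
qed

text \<open>A bounded operator can be applied to the basis expansion term by term.  Operators act on representatives and are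
  linear only almost everywhere, so finite sums have to be treated first.\<close>

lemma L2_bounded_operator_inner_expansion:
  assumes T: "L2_bounded_operator M T" and e: "orthonormal_basis M e" and f: "f \<in> L2 M" "g \<in> L2 M"
  shows "(\<lambda>k. L2_inner M f (e k) * L2_inner M (T (e k)) g) sums L2_inner M (T f) g"
proof -
  have eL: "e k \<in> L2 M" for k using e by (simp add: orthonormal_basis_def)
  let ?s = "\<lambda>N x. \<Sum>k<N. L2_inner M f (e k) * e k x"
  have s: "?s N \<in> L2 M" for N by (intro L2_sum L2_cmult eL)
  have "(\<lambda>N. L2_inner M (T (?s N)) g) \<longlonglongrightarrow> L2_inner M (T f) g"
    by (intro L2_inner_tendsto L2_bounded_operator_L2[OF T] s f
        L2_bounded_operator_tendsto[OF T s f(1)] orthonormal_basis_expansion[OF e f(1)])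
  moreover have "L2_inner M (T (?s N)) g = (\<Sum>k<N. L2_inner M f (e k) * L2_inner M (T (e k)) g)" for N
  proof -
    have Te: "T (e k) \<in> L2 M" for k by (rule L2_bounded_operator_L2[OF T eL])
    have "L2_inner M (T (?s N)) g = L2_inner M (\<lambda>x. \<Sum>k<N. L2_inner M f (e k) * T (e k) x) g"
      by (rule L2_inner_cong_AE)
        (use L2_bounded_operator_sum[OF T eL, where I = "{..<N}"] in
          \<open>auto intro!: L2_D(1)[OF L2_bounded_operator_L2[OF T s]] L2_D(1)[OF L2_sum] L2_cmult Te L2_D(1)[OF f(2)]\<close>)
    also have "\<dots> = (\<Sum>k<N. L2_inner M f (e k) * L2_inner M (T (e k)) g)"
      by (subst L2_inner_sum_left) (auto intro!: L2_cmult Te f simp: L2_inner_cmult_left)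
    finally show ?thesis .
  qed
  ultimately show ?thesis by (simp add: sums_def)
qed

lemma some_basis_orthonormal:
  "\<exists>e. orthonormal_basis M e \<Longrightarrow> orthonormal_basis M (some_basis M)"
  unfolding some_basis_def by (erule someI_ex)

lemma some_basis_L2: "orthonormal_basis M (some_basis M) \<Longrightarrow> some_basis M n \<in> L2 M"
  by (simp add: orthonormal_basis_def)

definition matrix_coeff :: "'a measure \<Rightarrow> (('a \<Rightarrow> complex) \<Rightarrow> 'a \<Rightarrow> complex) \<Rightarrow> nat \<Rightarrow> nat \<Rightarrow> complex" where
  "matrix_coeff M T n m = L2_inner M (T (some_basis M n)) (some_basis M m)"

lemma hs_norm_sq_sums:
  assumes "hilbert_schmidt M T"
  shows "(\<Sum>n. ennreal ((L2_norm M (T (some_basis M n)))\<^sup>2)) = ennreal ((hs_norm M T)\<^sup>2)"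
proof -
  have "summable (\<lambda>n. (L2_norm M (T (some_basis M n)))\<^sup>2)" using assms by (simp add: hilbert_schmidt_def)
  then show ?thesis by (subst suminf_ennreal2) (auto simp: hs_norm_def suminf_nonneg)
qed

lemma hs_norm_sq_matrix:
  assumes "orthonormal_basis M (some_basis M)" "hilbert_schmidt M T"
  shows "(\<Sum>n. \<Sum>m. ennreal ((cmod (matrix_coeff M T n m))\<^sup>2)) = ennreal ((hs_norm M T)\<^sup>2)"
proof -
  have "T (some_basis M n) \<in> L2 M" for n
    using assms by (simp add: hilbert_schmidt_def L2_bounded_operator_L2 some_basis_L2)
  then show ?thesis
    by (simp only: hs_norm_sq_sums[OF assms(2), symmetric] matrix_coeff_def Parseval_ennreal[OF assms(1)])
qed

lemma L2_norm_le_hs_norm: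
  assumes "hilbert_schmidt M T"
  shows "L2_norm M (T (some_basis M n)) \<le> hs_norm M T"
proof -
  have s: "summable (\<lambda>n. (L2_norm M (T (some_basis M n)))\<^sup>2)" using assms by (simp add: hilbert_schmidt_def)
  have "(L2_norm M (T (some_basis M n)))\<^sup>2 \<le> (\<Sum>n. (L2_norm M (T (some_basis M n)))\<^sup>2)"
    using sum_le_suminf[OF s, of "{n}"] by simp
  then show ?thesis unfolding hs_norm_def by (intro real_le_rsqrt)
qed

lemma hs_norm_nonneg: "hilbert_schmidt M T \<Longrightarrow> 0 \<le> hs_norm M T"
  using order_trans[OF L2_norm_nonneg L2_norm_le_hs_norm] by blast

lemma norm_suminf_le_ennreal:
  fixes a :: "nat \<Rightarrow> complex"
  shows "ennreal (cmod (suminf a)) \<le> (\<Sum>n. ennreal (cmod (a n)))"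
proof (cases "(\<Sum>n. ennreal (cmod (a n))) = \<infinity>")
  case False
  then have sm: "summable (\<lambda>m. cmod (a m))"
    by (intro summable_suminf_not_top) auto
  have "ennreal (cmod (suminf a)) \<le> ennreal (\<Sum>n. cmod (a n))"
    by (intro ennreal_leI summable_norm sm)
  also have "\<dots> = (\<Sum>n. ennreal (cmod (a n)))"
    by (subst suminf_ennreal2[symmetric]) (use sm in auto)
  finally show ?thesis .
qed simp

text \<open>Expanding \<open>T e\<^sub>n\<close> in the basis turns the trace of a product into the pairing of two matrices, to which the
  Cauchy--Schwarz inequality applies.  The pairing also shows that the trace depends on \<open>T\<close> only through its matrix.\<close>

lemma op_trace_compose:
  assumes b: "orthonormal_basis M (some_basis M)"
    and S: "hilbert_schmidt M S" and T: "hilbert_schmidt M T"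
  shows "op_trace M (\<lambda>\<phi>. S (T \<phi>)) = (\<Sum>n. \<Sum>m. matrix_coeff M T n m * matrix_coeff M S m n)"
    and "(\<Sum>n. ennreal (cmod (\<Sum>m. matrix_coeff M T n m * matrix_coeff M S m n)))
      \<le> ennreal (hs_norm M T * hs_norm M S)"
    and "summable (\<lambda>m. matrix_coeff M T n m * matrix_coeff M S m n)"
proof -
  have SB: "L2_bounded_operator M S" "L2_bounded_operator M T" using S T by (auto simp: hilbert_schmidt_def)
  note bL = some_basis_L2[OF b]
  have sums: "(\<lambda>m. matrix_coeff M T n m * matrix_coeff M S m n) sums
      L2_inner M (S (T (some_basis M n))) (some_basis M n)" for n
    unfolding matrix_coeff_def
    by (intro L2_bounded_operator_inner_expansion SB b bL L2_bounded_operator_L2[OF SB(2)])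
  then show "op_trace M (\<lambda>\<phi>. S (T \<phi>)) = (\<Sum>n. \<Sum>m. matrix_coeff M T n m * matrix_coeff M S m n)"
    unfolding op_trace_def by (simp add: sums_iff)
  show "summable (\<lambda>m. matrix_coeff M T n m * matrix_coeff M S m n)"
    using sums[of n] by (simp add: sums_iff)
  let ?t = "\<lambda>n m. ennreal (cmod (matrix_coeff M T n m))" and ?s = "\<lambda>n m. ennreal (cmod (matrix_coeff M S m n))"
  let ?c = "count_space (UNIV :: (nat \<times> nat) set)"
  have iter: "(\<integral>\<^sup>+p. f (fst p) (snd p) \<partial>?c) = (\<Sum>n. \<Sum>m. f n m)" for f :: "nat \<Rightarrow> nat \<Rightarrow> ennreal"
    using nn_integral_fst_count_space[of "\<lambda>p. f (fst p) (snd p)"]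
    by (simp add: nn_integral_count_space_nat)
  have iter': "(\<integral>\<^sup>+p. f (fst p) (snd p) \<partial>?c) = (\<Sum>m. \<Sum>n. f n m)" for f :: "nat \<Rightarrow> nat \<Rightarrow> ennreal"
    using nn_integral_snd_count_space[of "\<lambda>p. f (fst p) (snd p)"]
    by (simp add: nn_integral_count_space_nat)
  have "(\<Sum>n. \<Sum>m. ?t n m * ?s n m)\<^sup>2 \<le> (\<Sum>n. \<Sum>m. (?t n m)\<^sup>2) * (\<Sum>m. \<Sum>n. (?s n m)\<^sup>2)"
    using Cauchy_Schwarz_nn_integral[of "\<lambda>p. ?t (fst p) (snd p)" ?c "\<lambda>p. ?s (fst p) (snd p)"]
    unfolding iter[of "\<lambda>n m. ?t n m * ?s n m"] iter[of "\<lambda>n m. (?t n m)\<^sup>2"] iter'[of "\<lambda>n m. (?s n m)\<^sup>2"]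
    by simp
  also have "\<dots> = ennreal ((hs_norm M T)\<^sup>2) * ennreal ((hs_norm M S)\<^sup>2)"
    by (simp add: ennreal_power hs_norm_sq_matrix[OF b T] hs_norm_sq_matrix[OF b S])
  also have "\<dots> = (ennreal (hs_norm M T * hs_norm M S))\<^sup>2"
    using hs_norm_nonneg[OF S] hs_norm_nonneg[OF T] by (simp add: ennreal_power power_mult_distrib flip: ennreal_mult)
  finally have sq: "(\<Sum>n. \<Sum>m. ?t n m * ?s n m)\<^sup>2 \<le> (ennreal (hs_norm M T * hs_norm M S))\<^sup>2" .
  have nn: "0 \<le> hs_norm M T * hs_norm M S"
    using hs_norm_nonneg[OF S] hs_norm_nonneg[OF T] by simp
  have "(\<Sum>n. \<Sum>m. ?t n m * ?s n m) \<le> ennreal (hs_norm M T * hs_norm M S)"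
    by (rule ennreal_le_if_sq_le[OF sq nn])
  moreover have "ennreal (cmod (\<Sum>m. matrix_coeff M T n m * matrix_coeff M S m n)) \<le> (\<Sum>m. ?t n m * ?s n m)" for n
    using norm_suminf_le_ennreal[of "\<lambda>m. matrix_coeff M T n m * matrix_coeff M S m n"]
    by (simp add: norm_mult ennreal_mult)
  then have "(\<Sum>n. ennreal (cmod (\<Sum>m. matrix_coeff M T n m * matrix_coeff M S m n))) \<le> (\<Sum>n. \<Sum>m. ?t n m * ?s n m)"
    by (intro suminf_le) auto
  ultimately show "(\<Sum>n. ennreal (cmod (\<Sum>m. matrix_coeff M T n m * matrix_coeff M S m n)))
      \<le> ennreal (hs_norm M T * hs_norm M S)" by (rule order_trans[rotated])
qed

section \<open>Lebesgue measure in light-cone coordinates\<close>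

lemma borel_measurable_fst_borel [measurable (raw)]:
  fixes f :: "'a \<Rightarrow> 'b::second_countable_topology \<times> 'c::second_countable_topology"
  shows "f \<in> borel_measurable M \<Longrightarrow> (\<lambda>x. fst (f x)) \<in> borel_measurable M"
  by (rule measurable_compose[OF _ borel_measurable_continuous_onI]) (auto intro: continuous_intros)

lemma borel_measurable_snd_borel [measurable (raw)]:
  fixes f :: "'a \<Rightarrow> 'b::second_countable_topology \<times> 'c::second_countable_topology"
  shows "f \<in> borel_measurable M \<Longrightarrow> (\<lambda>x. snd (f x)) \<in> borel_measurable M"
  by (rule measurable_compose[OF _ borel_measurable_continuous_onI]) (auto intro: continuous_intros)

text \<open>Boosts are diagonal in the coordinates \<open>u = x\<^sub>1 + x\<^sub>2\<close>, \<open>v = x\<^sub>1 - x\<^sub>2\<close>, the Minkowski form becomes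
  \<open>u v\<close>, and the cones become the four quadrants.\<close>

definition lightcone :: "real \<Rightarrow> real \<Rightarrow> plane" where
  "lightcone u v = ((u + v) / 2, (u - v) / 2)"

lemma lightcone_surj: "lightcone (fst x + snd x) (fst x - snd x) = x"
  by (simp add: lightcone_def)

lemma lightcone_cases: obtains u v where "x = lightcone u v"
  using lightcone_surj[of x] by metis

lemma boost_lightcone: "boost \<theta> (lightcone u v) = lightcone (exp \<theta> * u) (exp (- \<theta>) * v)"
  by (simp add: boost_def lightcone_def cosh_def sinh_def field_simps)

lemma scaleR_lightcone: "c *\<^sub>R lightcone u v = lightcone (c * u) (c * v)"
  by (simp add: lightcone_def algebra_simps)

lemma add_lightcone: "lightcone u v + lightcone u' v' = lightcone (u + u') (v + v')"
  by (simp add: lightcone_def field_simps)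

lemma minkowski_lightcone: "minkowski (lightcone u v) (lightcone u v) = u * v"
  by (simp add: lightcone_def minkowski_def field_simps)

lemma borel_measurable_lightcone [measurable (raw)]:
  "f \<in> borel_measurable M \<Longrightarrow> g \<in> borel_measurable M \<Longrightarrow> (\<lambda>x. lightcone (f x) (g x)) \<in> borel_measurable M"
  unfolding lightcone_def by (intro borel_measurable_Pair) auto

lemma nn_integral_lightcone:
  fixes h :: "plane \<Rightarrow> ennreal"
  assumes [measurable]: "h \<in> borel_measurable borel"
  shows "(\<integral>\<^sup>+x. h x \<partial>lborel) = (\<integral>\<^sup>+u. \<integral>\<^sup>+v. ennreal (1/2) * h (lightcone u v) \<partial>lborel \<partial>lborel)"
proof -
  have "(\<integral>\<^sup>+x. h x \<partial>lborel) = (\<integral>\<^sup>+y. \<integral>\<^sup>+x. h (x, y) \<partial>lborel \<partial>lborel)"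
    by (subst lborel_pair.nn_integral_snd) (simp_all add: lborel_prod)
  also have "\<dots> = (\<integral>\<^sup>+y. \<integral>\<^sup>+u. h (u - y, y) \<partial>lborel \<partial>lborel)"
  proof (rule nn_integral_cong)
    show "(\<integral>\<^sup>+x. h (x, y) \<partial>lborel) = (\<integral>\<^sup>+u. h (u - y, y) \<partial>lborel)" for y
      using nn_integral_real_affine[of "\<lambda>x. h (x, y)" 1 "- y"] by simp
  qed
  also have "\<dots> = (\<integral>\<^sup>+u. \<integral>\<^sup>+y. h (u - y, y) \<partial>lborel \<partial>lborel)"
    by (rule lborel_pair.Fubini') measurable
  also have "\<dots> = (\<integral>\<^sup>+u. \<integral>\<^sup>+v. ennreal (1/2) * h (lightcone u v) \<partial>lborel \<partial>lborel)"
  proof (rule nn_integral_cong)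
    fix u :: real
    have e: "(u - (u/2 + (- 1/2) * v), u/2 + (- 1/2) * v) = lightcone u v" for v
      by (simp add: lightcone_def field_simps)
    have "(\<integral>\<^sup>+y. h (u - y, y) \<partial>lborel)
      = ennreal \<bar>- 1/2\<bar> * (\<integral>\<^sup>+v. h (u - (u/2 + (- 1/2) * v), u/2 + (- 1/2) * v) \<partial>lborel)"
      by (rule nn_integral_real_affine[where c = "- 1/2" and t = "u/2"]) simp_all
    also have "\<dots> = (\<integral>\<^sup>+v. ennreal (1/2) * h (lightcone u v) \<partial>lborel)"
      unfolding e by (subst nn_integral_cmult) simp_all
    finally show "(\<integral>\<^sup>+y. h (u - y, y) \<partial>lborel) = (\<integral>\<^sup>+v. ennreal (1/2) * h (lightcone u v) \<partial>lborel)" .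
  qed
  finally show ?thesis .
qed

lemma borel_measurable_boost [measurable (raw)]:
  assumes [measurable]: "f \<in> borel_measurable M" "g \<in> borel_measurable M"
  shows "(\<lambda>x. boost (f x) (g x)) \<in> borel_measurable M"
  unfolding boost_def cosh_def sinh_def by measurable

text \<open>In light-cone coordinates the map is a pair of affine maps of the line with slopes \<open>a e\<^sup>\<theta>\<close> and \<open>a e\<^sup>-\<^sup>\<theta>\<close>.\<close>

lemma nn_integral_dilation_boost:
  fixes h :: "plane \<Rightarrow> ennreal"
  assumes [measurable]: "h \<in> borel_measurable borel" and a: "a > 0"
  shows "(\<integral>\<^sup>+x. h x \<partial>lborel) = ennreal (a\<^sup>2) * (\<integral>\<^sup>+x. h (c + a *\<^sub>R boost \<theta> x) \<partial>lborel)"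
proof -
  obtain u0 v0 where c: "c = lightcone u0 v0" by (rule lightcone_cases)
  have p: "a * exp \<theta> > 0" "a * exp (- \<theta>) > 0" using a by auto
  have "(\<integral>\<^sup>+x. h x \<partial>lborel) = (\<integral>\<^sup>+u. \<integral>\<^sup>+v. ennreal (1/2) * h (lightcone u v) \<partial>lborel \<partial>lborel)"
    by (rule nn_integral_lightcone) measurable
  also have "\<dots> = (\<integral>\<^sup>+u. ennreal (a * exp (- \<theta>)) *
      (\<integral>\<^sup>+v. ennreal (1/2) * h (lightcone u (v0 + a * exp (- \<theta>) * v)) \<partial>lborel) \<partial>lborel)"
    using p by (intro nn_integral_cong, subst nn_integral_real_affine[where c = "a * exp (- \<theta>)" and t = v0]) auto
  also have "\<dots> = ennreal (a * exp \<theta>) * (\<integral>\<^sup>+u. ennreal (a * exp (- \<theta>)) *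
      (\<integral>\<^sup>+v. ennreal (1/2) * h (lightcone (u0 + a * exp \<theta> * u) (v0 + a * exp (- \<theta>) * v)) \<partial>lborel) \<partial>lborel)"
    using p by (subst nn_integral_real_affine[where c = "a * exp \<theta>" and t = u0]) auto
  also have "\<dots> = ennreal (a * exp \<theta>) * ennreal (a * exp (- \<theta>)) * (\<integral>\<^sup>+u.
      \<integral>\<^sup>+v. ennreal (1/2) * h (lightcone (u0 + a * exp \<theta> * u) (v0 + a * exp (- \<theta>) * v)) \<partial>lborel \<partial>lborel)"
    by (subst nn_integral_cmult) (auto simp: mult.assoc)
  also have "ennreal (a * exp \<theta>) * ennreal (a * exp (- \<theta>)) = ennreal (a\<^sup>2)"
    using p by (simp add: ennreal_mult[symmetric] power2_eq_square exp_minus)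
  also have "(\<integral>\<^sup>+u. \<integral>\<^sup>+v. ennreal (1/2) * h (lightcone (u0 + a * exp \<theta> * u) (v0 + a * exp (- \<theta>) * v)) \<partial>lborel \<partial>lborel)
      = (\<integral>\<^sup>+x. h (c + a *\<^sub>R boost \<theta> x) \<partial>lborel)"
    by (subst nn_integral_lightcone) (auto simp: c boost_lightcone scaleR_lightcone add_lightcone mult.assoc)
  finally show ?thesis .
qed

lemma nn_integral_exp_substitution:
  fixes k :: "real \<Rightarrow> ennreal"
  assumes [measurable]: "k \<in> borel_measurable borel"
  shows "(\<integral>\<^sup>+t. k t * indicator {0<..} t \<partial>lborel) = (\<integral>\<^sup>+\<theta>. k (exp \<theta>) * ennreal (exp \<theta>) \<partial>lborel)"
proof -
  let ?L = "\<lambda>n::nat. \<lambda>t. k t * indicator {exp (- real n)..exp (real n)} t"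
  let ?R = "\<lambda>n::nat. \<lambda>\<theta>. k (exp \<theta>) * ennreal (exp \<theta>) * indicator {- real n..real n} \<theta>"
  have L: "(\<lambda>n. \<integral>\<^sup>+t. ?L n t \<partial>lborel) \<longlonglongrightarrow> (\<integral>\<^sup>+t. k t * indicator {0<..} t \<partial>lborel)"
  proof (rule nn_integral_LIMSEQ)
    show "incseq ?L"
    proof (intro incseq_SucI le_funI mult_left_mono)
      show "(indicator {exp (- real n)..exp (real n)} t :: ennreal)
          \<le> indicator {exp (- real (Suc n))..exp (real (Suc n))} t" for n t
        using exp_le_cancel_iff[of "- real (Suc n)" "- real n"] exp_le_cancel_iff[of "real n" "real (Suc n)"]
        by (intro indicator_leI) (auto simp del: exp_le_cancel_iff)
    qed simp
    show "(\<lambda>n. ?L n t) \<longlonglongrightarrow> k t * indicator {0<..} t" for t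
    proof (rule tendsto_eventually)
      obtain N :: nat where N: "\<bar>ln t\<bar> \<le> real N" using real_arch_simple by blast
      show "\<forall>\<^sub>F n in sequentially. ?L n t = k t * indicator {0<..} t"
        using eventually_ge_at_top[of N]
      proof eventually_elim
        case (elim n)
        show ?case
        proof (cases "t > 0")
          case True
          then have "exp (- real n) \<le> t" "t \<le> exp (real n)"
            using N elim exp_le_cancel_iff[of "- real n" "ln t"] exp_le_cancel_iff[of "ln t" "real n"] by auto
          then show ?thesis using True by (auto split: split_indicator)
        next
          case False
          then have "\<not> exp (- real n) \<le> t" using exp_gt_zero[of "- real n"] by linarith
          then show ?thesis using False by (auto split: split_indicator)
        qed
      qed
    qed
  qed measurable
  have R: "(\<lambda>n. \<integral>\<^sup>+\<theta>. ?R n \<theta> \<partial>lborel) \<longlonglongrightarrow> (\<integral>\<^sup>+\<theta>. k (exp \<theta>) * ennreal (exp \<theta>) \<partial>lborel)"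
  proof (rule nn_integral_LIMSEQ)
    show "incseq ?R" by (auto simp: incseq_def le_fun_def split: split_indicator)
    show "(\<lambda>n. ?R n t) \<longlonglongrightarrow> k (exp t) * ennreal (exp t)" for t
    proof (rule tendsto_eventually)
      obtain N :: nat where N: "\<bar>t\<bar> \<le> real N" using real_arch_simple by blast
      show "\<forall>\<^sub>F n in sequentially. ?R n t = k (exp t) * ennreal (exp t)"
        using eventually_ge_at_top[of N] by eventually_elim (use N in \<open>auto split: split_indicator\<close>)
    qed
  qed measurable
  have "(\<integral>\<^sup>+t. ?L n t \<partial>lborel) = (\<integral>\<^sup>+\<theta>. ?R n \<theta> \<partial>lborel)" if "n > 0" for n
    by (rule nn_integral_substitution_aux[where g = exp])
      (use that in \<open>auto intro!: DERIV_exp continuous_intros\<close>)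
  then have "\<forall>\<^sub>F n in sequentially. (\<integral>\<^sup>+t. ?L n t \<partial>lborel) = (\<integral>\<^sup>+\<theta>. ?R n \<theta> \<partial>lborel)"
    by (rule eventually_mono[OF eventually_gt_at_top[of 0]])
  from tendsto_cong[OF this] L R show ?thesis by (blast intro: LIMSEQ_unique)
qed

section \<open>The cones\<close>

lemma cone_quadrant:
  assumes "i \<in> {1, 2}" "j \<in> {1, 2}"
  shows "\<exists>s\<in>{1, -1}. \<exists>t\<in>{1, -1::real}. \<forall>u v. lightcone u v \<in> cone i j \<longleftrightarrow> s * u > 0 \<and> t * v > 0"
proof -
  have m: "((u - v) / 2)\<^sup>2 < ((u + v) / 2)\<^sup>2 \<longleftrightarrow> u * v > 0"
    "((u + v) / 2)\<^sup>2 < ((u - v) / 2)\<^sup>2 \<longleftrightarrow> u * v < 0" for u v :: real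
    by (auto simp: power2_eq_square field_simps)
  have "\<exists>s t. s \<in> {1, -1} \<and> t \<in> {1, -1::real} \<and> (\<forall>u v. lightcone u v \<in> cone i j \<longleftrightarrow> s * u > 0 \<and> t * v > 0)"
  proof (cases "j = 1"; cases "i = 1")
    assume "j = 1" "i = 1"
    then show ?thesis by (intro exI[of _ 1]) (auto simp: cone_def lightcone_def m zero_less_mult_iff)
  next
    assume "j = 1" "i \<noteq> 1"
    then show ?thesis by (intro exI[of _ "-1"]) (auto simp: cone_def lightcone_def m zero_less_mult_iff)
  next
    assume "j \<noteq> 1" "i = 1"
    then show ?thesis by (intro exI[of _ 1] exI[of _ "-1"]) (auto simp: cone_def lightcone_def m mult_less_0_iff)
  next
    assume "j \<noteq> 1" "i \<noteq> 1"
    then show ?thesis by (intro exI[of _ "-1"] exI[of _ 1]) (auto simp: cone_def lightcone_def m mult_less_0_iff)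
  qed
  then show ?thesis by blast
qed

lemma sets_cone [measurable]: "cone i j \<in> sets borel"
proof -
  have "cone i j = {x\<in>space borel. (if j = 1 then (fst x)\<^sup>2 > (snd x)\<^sup>2 \<and> (if i = 1 then fst x > 0 else fst x < 0)
     else (fst x)\<^sup>2 < (snd x)\<^sup>2 \<and> (if i = 1 then snd x > 0 else snd x < 0))}"
    by (auto simp: cone_def)
  also have "\<dots> \<in> sets borel"
    by measurable
  finally show ?thesis .
qed

lemma cone_dilation_boost:
  assumes "i \<in> {1, 2}" "j \<in> {1, 2}" "a > 0"
  shows "a *\<^sub>R boost \<theta> x \<in> cone i j \<longleftrightarrow> x \<in> cone i j"
proof -
  obtain s t :: real where q: "\<And>u v. lightcone u v \<in> cone i j \<longleftrightarrow> s * u > 0 \<and> t * v > 0"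
    using cone_quadrant[OF assms(1,2)] by blast
  obtain u v where x: "x = lightcone u v" by (rule lightcone_cases)
  have "s * (a * (exp \<theta> * u)) = (a * exp \<theta>) * (s * u)" "t * (a * (exp (- \<theta>) * v)) = (a * exp (- \<theta>)) * (t * v)"
    by simp_all
  moreover have "a * exp \<theta> > 0" "a * exp (- \<theta>) > 0" using assms(3) by auto
  ultimately show ?thesis unfolding x boost_lightcone scaleR_lightcone q
    by (metis zero_less_mult_pos mult_pos_pos)
qed

lemma minkowski_dilation_boost: "minkowski (a *\<^sub>R boost \<theta> x) (a *\<^sub>R boost \<theta> x) = a\<^sup>2 * minkowski x x"
proof -
  obtain u v where x: "x = lightcone u v" by (rule lightcone_cases)
  show ?thesis
    unfolding x boost_lightcone scaleR_lightcone minkowski_lightcone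
    by (simp add: power2_eq_square exp_minus field_simps)
qed

lemma space_cone_measure [simp]: "space (cone_measure i j) = cone i j"
  by (simp add: cone_measure_def space_restrict_space)

lemma nn_integral_cone_measure:
  "(\<integral>\<^sup>+x. f x \<partial>cone_measure i j) = (\<integral>\<^sup>+x. f x * indicator (cone i j) x \<partial>lborel)"
  unfolding cone_measure_def by (rule nn_integral_restrict_space) simp

lemma borel_measurable_cone_measure: "f \<in> borel_measurable borel \<Longrightarrow> f \<in> borel_measurable (cone_measure i j)"
  unfolding cone_measure_def by (rule measurable_restrict_space1) simp

lemma sigma_finite_cone_measure: "sigma_finite_measure (cone_measure i j)"
  unfolding cone_measure_def
  by (rule sigma_finite_measure_restrict_space) (auto intro: lborel.sigma_finite_measure_axioms)

text \<open>The group \<open>\<real>\<^sub>+ \<times> \<real>\<close> of dilations and boosts acts simply transitively on each cone; this is the change of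
  variables from the group to the orbit of a point.\<close>

lemma nn_integral_orbit:
  fixes h :: "plane \<Rightarrow> ennreal"
  assumes ij: "i \<in> {1, 2}" "j \<in> {1, 2}" and x: "x \<in> cone i j"
    and [measurable]: "h \<in> borel_measurable borel"
  shows "(\<integral>\<^sup>+a. \<integral>\<^sup>+\<theta>. h (a *\<^sub>R boost (- \<theta>) x) * ennreal (a * \<bar>minkowski x x\<bar>) * indicator {0<..} a \<partial>lborel \<partial>lborel)
    = (\<integral>\<^sup>+y. h y \<partial>cone_measure i j)"
proof -
  obtain s t :: real where st: "s \<in> {1, -1}" "t \<in> {1, -1}"
    and q: "\<And>u v. lightcone u v \<in> cone i j \<longleftrightarrow> s * u > 0 \<and> t * v > 0"
    using cone_quadrant[OF ij] by blast
  obtain u0 v0 where x0: "x = lightcone u0 v0" by (rule lightcone_cases)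
  have uv: "s * u0 > 0" "t * v0 > 0" using x q by (auto simp: x0)
  then have nz: "u0 \<noteq> 0" "v0 \<noteq> 0" by auto
  have m: "\<bar>minkowski x x\<bar> = \<bar>u0\<bar> * \<bar>v0\<bar>" by (simp add: x0 minkowski_lightcone abs_mult)
  have pos: "s * (u0 * p) > 0 \<longleftrightarrow> p > 0" "t * (v0 * p) > 0 \<longleftrightarrow> p > 0" for p
    using uv by (metis mult.assoc zero_less_mult_pos mult_pos_pos)+
  let ?f = "\<lambda>a \<theta>. h (lightcone (a * exp (- \<theta>) * u0) (a * exp \<theta> * v0)) * ennreal (a * (\<bar>u0\<bar> * \<bar>v0\<bar>)) * indicator {0<..} a"
  have "(\<integral>\<^sup>+a. \<integral>\<^sup>+\<theta>. h (a *\<^sub>R boost (- \<theta>) x) * ennreal (a * \<bar>minkowski x x\<bar>) * indicator {0<..} a \<partial>lborel \<partial>lborel)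
     = (\<integral>\<^sup>+a. \<integral>\<^sup>+\<theta>. ?f a \<theta> \<partial>lborel \<partial>lborel)"
    unfolding m by (simp add: x0 boost_lightcone scaleR_lightcone mult.assoc)
  also have "\<dots> = (\<integral>\<^sup>+\<theta>. \<integral>\<^sup>+a. ?f a \<theta> \<partial>lborel \<partial>lborel)"
    by (rule lborel_pair.Fubini'[symmetric]) measurable
  (* The substitution a = e^\<theta> p makes the first light-cone coordinate u0 p independent of \<theta>; then
     after exchanging the integrals, r = p e^(2\<theta>) straightens the second one. *)
  also have "\<dots> = (\<integral>\<^sup>+\<theta>. \<integral>\<^sup>+p. ennreal (exp \<theta>) * ?f (exp \<theta> * p) \<theta> \<partial>lborel \<partial>lborel)"
  proof (rule nn_integral_cong)
    fix \<theta> :: real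
    have "(\<integral>\<^sup>+a. ?f a \<theta> \<partial>lborel) = ennreal (exp \<theta>) * (\<integral>\<^sup>+p. ?f (exp \<theta> * p) \<theta> \<partial>lborel)"
      using nn_integral_real_affine[of "\<lambda>a. ?f a \<theta>" "exp \<theta>" 0] by simp
    also have "\<dots> = (\<integral>\<^sup>+p. ennreal (exp \<theta>) * ?f (exp \<theta> * p) \<theta> \<partial>lborel)"
      by (rule nn_integral_cmult[symmetric]) measurable
    finally show "(\<integral>\<^sup>+a. ?f a \<theta> \<partial>lborel) = (\<integral>\<^sup>+p. ennreal (exp \<theta>) * ?f (exp \<theta> * p) \<theta> \<partial>lborel)" .
  qed
  also have "\<dots> = (\<integral>\<^sup>+p. \<integral>\<^sup>+\<theta>. ennreal (exp \<theta>) * ?f (exp \<theta> * p) \<theta> \<partial>lborel \<partial>lborel)"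
    by (rule lborel_pair.Fubini') measurable
  also have "\<dots> = (\<integral>\<^sup>+p. \<integral>\<^sup>+r. ennreal (1/2) * (h (lightcone (u0 * p) (v0 * r)) * ennreal (\<bar>u0\<bar> * \<bar>v0\<bar>))
      * indicator {0<..} p * indicator {0<..} r \<partial>lborel \<partial>lborel)"
  proof (rule nn_integral_cong)
    fix p :: real
    show "(\<integral>\<^sup>+\<theta>. ennreal (exp \<theta>) * ?f (exp \<theta> * p) \<theta> \<partial>lborel) =
      (\<integral>\<^sup>+r. ennreal (1/2) * (h (lightcone (u0 * p) (v0 * r)) * ennreal (\<bar>u0\<bar> * \<bar>v0\<bar>))
      * indicator {0<..} p * indicator {0<..} r \<partial>lborel)"
    proof (cases "p > 0")
      case False
      then have "indicator {0<..} (exp \<theta> * p) = (0::ennreal)" "indicator {0<..} p = (0::ennreal)" for \<theta>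
        by (auto simp: indicator_def zero_less_mult_iff)
      then show ?thesis by (simp only: mult_zero_right mult_zero_left)
    next
      case p: True
      let ?k = "\<lambda>r. ennreal (1/2) * (h (lightcone (u0 * p) (v0 * r)) * ennreal (\<bar>u0\<bar> * \<bar>v0\<bar>))"
      have e: "exp (ln p + 2 * \<theta>) = p * exp \<theta> * exp \<theta>" for \<theta>
        using p by (simp only: mult_2 exp_add exp_ln mult.assoc)
      have "(\<integral>\<^sup>+r. ?k r * indicator {0<..} p * indicator {0<..} r \<partial>lborel) = (\<integral>\<^sup>+r. ?k r * indicator {0<..} r \<partial>lborel)"
        using p by simp
      also have "\<dots> = (\<integral>\<^sup>+\<theta>. ?k (exp \<theta>) * ennreal (exp \<theta>) \<partial>lborel)"
        by (rule nn_integral_exp_substitution) measurable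
      also have "\<dots> = ennreal 2 * (\<integral>\<^sup>+\<theta>. ?k (exp (ln p + 2 * \<theta>)) * ennreal (exp (ln p + 2 * \<theta>)) \<partial>lborel)"
        by (subst nn_integral_real_affine[where c = 2 and t = "ln p"]) auto
      also have "\<dots> = (\<integral>\<^sup>+\<theta>. ennreal 2 * (?k (exp (ln p + 2 * \<theta>)) * ennreal (exp (ln p + 2 * \<theta>))) \<partial>lborel)"
        by (rule nn_integral_cmult[symmetric]) measurable
      also have "\<dots> = (\<integral>\<^sup>+\<theta>. ennreal (exp \<theta>) * ?f (exp \<theta> * p) \<theta> \<partial>lborel)"
      proof (rule nn_integral_cong)
        fix \<theta> :: real
        have l: "lightcone (exp \<theta> * p * exp (- \<theta>) * u0) (exp \<theta> * p * exp \<theta> * v0)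
            = lightcone (u0 * p) (v0 * exp (ln p + 2 * \<theta>))"
          unfolding e by (simp add: exp_minus field_simps)
        have c: "ennreal 2 * (ennreal (1/2) * (X * ennreal w) * ennreal z) = X * ennreal (w * z)"
          if "w \<ge> 0" "z \<ge> 0" for X w z
        proof -
          have "ennreal 2 * (ennreal (1/2) * (X * ennreal w) * ennreal z)
              = (ennreal 2 * ennreal (1/2)) * (X * (ennreal w * ennreal z))" by (simp only: ac_simps)
          also have "\<dots> = X * ennreal (w * z)"
            using that ennreal_mult[of 2 "1/2", symmetric] by (simp only: ennreal_mult[of w z]) simp
          finally show ?thesis .
        qed
        have "ennreal (exp \<theta>) * ?f (exp \<theta> * p) \<theta>
          = h (lightcone (u0 * p) (v0 * exp (ln p + 2 * \<theta>))) * (ennreal (exp \<theta>) * ennreal (exp \<theta> * p * (\<bar>u0\<bar> * \<bar>v0\<bar>)))"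
          unfolding l using p by (simp add: ac_simps)
        also have "ennreal (exp \<theta>) * ennreal (exp \<theta> * p * (\<bar>u0\<bar> * \<bar>v0\<bar>)) = ennreal (\<bar>u0\<bar> * \<bar>v0\<bar> * exp (ln p + 2 * \<theta>))"
          unfolding e using p by (subst ennreal_mult[symmetric]) (auto simp: ac_simps)
        finally show "ennreal 2 * (?k (exp (ln p + 2 * \<theta>)) * ennreal (exp (ln p + 2 * \<theta>)))
          = ennreal (exp \<theta>) * ?f (exp \<theta> * p) \<theta>"
          by (subst c) auto
      qed
      finally show ?thesis by simp
    qed
  qed
  also have "\<dots> = (\<integral>\<^sup>+p. \<integral>\<^sup>+r. ennreal (\<bar>u0\<bar> * \<bar>v0\<bar>) * (ennreal (1/2) * (h (lightcone (0 + u0 * p) (0 + v0 * r))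
      * indicator (cone i j) (lightcone (0 + u0 * p) (0 + v0 * r)))) \<partial>lborel \<partial>lborel)"
  proof (intro nn_integral_cong)
    fix p r :: real
    have "indicator (cone i j) (lightcone (0 + u0 * p) (0 + v0 * r)) = indicator {0<..} p * (indicator {0<..} r :: ennreal)"
      by (simp add: indicator_def q pos)
    then show "ennreal (1/2) * (h (lightcone (u0 * p) (v0 * r)) * ennreal (\<bar>u0\<bar> * \<bar>v0\<bar>))
        * indicator {0<..} p * indicator {0<..} r
      = ennreal (\<bar>u0\<bar> * \<bar>v0\<bar>) * (ennreal (1/2) * (h (lightcone (0 + u0 * p) (0 + v0 * r))
        * indicator (cone i j) (lightcone (0 + u0 * p) (0 + v0 * r))))"
      by (simp only: add_0_left ac_simps)
  qed
  also have "\<dots> = (\<integral>\<^sup>+u. \<integral>\<^sup>+v. ennreal (1/2) * (h (lightcone u v) * indicator (cone i j) (lightcone u v)) \<partial>lborel \<partial>lborel)"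
  proof -
    let ?g = "\<lambda>u v. ennreal (1/2) * (h (lightcone u v) * indicator (cone i j) (lightcone u v))"
    have "(\<integral>\<^sup>+u. \<integral>\<^sup>+v. ?g u v \<partial>lborel \<partial>lborel)
        = ennreal \<bar>u0\<bar> * (\<integral>\<^sup>+p. \<integral>\<^sup>+v. ?g (0 + u0 * p) v \<partial>lborel \<partial>lborel)"
      by (rule nn_integral_real_affine) (use nz in measurable)
    also have "\<dots> = ennreal \<bar>u0\<bar> * (\<integral>\<^sup>+p. ennreal \<bar>v0\<bar> * (\<integral>\<^sup>+r. ?g (0 + u0 * p) (0 + v0 * r) \<partial>lborel) \<partial>lborel)"
      by (intro arg_cong2[where f = "(*)"] refl nn_integral_cong nn_integral_real_affine) (use nz in measurable)
    also have "\<dots> = ennreal (\<bar>u0\<bar> * \<bar>v0\<bar>) * (\<integral>\<^sup>+p. \<integral>\<^sup>+r. ?g (0 + u0 * p) (0 + v0 * r) \<partial>lborel \<partial>lborel)"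
      by (subst nn_integral_cmult, measurable) (simp add: ennreal_mult mult.assoc)
    also have "\<dots> = (\<integral>\<^sup>+p. \<integral>\<^sup>+r. ennreal (\<bar>u0\<bar> * \<bar>v0\<bar>) * ?g (0 + u0 * p) (0 + v0 * r) \<partial>lborel \<partial>lborel)"
      by (simp add: nn_integral_cmult)
    finally show ?thesis by (rule sym)
  qed
  also have "\<dots> = (\<integral>\<^sup>+y. h y \<partial>cone_measure i j)"
    unfolding nn_integral_cone_measure by (rule nn_integral_lightcone[symmetric]) measurable
  finally show ?thesis .
qed

section \<open>Orthonormal bases over the cones\<close>

lemma countable_rational_points:
  "countable {a::'a::euclidean_space. \<forall>i\<in>Basis. a \<bullet> i \<in> \<rat>}"
proof -
  have "{a::'a. \<forall>i\<in>Basis. a \<bullet> i \<in> \<rat>} \<subseteq> (\<lambda>f. \<Sum>i\<in>Basis. f i *\<^sub>R i) ` (PiE Basis (\<lambda>_. \<rat>))"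
  proof
    fix a :: 'a assume a: "a \<in> {a::'a. \<forall>i\<in>Basis. a \<bullet> i \<in> \<rat>}"
    show "a \<in> (\<lambda>f. \<Sum>i\<in>Basis. f i *\<^sub>R i) ` (PiE Basis (\<lambda>_. \<rat>))"
      by (rule image_eqI[where x = "restrict (\<lambda>i. a \<bullet> i) Basis"]) (use a in \<open>auto simp: euclidean_representation\<close>)
  qed
  then show ?thesis
    by (rule countable_subset) (intro countable_image countable_PiE finite_Basis countable_rat)
qed

text \<open>Rational boxes form a countable base that is closed under intersections, so by Dynkin's argument the integral of
  \<open>f\<close> over every Borel subset of a bounded box vanishes as well.\<close>

lemma AE_zero_if_rational_box_integrals_zero:
  fixes f :: "'a::euclidean_space \<Rightarrow> complex"
  assumes [measurable]: "f \<in> borel_measurable borel"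
    and int: "\<And>a b. integrable lborel (\<lambda>x. indicator (box a b) x *\<^sub>R f x)"
    and zero: "\<And>a b. \<forall>i\<in>Basis. a \<bullet> i \<in> \<rat> \<and> b \<bullet> i \<in> \<rat> \<Longrightarrow> (\<integral>x. indicator (box a b) x *\<^sub>R f x \<partial>lborel) = 0"
  shows "AE x in lborel. f x = 0"
proof -
  let ?G = "{box a b | a b :: 'a. \<forall>i\<in>Basis. a \<bullet> i \<in> \<rat> \<and> b \<bullet> i \<in> \<rat>}"
  have Int: "\<exists>e f. (\<forall>i\<in>Basis. e \<bullet> i \<in> \<rat> \<and> f \<bullet> i \<in> \<rat>) \<and> box a b \<inter> box c d = box e f"
    if "\<forall>i\<in>Basis. a \<bullet> i \<in> \<rat> \<and> b \<bullet> i \<in> \<rat>" "\<forall>i\<in>Basis. c \<bullet> i \<in> \<rat> \<and> d \<bullet> i \<in> \<rat>" for a b c d :: 'a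
  proof (intro exI conjI)
    let ?e = "\<Sum>i\<in>Basis. max (a \<bullet> i) (c \<bullet> i) *\<^sub>R i" and ?f = "\<Sum>i\<in>Basis. min (b \<bullet> i) (d \<bullet> i) *\<^sub>R i"
    show "\<forall>i\<in>Basis. ?e \<bullet> i \<in> \<rat> \<and> ?f \<bullet> i \<in> \<rat>" using that by (auto simp: max_def min_def)
    show "box a b \<inter> box c d = box ?e ?f" by (auto simp: mem_box)
  qed
  have "Int_stable ?G"
  proof (rule Int_stableI)
    fix A B assume "A \<in> ?G" "B \<in> ?G"
    then obtain a b c d :: 'a where ab: "A = box a b" "\<forall>i\<in>Basis. a \<bullet> i \<in> \<rat> \<and> b \<bullet> i \<in> \<rat>"
      and cd: "B = box c d" "\<forall>i\<in>Basis. c \<bullet> i \<in> \<rat> \<and> d \<bullet> i \<in> \<rat>"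
      by (elim CollectE exE conjE)
    from Int[OF ab(2) cd(2)] obtain e f :: 'a where
      "\<forall>i\<in>Basis. e \<bullet> i \<in> \<rat> \<and> f \<bullet> i \<in> \<rat>" "box a b \<inter> box c d = box e f"
      by (elim exE conjE)
    then show "A \<inter> B \<in> ?G" unfolding ab(1) cd(1) by blast
  qed
  have "countable ((\<lambda>(a, b). box a b) ` ({a::'a. \<forall>i\<in>Basis. a \<bullet> i \<in> \<rat>} \<times> {a::'a. \<forall>i\<in>Basis. a \<bullet> i \<in> \<rat>}))"
    by (rule countable_image[OF countable_SIGMA[OF countable_rational_points countable_rational_points]])
  moreover have "?G \<subseteq> (\<lambda>(a, b). box a b) ` ({a::'a. \<forall>i\<in>Basis. a \<bullet> i \<in> \<rat>} \<times> {a::'a. \<forall>i\<in>Basis. a \<bullet> i \<in> \<rat>})"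
  proof
    fix X assume "X \<in> ?G"
    then obtain a b :: 'a where "X = box a b" "\<forall>i\<in>Basis. a \<bullet> i \<in> \<rat> \<and> b \<bullet> i \<in> \<rat>" by blast
    then show "X \<in> (\<lambda>(a, b). box a b) ` ({a::'a. \<forall>i\<in>Basis. a \<bullet> i \<in> \<rat>} \<times> {a::'a. \<forall>i\<in>Basis. a \<bullet> i \<in> \<rat>})"
      by (intro image_eqI[where x = "(a, b)"]) simp_all
  qed
  ultimately have "countable ?G" by (rule countable_subset[rotated])
  moreover have "topological_basis ?G"
  proof (rule topological_basisI)
    fix O' and x :: 'a assume O': "open O'" "x \<in> O'"
    then obtain e where e: "e > 0" "ball x e \<subseteq> O'" by (auto simp: open_contains_ball)
    from rational_boxes[OF e(1), of x] obtain a b where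
      "\<forall>i\<in>Basis. a \<bullet> i \<in> \<rat> \<and> b \<bullet> i \<in> \<rat>" "x \<in> box a b" "box a b \<subseteq> ball x e" by auto
    then show "\<exists>B'\<in>?G. x \<in> B' \<and> B' \<subseteq> O'" using e(2) by blast
  qed auto
  ultimately have "(borel :: 'a measure) = sigma UNIV ?G" by (rule borel_eq_countable_basis)
  then have "sets (borel :: 'a measure) = sets (sigma UNIV ?G)" by (rule arg_cong)
  also have "\<dots> = sigma_sets UNIV ?G" by (rule sets_measure_of) simp
  finally have borel: "sets (borel :: 'a measure) = sigma_sets UNIV ?G" .
  have GP: "?G \<subseteq> Pow UNIV" by simp
  have "AE x in lborel. indicator (box (- real N *\<^sub>R One) (real N *\<^sub>R One)) x *\<^sub>R f x = 0" for N :: nat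
  proof (rule sigma_finite_measure.density_zero[OF lborel.sigma_finite_measure_axioms int])
    let ?B = "box (- real N *\<^sub>R One) (real N *\<^sub>R One) :: 'a set"
    let ?F = "\<lambda>x. indicator ?B x *\<^sub>R f x"
    have B: "\<forall>i\<in>Basis. (- real N *\<^sub>R One :: 'a) \<bullet> i \<in> \<rat> \<and> (real N *\<^sub>R One :: 'a) \<bullet> i \<in> \<rat>" by simp
    fix A :: "'a set" assume "A \<in> sets lborel"
    then have A: "A \<in> sigma_sets UNIV ?G" unfolding sets_lborel borel .
    have meas: "X \<in> sets borel" if "X \<in> sigma_sets UNIV ?G" for X using that unfolding borel .
    have Fi: "integrable lborel (\<lambda>x. indicator X x *\<^sub>R ?F x)" if "X \<in> sets borel" for X
      by (rule integrable_mult_indicator) (use that int in auto)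
    have tot: "(\<integral>x. ?F x \<partial>lborel) = 0" by (rule zero[OF B])
    show "set_lebesgue_integral lborel A ?F = 0"
      using A
    proof (induction rule: sigma_sets_induct_disjoint[OF \<open>Int_stable ?G\<close> GP,
          consumes 1, case_names basic empty compl union])
      case (basic A)
      then obtain a b :: 'a where A: "A = box a b" "\<forall>i\<in>Basis. a \<bullet> i \<in> \<rat> \<and> b \<bullet> i \<in> \<rat>" by blast
      from Int[OF A(2) B] obtain e g where eg: "\<forall>i\<in>Basis. e \<bullet> i \<in> \<rat> \<and> g \<bullet> i \<in> \<rat>" "A \<inter> ?B = box e g"
        unfolding A(1) by blast
      have "set_lebesgue_integral lborel A ?F = (\<integral>x. indicator (box e g) x *\<^sub>R f x \<partial>lborel)"
        unfolding set_lebesgue_integral_def eg(2)[symmetric]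
        by (rule Bochner_Integration.integral_cong) (auto simp: indicator_def)
      then show ?case using zero[OF eg(1)] by simp
    next
      case empty
      then show ?case by (simp add: set_lebesgue_integral_def)
    next
      case (compl A)
      have "set_lebesgue_integral lborel (UNIV - A) ?F = (\<integral>x. ?F x - indicator A x *\<^sub>R ?F x \<partial>lborel)"
        unfolding set_lebesgue_integral_def
      proof (rule Bochner_Integration.integral_cong)
        show "indicat_real (UNIV - A) x *\<^sub>R ?F x = ?F x - indicator A x *\<^sub>R ?F x" for x
          by (cases "x \<in> A") simp_all
      qed simp
      also have "\<dots> = (\<integral>x. ?F x \<partial>lborel) - (\<integral>x. indicator A x *\<^sub>R ?F x \<partial>lborel)"
        by (rule Bochner_Integration.integral_diff) (use int Fi[OF meas[OF compl(1)]] in auto)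
      finally show ?case using compl tot by (simp add: set_lebesgue_integral_def)
    next
      case (union A)
      have A: "range A \<subseteq> sets lborel" using union meas by auto
      have "set_lebesgue_integral lborel (\<Union>i. A i) ?F = (\<Sum>i. set_lebesgue_integral lborel (A i) ?F)"
      proof (rule lebesgue_integral_countable_add)
        show "A i \<inter> A j = {}" if "i \<noteq> j" for i j using union(1) that unfolding disjoint_family_on_def by blast
        show "set_integrable lborel (\<Union>i. A i) ?F"
          unfolding set_integrable_def by (rule Fi) (use A in auto)
      qed (use A in auto)
      then show ?case using union by simp
    qed
  qed
  then have "AE x in lborel. \<forall>N::nat. indicator (box (- real N *\<^sub>R One) (real N *\<^sub>R One)) x *\<^sub>R f x = 0"
    unfolding AE_all_countable by blast
  then show ?thesis
  proof eventually_elim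
    case (elim x)
    obtain N :: nat where N: "norm x < real N" using reals_Archimedean2 by blast
    have "x \<in> box (- real N *\<^sub>R One) (real N *\<^sub>R One)"
      unfolding mem_box
    proof
      fix i :: 'a assume i: "i \<in> Basis"
      have "\<bar>x \<bullet> i\<bar> < real N" using Basis_le_norm[OF i, of x] N by linarith
      then show "(- real N *\<^sub>R One) \<bullet> i < x \<bullet> i \<and> x \<bullet> i < (real N *\<^sub>R One) \<bullet> i" using i by auto
    qed
    then show ?case using elim[rule_format, of N] by simp
  qed
qed

lemma borel_measurable_cone_measure_iff:
  fixes f :: "plane \<Rightarrow> complex"
  shows "f \<in> borel_measurable (cone_measure i j) \<longleftrightarrow> (\<lambda>x. indicator (cone i j) x *\<^sub>R f x) \<in> borel_measurable borel"
  unfolding cone_measure_def by (subst borel_measurable_restrict_space_iff) auto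

lemma indicator_box_L2_cone: "(\<lambda>x. indicator (box a b) x) \<in> L2 (cone_measure i j)"
proof -
  have "(\<lambda>x. (cmod (indicator (box a b) x))\<^sup>2) = indicator (box a b)" by (auto simp: indicator_def)
  moreover have "integrable lborel (\<lambda>x. indicator (cone i j) x *\<^sub>R (indicator (box a b) x :: real))"
    by (rule integrable_mult_indicator) (auto intro: integrable_real_indicator simp: emeasure_lborel_box_eq)
  then have "integrable (cone_measure i j) (indicator (box a b) :: _ \<Rightarrow> real)"
    unfolding cone_measure_def by (subst integrable_restrict_space) simp_all
  ultimately show ?thesis by (simp add: L2_def borel_measurable_cone_measure)
qed

lemma L2_cone_total:
  assumes f: "f \<in> L2 (cone_measure i j)"
    and zero: "\<And>a b. \<forall>k\<in>Basis. a \<bullet> k \<in> \<rat> \<and> b \<bullet> k \<in> \<rat> \<Longrightarrow>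
      L2_inner (cone_measure i j) f (\<lambda>x. indicator (box a b) x) = 0"
  shows "AE x in cone_measure i j. f x = 0"
proof -
  let ?f = "\<lambda>x. indicator (cone i j) x *\<^sub>R f x"
  have fm: "?f \<in> borel_measurable borel"
    using L2_D(1)[OF f] by (simp add: borel_measurable_cone_measure_iff)
  note i1 = indicator_box_L2_cone
  have eq: "indicator (cone i j) x *\<^sub>R (f x * cnj (indicator (box a b) x)) = indicator (box a b) x *\<^sub>R ?f x" for a b x
    by (auto simp: indicator_def)
  have "AE x in lborel. ?f x = 0"
  proof (rule AE_zero_if_rational_box_integrals_zero[OF fm])
    fix a b :: plane
    have "integrable (cone_measure i j) (\<lambda>x. f x * cnj (indicator (box a b) x))"
      by (rule L2_inner_integrable[OF f i1])
    then show "integrable lborel (\<lambda>x. indicator (box a b) x *\<^sub>R ?f x)"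
      unfolding cone_measure_def by (subst (asm) integrable_restrict_space) (simp_all only: eq, simp)
    assume "\<forall>k\<in>Basis. a \<bullet> k \<in> \<rat> \<and> b \<bullet> k \<in> \<rat>"
    from zero[OF this] show "(\<integral>x. indicator (box a b) x *\<^sub>R ?f x \<partial>lborel) = 0"
      unfolding cone_measure_def L2_inner_def by (subst (asm) integral_restrict_space) (simp_all only: eq, simp)
  qed
  then show ?thesis
    unfolding cone_measure_def by (subst AE_restrict_space_iff) (auto elim: AE_mp)
qed

text \<open>Unit squares of the light-cone grid inside the cone are disjoint and have area \<open>1/2\<close>, the Jacobian of the
  light-cone coordinates; the normalising factor is therefore \<open>\<surd>2\<close>.\<close>

lemma cone_infinite_orthonormal_family:
  assumes "i \<in> {1, 2}" "j \<in> {1, 2}"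
  shows "\<exists>g. orthonormal_family (cone_measure i j) (UNIV :: nat set) g"
proof -
  obtain s t :: real where st: "s \<in> {1, -1}" "t \<in> {1, -1}"
    and q: "\<And>u v. lightcone u v \<in> cone i j \<longleftrightarrow> s * u > 0 \<and> t * v > 0"
    using cone_quadrant[OF assms] by blast
  define A where "A k = {x :: plane. s * (fst x + snd x) \<in> {real k <..< real k + 1} \<and> t * (fst x - snd x) \<in> {0<..<1}}" for k :: nat
  have [measurable]: "A k \<in> sets borel" for k
  proof -
    have "A k = {x \<in> space borel. real k < s * (fst x + snd x) \<and> s * (fst x + snd x) < real k + 1
        \<and> 0 < t * (fst x - snd x) \<and> t * (fst x - snd x) < 1}" by (auto simp: A_def)
    also have "\<dots> \<in> sets borel" by measurable
    finally show ?thesis .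
  qed
  have sub: "x \<in> cone i j" if "x \<in> A k" for x k
  proof -
    obtain u v where x: "x = lightcone u v" by (rule lightcone_cases)
    have "fst x + snd x = u" "fst x - snd x = v" by (simp_all add: x lightcone_def field_simps)
    then show ?thesis using that by (auto simp: A_def q x)
  qed
  have len: "(\<integral>\<^sup>+u. indicator {c<..<c+1} (r * u) \<partial>lborel) = 1" if "r \<in> {1, -1}" for r c :: real
  proof -
    have "(\<integral>\<^sup>+u. indicator {c<..<c+1} (r * u) \<partial>lborel) = (\<integral>\<^sup>+u. indicator {c<..<c+1} u \<partial>lborel)"
      using that nn_integral_real_affine[of "indicator {c<..<c+1}" r 0] by auto
    then show ?thesis by simp
  qed
  have em: "emeasure lborel (A k) = ennreal (1/2)" for k
  proof -
    have "emeasure lborel (A k) = (\<integral>\<^sup>+x. indicator (A k) x \<partial>lborel)" by simp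
    also have "\<dots> = (\<integral>\<^sup>+u. \<integral>\<^sup>+v. ennreal (1/2) * indicator (A k) (lightcone u v) \<partial>lborel \<partial>lborel)"
      by (rule nn_integral_lightcone) measurable
    also have "\<dots> = (\<integral>\<^sup>+u. \<integral>\<^sup>+v. (ennreal (1/2) * indicator {real k<..<real k+1} (s * u)) * indicator {0<..<0+1} (t * v) \<partial>lborel \<partial>lborel)"
    proof (intro nn_integral_cong)
      fix u v
      have "fst (lightcone u v) + snd (lightcone u v) = u" "fst (lightcone u v) - snd (lightcone u v) = v"
        by (simp_all add: lightcone_def field_simps)
      then have "(indicator (A k) (lightcone u v) :: ennreal) = indicator {real k<..<real k+1} (s * u) * indicator {0<..<0+1} (t * v)"
        by (auto simp: A_def indicator_def)
      then show "ennreal (1/2) * indicator (A k) (lightcone u v) = (ennreal (1/2) * indicator {real k<..<real k+1} (s * u)) * indicator {0<..<0+1} (t * v)"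
        by (simp only: mult.assoc)
    qed
    also have "\<dots> = (\<integral>\<^sup>+u. (ennreal (1/2) * indicator {real k<..<real k+1} (s * u)) * 1 \<partial>lborel)"
      by (intro nn_integral_cong) (subst nn_integral_cmult, measurable, simp only: len[OF st(2)])
    also have "\<dots> = ennreal (1/2) * (\<integral>\<^sup>+u. indicator {real k<..<real k+1} (s * u) \<partial>lborel)"
      unfolding mult_1_right by (rule nn_integral_cmult) measurable
    also have "\<dots> = ennreal (1/2)" by (simp only: len[OF st(1)] mult_1_right)
    finally show ?thesis .
  qed
  have me: "measure lborel (A k) = 1/2" for k
    unfolding measure_def em by (rule enn2real_ennreal) simp
  have disj: "A k \<inter> A l = {}" if "k \<noteq> l" for k l
  proof (rule ccontr)
    assume "A k \<inter> A l \<noteq> {}"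
    then obtain y where "real k < y" "y < real k + 1" "real l < y" "y < real l + 1" by (auto simp: A_def)
    then have "real k < real (l + 1)" "real l < real (k + 1)" by auto
    then show False using that by linarith
  qed
  define g where "g k x = complex_of_real (sqrt 2) * indicator (A k) x" for k x
  have [measurable]: "g k \<in> borel_measurable borel" for k unfolding g_def by measurable
  have int: "integrable (cone_measure i j) (\<lambda>x. indicator (A k) x :: real)"
    and val: "(\<integral>x. indicator (A k) x \<partial>cone_measure i j) = (1/2 :: real)" for k
  proof -
    have e: "indicator (cone i j) x *\<^sub>R indicator (A k) x = (indicator (A k) x :: real)" for x
      using sub by (auto simp: indicator_def)
    have "integrable lborel (indicator (A k) :: plane \<Rightarrow> real)"
      by (rule integrable_real_indicator) (simp_all only: em ennreal_less_top infinity_ennreal_def sets_lborel, measurable)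
    then show "integrable (cone_measure i j) (\<lambda>x. indicator (A k) x :: real)"
      unfolding cone_measure_def by (subst integrable_restrict_space) (simp_all only: e, simp)
    show "(\<integral>x. indicator (A k) x \<partial>cone_measure i j) = (1/2 :: real)"
      unfolding cone_measure_def by (subst integral_restrict_space) (simp_all only: e, simp_all add: me)
  qed
  have gL: "g k \<in> L2 (cone_measure i j)" for k
  proof -
    have "(\<lambda>x. (cmod (g k x))\<^sup>2) = (\<lambda>x. 2 * indicator (A k) x)"
    proof
      show "(cmod (g k x))\<^sup>2 = 2 * indicator (A k) x" for x
        unfolding g_def norm_mult power_mult_distrib by (cases "x \<in> A k") simp_all
    qed
    moreover have "integrable (cone_measure i j) (\<lambda>x. 2 * indicator (A k) x :: real)"
      by (rule integrable_mult_right[OF int])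
    ultimately have "integrable (cone_measure i j) (\<lambda>x. (cmod (g k x))\<^sup>2)" by (simp only:)
    then show ?thesis by (simp add: L2_def borel_measurable_cone_measure)
  qed
  have gi: "L2_inner (cone_measure i j) (g k) (g l) = (if k = l then 1 else 0)" for k l
  proof (cases "k = l")
    case True
    have "g k x * cnj (g k x) = complex_of_real (2 * indicator (A k) x)" for x
      by (cases "x \<in> A k") (simp_all add: g_def flip: of_real_mult)
    then have "L2_inner (cone_measure i j) (g k) (g k) = complex_of_real (\<integral>x. 2 * indicator (A k) x \<partial>cone_measure i j)"
      unfolding L2_inner_def by (simp only: integral_complex_of_real)
    also have "(\<integral>x. 2 * indicator (A k) x \<partial>cone_measure i j) = (1 :: real)"
      by (simp only: integral_mult_right_zero val)
    finally show ?thesis using True by simp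
  next
    case False
    then have "g k x * cnj (g l x) = 0" for x using disj[OF False] by (auto simp: g_def indicator_def)
    then show ?thesis using False by (simp only: L2_inner_def) simp
  qed
  show ?thesis by (intro exI[of _ g]) (simp add: orthonormal_family_def gL gi)
qed

lemma some_basis_cone:
  assumes "i \<in> {1, 2}" "j \<in> {1, 2}"
  shows "orthonormal_basis (cone_measure i j) (some_basis (cone_measure i j))"
proof (rule some_basis_orthonormal)
  obtain g where g: "orthonormal_family (cone_measure i j) (UNIV :: nat set) g"
    using cone_infinite_orthonormal_family[OF assms] by blast
  let ?Q = "{a::plane. \<forall>k\<in>Basis. a \<bullet> k \<in> \<rat>}"
  let ?V = "(\<lambda>(a, b) x. indicator (box a b) x :: complex) ` (?Q \<times> ?Q)"
  have cV: "countable ?V" by (intro countable_image countable_SIGMA countable_rational_points)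
  have inV: "(\<lambda>x. indicator (box a b) x) \<in> ?V" if "\<forall>k\<in>Basis. a \<bullet> k \<in> \<rat> \<and> b \<bullet> k \<in> \<rat>" for a b :: plane
    by (rule image_eqI[where x = "(a, b)"]) (use that in simp_all)
  have "(\<lambda>x. indicator (box 0 0) x) \<in> ?V" by (rule inV) simp
  then have ne: "?V \<noteq> {}" by blast
  show "\<exists>e. orthonormal_basis (cone_measure i j) e"
  proof (rule orthonormal_basis_exists[OF _ _ g, where v = "from_nat_into ?V"])
    show "from_nat_into ?V k \<in> L2 (cone_measure i j)" for k
    proof -
      obtain a b :: plane where "from_nat_into ?V k = (\<lambda>x. indicator (box a b) x)"
        using from_nat_into[OF ne, of k] by auto
      then show ?thesis by (simp add: indicator_box_L2_cone)
    qed
    fix f assume f: "f \<in> L2 (cone_measure i j)" and orth: "\<And>k. L2_inner (cone_measure i j) f (from_nat_into ?V k) = 0"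
    show "AE x in cone_measure i j. f x = 0"
    proof (rule L2_cone_total[OF f])
      fix a b :: plane assume "\<forall>k\<in>Basis. a \<bullet> k \<in> \<rat> \<and> b \<bullet> k \<in> \<rat>"
      from from_nat_into_surj[OF cV inV[OF this]] obtain k where "from_nat_into ?V k = (\<lambda>x. indicator (box a b) x)"
        by (rule exE)
      then show "L2_inner (cone_measure i j) f (\<lambda>x. indicator (box a b) x) = 0" using orth[of k] by simp
    qed
  qed
qed

section \<open>Haar measure\<close>

lemma sets_eq_if_id_measurable:
  assumes "space M = space N" "(\<lambda>x. x) \<in> measurable M N" "(\<lambda>x. x) \<in> measurable N M"
  shows "sets M = sets N"
proof -
  have step: "A \<in> sets X" if "space X = space Y" "(\<lambda>x. x) \<in> measurable X Y" "A \<in> sets Y" for A :: "'a set" and X Y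
    using measurable_sets[OF that(2,3)] sets.sets_into_space[OF that(3)] that(1)
    by (simp add: Int_absorb2)
  show ?thesis
    using step[OF assms(1,2)] step[OF assms(1)[symmetric] assms(3)] by blast
qed

text \<open>Used to split the translations off Haar measure, which is defined on a subset of the full product space.\<close>

lemma pair_measure_restrict_space_right:
  assumes "sigma_finite_measure M" "sigma_finite_measure N" and \<Omega>: "\<Omega> \<in> sets N"
  shows "M \<Otimes>\<^sub>M restrict_space N \<Omega> = restrict_space (M \<Otimes>\<^sub>M N) (space M \<times> \<Omega>)"
proof (rule pair_measure_eqI)
  interpret N: sigma_finite_measure N by fact
  let ?P = "M \<Otimes>\<^sub>M restrict_space N \<Omega>" and ?R = "restrict_space (M \<Otimes>\<^sub>M N) (space M \<times> \<Omega>)"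
  have sub: "\<Omega> \<subseteq> space N" by (rule sets.sets_into_space[OF \<Omega>])
  show "sigma_finite_measure M" by fact
  show "sigma_finite_measure (restrict_space N \<Omega>)"
    by (rule sigma_finite_measure_restrict_space) fact+
  show "sets ?P = sets ?R"
  proof (rule sets_eq_if_id_measurable)
    show "space ?P = space ?R" using sub by (auto simp: space_pair_measure space_restrict_space)
    have "(\<lambda>x. (fst x, snd x)) \<in> measurable ?P (M \<Otimes>\<^sub>M N)"
      by (intro measurable_Pair measurable_fst measurable_compose[OF measurable_snd] measurable_restrict_space1 measurable_ident_sets refl)
    then show "(\<lambda>x. x) \<in> measurable ?P ?R"
      using sub by (intro measurable_restrict_space2) (auto simp: space_pair_measure space_restrict_space)
    have "fst \<in> measurable ?R M" by (rule measurable_restrict_space1[OF measurable_fst])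
    moreover have "snd \<in> measurable ?R (restrict_space N \<Omega>)"
      by (rule measurable_restrict_space2[OF _ measurable_restrict_space1[OF measurable_snd]])
        (auto simp: space_pair_measure space_restrict_space)
    ultimately have "(\<lambda>x. (fst x, snd x)) \<in> measurable ?R ?P" by (rule measurable_Pair)
    then show "(\<lambda>x. x) \<in> measurable ?R ?P" by simp
  qed
  fix A B assume A: "A \<in> sets M" and B: "B \<in> sets (restrict_space N \<Omega>)"
  then have B': "B \<in> sets N" "B \<subseteq> \<Omega>" using \<Omega> by (auto simp: sets_restrict_space_iff sub)
  have "emeasure ?R (A \<times> B) = emeasure (M \<Otimes>\<^sub>M N) (A \<times> B)"
    by (rule emeasure_restrict_space) (use \<Omega> sub B' sets.sets_into_space[OF A] in \<open>auto simp: space_pair_measure\<close>)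
  also have "\<dots> = emeasure M A * emeasure N B" by (rule N.emeasure_pair_measure_Times[OF A B'(1)])
  also have "emeasure N B = emeasure (restrict_space N \<Omega>) B"
    by (rule emeasure_restrict_space[symmetric]) (use \<Omega> sub B' in auto)
  finally show "emeasure M A * emeasure (restrict_space N \<Omega>) B = emeasure ?R (A \<times> B)" by simp
qed

text \<open>What remains of Haar measure when the translations are split off.\<close>
definition dilation_boost_measure :: "(real \<times> real) measure" where
  "dilation_boost_measure =
     density (restrict_space lborel ({0<..} \<times> UNIV)) (\<lambda>(a, \<theta>). ennreal (1 / a ^ 3))"

lemma space_haar [simp]: "space haar = poincare_group"
  by (simp add: haar_def space_restrict_space)

lemma sets_poincare_group [measurable]: "poincare_group \<in> sets borel"
proof -
  have "poincare_group = {\<xi> \<in> space borel. fst (snd \<xi>) > 0}" by (auto simp: poincare_group_def)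
  also have "\<dots> \<in> sets borel" by measurable
  finally show ?thesis .
qed

lemma sets_dilation_boost [measurable]: "({0<..} \<times> UNIV :: (real \<times> real) set) \<in> sets borel"
  by (intro borel_open open_Times) auto

lemma space_dilation_boost_measure [simp]: "space dilation_boost_measure = {0<..} \<times> UNIV"
  by (simp add: dilation_boost_measure_def space_restrict_space)

lemma borel_measurable_haar_eq: "borel_measurable haar = borel_measurable (restrict_space lborel poincare_group)"
  by (rule measurable_cong_sets) (simp_all add: haar_def)

lemma borel_measurable_haar: "f \<in> borel_measurable borel \<Longrightarrow> f \<in> borel_measurable haar"
  unfolding borel_measurable_haar_eq by (rule measurable_restrict_space1) simp

lemma borel_measurable_dilation_boost_measure:
  "f \<in> borel_measurable borel \<Longrightarrow> f \<in> borel_measurable dilation_boost_measure"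
  unfolding dilation_boost_measure_def
  by (subst measurable_cong_sets[OF sets_density refl]) (rule measurable_restrict_space1, simp)

lemma sigma_finite_dilation_boost_measure: "sigma_finite_measure dilation_boost_measure"
proof -
  interpret R: sigma_finite_measure "restrict_space lborel ({0<..} \<times> UNIV) :: (real \<times> real) measure"
    by (rule sigma_finite_measure_restrict_space) (auto intro: lborel.sigma_finite_measure_axioms)
  have m: "(\<lambda>(a, \<theta>). ennreal (1 / a ^ 3)) \<in> borel_measurable (restrict_space lborel ({0<..} \<times> UNIV) :: (real \<times> real) measure)"
    by (rule measurable_restrict_space1) (simp add: split_beta')
  show ?thesis
    unfolding dilation_boost_measure_def R.sigma_finite_iff_density_finite[OF m] by (auto split: prod.split)
qed

lemma haar_eq_pair: "haar = lborel \<Otimes>\<^sub>M dilation_boost_measure"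
proof -
  let ?R = "restrict_space lborel ({0<..} \<times> UNIV) :: (real \<times> real) measure"
  have m: "(\<lambda>(a, \<theta>). ennreal (1 / a ^ 3)) \<in> borel_measurable ?R"
    by (rule measurable_restrict_space1) (simp add: split_beta')
  have s: "sigma_finite_measure ?R"
    by (rule sigma_finite_measure_restrict_space) (auto intro: lborel.sigma_finite_measure_axioms)
  have "lborel \<Otimes>\<^sub>M dilation_boost_measure = density lborel (\<lambda>_. 1) \<Otimes>\<^sub>M density ?R (\<lambda>(a, \<theta>). ennreal (1 / a ^ 3))"
    by (simp add: dilation_boost_measure_def density_1)
  also have "\<dots> = density (lborel \<Otimes>\<^sub>M ?R) (\<lambda>(x, y). 1 * (\<lambda>(a, \<theta>). ennreal (1 / a ^ 3)) y)"
    by (rule pair_measure_density)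
      (use m s sigma_finite_dilation_boost_measure in \<open>auto simp: dilation_boost_measure_def\<close>)
  also have "lborel \<Otimes>\<^sub>M ?R = restrict_space (lborel \<Otimes>\<^sub>M lborel) (space lborel \<times> ({0<..} \<times> UNIV))"
    by (rule pair_measure_restrict_space_right) (auto intro: lborel.sigma_finite_measure_axioms)
  also have "\<dots> = restrict_space lborel poincare_group"
    unfolding lborel_prod by (rule arg_cong[where f = "restrict_space lborel"]) (auto simp: poincare_group_def)
  also have "density \<dots> (\<lambda>(x, y). 1 * (\<lambda>(a, \<theta>). ennreal (1 / a ^ 3)) y) = haar"
    unfolding haar_def by (rule arg_cong[where f = "density _"]) (auto simp: fun_eq_iff)
  finally show ?thesis by simp
qed

lemma sigma_finite_haar: "sigma_finite_measure haar"
proof -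
  interpret sigma_finite_measure dilation_boost_measure by (rule sigma_finite_dilation_boost_measure)
  interpret pair_sigma_finite lborel dilation_boost_measure ..
  show ?thesis unfolding haar_eq_pair by (rule sigma_finite_measure_axioms)
qed

lemma nn_integral_dilation_boost_measure:
  assumes [measurable]: "k \<in> borel_measurable borel"
  shows "(\<integral>\<^sup>+p. k p \<partial>dilation_boost_measure)
    = (\<integral>\<^sup>+a. \<integral>\<^sup>+\<theta>. k (a, \<theta>) * (ennreal (1 / a ^ 3) * indicator {0<..} a) \<partial>lborel \<partial>lborel)"
proof -
  let ?R = "restrict_space lborel ({0<..} \<times> UNIV) :: (real \<times> real) measure"
  have m: "(\<lambda>(a, \<theta>). ennreal (1 / a ^ 3)) \<in> borel_measurable ?R"
    by (rule measurable_restrict_space1) (simp add: split_beta')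
  have k: "k \<in> borel_measurable ?R" by (rule measurable_restrict_space1) simp
  have "(\<integral>\<^sup>+p. k p \<partial>dilation_boost_measure)
      = (\<integral>\<^sup>+p. (\<lambda>(a, \<theta>). ennreal (1 / a ^ 3)) p * k p \<partial>?R)"
    unfolding dilation_boost_measure_def by (rule nn_integral_density[OF m k])
  also have "\<dots> = (\<integral>\<^sup>+p. (\<lambda>(a, \<theta>). ennreal (1 / a ^ 3)) p * k p * indicator ({0<..} \<times> UNIV) p \<partial>lborel)"
    by (rule nn_integral_restrict_space) simp
  also have "\<dots> = (\<integral>\<^sup>+p. k p * (ennreal (1 / fst p ^ 3) * indicator {0<..} (fst p)) \<partial>(lborel \<Otimes>\<^sub>M lborel))"
    unfolding lborel_prod by (intro nn_integral_cong) (auto simp: indicator_def mult.commute)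
  also have "\<dots> = (\<integral>\<^sup>+a. \<integral>\<^sup>+\<theta>. k (a, \<theta>) * (ennreal (1 / a ^ 3) * indicator {0<..} a) \<partial>lborel \<partial>lborel)"
    by (subst lborel.nn_integral_fst[symmetric]) (simp_all add: lborel_prod)
  finally show ?thesis .
qed

lemma nn_integral_haar:
  assumes [measurable]: "h \<in> borel_measurable borel"
  shows "(\<integral>\<^sup>+\<xi>. h \<xi> \<partial>haar)
    = (\<integral>\<^sup>+a. \<integral>\<^sup>+\<theta>. (\<integral>\<^sup>+b. h (b, a, \<theta>) \<partial>lborel) * (ennreal (1 / a ^ 3) * indicator {0<..} a) \<partial>lborel \<partial>lborel)"
proof -
  interpret sigma_finite_measure dilation_boost_measure by (rule sigma_finite_dilation_boost_measure)
  interpret pair_sigma_finite lborel dilation_boost_measure ..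
  have hm: "h \<in> borel_measurable (lborel \<Otimes>\<^sub>M dilation_boost_measure)"
    unfolding haar_eq_pair[symmetric] by (rule borel_measurable_haar) simp
  have "(\<integral>\<^sup>+\<xi>. h \<xi> \<partial>haar) = (\<integral>\<^sup>+p. \<integral>\<^sup>+b. h (b, p) \<partial>lborel \<partial>dilation_boost_measure)"
    unfolding haar_eq_pair by (rule nn_integral_snd[symmetric]) (use hm in simp)
  also have "\<dots> = (\<integral>\<^sup>+a. \<integral>\<^sup>+\<theta>. (\<integral>\<^sup>+b. h (b, a, \<theta>) \<partial>lborel) * (ennreal (1 / a ^ 3) * indicator {0<..} a) \<partial>lborel \<partial>lborel)"
    by (rule nn_integral_dilation_boost_measure) measurable
  finally show ?thesis .
qed

lemma pmult_closed: "u \<in> poincare_group \<Longrightarrow> v \<in> poincare_group \<Longrightarrow> u \<star> v \<in> poincare_group"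
  by (auto simp: poincare_group_def pmult_def)

lemma pinv_closed: "u \<in> poincare_group \<Longrightarrow> pinv u \<in> poincare_group"
  by (auto simp: poincare_group_def pinv_def)

lemma psqrt_closed: "u \<in> poincare_group \<Longrightarrow> psqrt u \<in> poincare_group"
  by (auto simp: poincare_group_def psqrt_def)

lemma borel_measurable_pmult [measurable (raw)]:
  assumes [measurable]: "f \<in> borel_measurable M" "g \<in> borel_measurable M"
  shows "(\<lambda>x. f x \<star> g x) \<in> borel_measurable M"
  unfolding pmult_def case_prod_beta by measurable

lemma borel_measurable_pinv [measurable (raw)]:
  assumes [measurable]: "f \<in> borel_measurable M"
  shows "(\<lambda>x. pinv (f x)) \<in> borel_measurable M"
  unfolding pinv_def case_prod_beta by measurable

lemma borel_measurable_psqrt [measurable (raw)]: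
  assumes [measurable]: "f \<in> borel_measurable M"
  shows "(\<lambda>x. psqrt (f x)) \<in> borel_measurable M"
  unfolding psqrt_def case_prod_beta cosh_def by measurable

lemma measurable_haar_iff:
  "f \<in> measurable M haar \<longleftrightarrow> f \<in> borel_measurable M \<and> f \<in> space M \<rightarrow> poincare_group"
proof -
  have "measurable M haar = measurable M (restrict_space borel poincare_group)"
    by (rule measurable_cong_sets) (simp_all add: haar_def sets_restrict_space)
  then show ?thesis by (auto simp: measurable_restrict_space2_iff)
qed

lemma ident_haar_borel: "(\<lambda>x. x) \<in> borel_measurable haar"
  by (rule borel_measurable_haar) simp

text \<open>Left translation by \<open>(b\<^sub>0, a\<^sub>0, \<theta>\<^sub>0)\<close> scales Lebesgue measure by \<open>a\<^sub>0\<^sup>2\<close> in \<open>b\<close> and by \<open>a\<^sub>0\<close> in \<open>a\<close>;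
  the density \<open>1 / a\<^sup>3\<close> compensates both.\<close>

lemma nn_integral_haar_left_invariant:
  assumes h: "h \<in> borel_measurable haar" and g: "g \<in> poincare_group"
  shows "(\<integral>\<^sup>+\<xi>. h (g \<star> \<xi>) \<partial>haar) = (\<integral>\<^sup>+\<xi>. h \<xi> \<partial>haar)"
proof -
  obtain b0 a0 \<theta>0 where g': "g = (b0, a0, \<theta>0)" and a0: "a0 > 0" using g by (auto simp: poincare_group_def)
  define k where "k \<xi> = h \<xi> * indicator poincare_group \<xi>" for \<xi>
  have [measurable]: "k \<in> borel_measurable borel"
    using h unfolding borel_measurable_haar_eq k_def[abs_def]
    by (subst (asm) borel_measurable_restrict_space_iff_ennreal) simp_all
  let ?w = "\<lambda>a. ennreal (1 / a ^ 3) * indicator {0<..} a :: ennreal"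
  have w: "ennreal a0 * (ennreal (a0\<^sup>2) * ?w (0 + a0 * a)) = ?w a" for a
  proof (cases "a > 0")
    case True
    have "(a0 * a) ^ 3 = a0 * a0\<^sup>2 * a ^ 3" by (simp add: power_mult_distrib power2_eq_square power3_eq_cube)
    then have "a0 * (a0\<^sup>2 * (1 / (a0 * a) ^ 3)) = 1 / a ^ 3" using a0 by simp
    then show ?thesis using a0 True by (simp add: ennreal_mult[symmetric])
  next
    case False
    then show ?thesis using a0 by (simp add: zero_less_mult_iff)
  qed
  have "(\<integral>\<^sup>+\<xi>. h \<xi> \<partial>haar) = (\<integral>\<^sup>+\<xi>. k \<xi> \<partial>haar)"
    by (rule nn_integral_cong) (simp add: k_def)
  also have "\<dots> = (\<integral>\<^sup>+a. \<integral>\<^sup>+\<theta>. (\<integral>\<^sup>+b. k (b, a, \<theta>) \<partial>lborel) * ?w a \<partial>lborel \<partial>lborel)"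
    by (rule nn_integral_haar) measurable
  also have "\<dots> = ennreal \<bar>a0\<bar> * (\<integral>\<^sup>+a. \<integral>\<^sup>+\<theta>. (\<integral>\<^sup>+b. k (b, 0 + a0 * a, \<theta>) \<partial>lborel) * ?w (0 + a0 * a) \<partial>lborel \<partial>lborel)"
    by (rule nn_integral_real_affine) (use a0 in auto)
  also have "\<dots> = (\<integral>\<^sup>+a. \<integral>\<^sup>+\<theta>. ennreal a0 * ((\<integral>\<^sup>+b. k (b, 0 + a0 * a, \<theta>) \<partial>lborel) * ?w (0 + a0 * a)) \<partial>lborel \<partial>lborel)"
    using a0 by (simp add: nn_integral_cmult)
  also have "\<dots> = (\<integral>\<^sup>+a. \<integral>\<^sup>+\<theta>. (\<integral>\<^sup>+b. k (g \<star> (b, a, \<theta>)) \<partial>lborel) * ?w a \<partial>lborel \<partial>lborel)"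
  proof (rule nn_integral_cong)
    fix a :: real
    let ?K = "\<lambda>\<theta>. ennreal a0 * ((\<integral>\<^sup>+b. k (b, 0 + a0 * a, \<theta>) \<partial>lborel) * ?w (0 + a0 * a))"
    have "(\<integral>\<^sup>+\<theta>. ?K \<theta> \<partial>lborel) = ennreal \<bar>1\<bar> * (\<integral>\<^sup>+\<theta>. ?K (\<theta>0 + 1 * \<theta>) \<partial>lborel)"
      by (rule nn_integral_real_affine) auto
    also have "\<dots> = (\<integral>\<^sup>+\<theta>. ?K (\<theta>0 + \<theta>) \<partial>lborel)" by simp
    also have "\<dots> = (\<integral>\<^sup>+\<theta>. (\<integral>\<^sup>+b. k (g \<star> (b, a, \<theta>)) \<partial>lborel) * ?w a \<partial>lborel)"
    proof (rule nn_integral_cong)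
      fix \<theta> :: real
      have "(\<integral>\<^sup>+b. k (b, 0 + a0 * a, \<theta>0 + \<theta>) \<partial>lborel)
          = ennreal (a0\<^sup>2) * (\<integral>\<^sup>+b. k (b0 + a0 *\<^sub>R boost \<theta>0 b, 0 + a0 * a, \<theta>0 + \<theta>) \<partial>lborel)"
        by (rule nn_integral_dilation_boost) (use a0 in auto)
      then have "(\<integral>\<^sup>+b. k (b, 0 + a0 * a, \<theta>0 + \<theta>) \<partial>lborel) = ennreal (a0\<^sup>2) * (\<integral>\<^sup>+b. k (g \<star> (b, a, \<theta>)) \<partial>lborel)"
        by (simp add: g' pmult_def)
      then have "?K (\<theta>0 + \<theta>) = (\<integral>\<^sup>+b. k (g \<star> (b, a, \<theta>)) \<partial>lborel) * (ennreal a0 * (ennreal (a0\<^sup>2) * ?w (0 + a0 * a)))"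
        by (simp only: ac_simps)
      then show "?K (\<theta>0 + \<theta>) = (\<integral>\<^sup>+b. k (g \<star> (b, a, \<theta>)) \<partial>lborel) * ?w a"
        unfolding w .
    qed
    finally show "(\<integral>\<^sup>+\<theta>. ?K \<theta> \<partial>lborel) = (\<integral>\<^sup>+\<theta>. (\<integral>\<^sup>+b. k (g \<star> (b, a, \<theta>)) \<partial>lborel) * ?w a \<partial>lborel)" .
  qed
  also have "\<dots> = (\<integral>\<^sup>+\<xi>. k (g \<star> \<xi>) \<partial>haar)"
    by (rule nn_integral_haar[symmetric]) measurable
  also have "\<dots> = (\<integral>\<^sup>+\<xi>. h (g \<star> \<xi>) \<partial>haar)"
    by (rule nn_integral_cong) (simp add: k_def pmult_closed[OF g])
  finally show ?thesis by simp
qed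

text \<open>The second argument of the Wigner integrand depends on \<open>w\<close> only through \<open>u = \<xi>\<^sup>1\<^sup>/\<^sup>2 w\<close>.\<close>

lemma pinv_mult_sqrt:
  assumes "\<xi> \<in> poincare_group" "w \<in> poincare_group"
  shows "pinv w \<star> psqrt \<xi> = pinv (psqrt \<xi> \<star> w) \<star> \<xi>"
proof -
  let ?s = "psqrt \<xi>"
  have s: "?s \<in> poincare_group" by (rule psqrt_closed) fact
  have "\<xi> = (?s \<star> w) \<star> (pinv w \<star> ?s)"
    using pmult_pinv(1)[OF assms(2)] psqrt_square[OF assms(1)]
    by (metis pmult_assoc pmult_pone(1))
  then have "pinv (?s \<star> w) \<star> \<xi> = (pinv (?s \<star> w) \<star> (?s \<star> w)) \<star> (pinv w \<star> ?s)"
    by (metis pmult_assoc)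
  then show ?thesis
    using pmult_pinv(2)[OF pmult_closed[OF s assms(2)]] by (simp add: pmult_pone)
qed

lemma measurable_fst_haar: "fst \<in> borel_measurable (haar \<Otimes>\<^sub>M haar)"
  using measurable_compose[OF measurable_fst[of haar haar] ident_haar_borel] .

lemma measurable_snd_haar: "snd \<in> borel_measurable (haar \<Otimes>\<^sub>M haar)"
  using measurable_compose[OF measurable_snd[of haar haar] ident_haar_borel] .

lemma measurable_sqrt_translates:
  "(\<lambda>(w, \<xi>). psqrt \<xi> \<star> w) \<in> measurable (haar \<Otimes>\<^sub>M haar) haar"
  "(\<lambda>(w, \<xi>). pinv w \<star> psqrt \<xi>) \<in> measurable (haar \<Otimes>\<^sub>M haar) haar"
proof -
  note m = measurable_fst_haar measurable_snd_haar
  show "(\<lambda>(w, \<xi>). psqrt \<xi> \<star> w) \<in> measurable (haar \<Otimes>\<^sub>M haar) haar"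
    "(\<lambda>(w, \<xi>). pinv w \<star> psqrt \<xi>) \<in> measurable (haar \<Otimes>\<^sub>M haar) haar"
    unfolding measurable_haar_iff case_prod_beta
    using borel_measurable_pmult[OF borel_measurable_psqrt[OF m(2)] m(1)]
      borel_measurable_pmult[OF borel_measurable_pinv[OF m(1)] borel_measurable_psqrt[OF m(2)]]
    by (auto simp: space_pair_measure intro!: pmult_closed psqrt_closed pinv_closed)
qed

text \<open>The substitution \<open>u = \<xi>\<^sup>1\<^sup>/\<^sup>2 w\<close>, \<open>v = w\<inverse> \<xi>\<^sup>1\<^sup>/\<^sup>2 = u\<inverse> \<xi>\<close> preserves the product Haar measure.  Done in two steps,
  first in \<open>w\<close> for fixed \<open>\<xi>\<close> and then in \<open>\<xi>\<close> for fixed \<open>u\<close>, it only involves left translations; the Jacobian of the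
  square root never enters.\<close>

lemma nn_integral_sqrt_substitution:
  assumes f [measurable]: "f \<in> borel_measurable haar" and g [measurable]: "g \<in> borel_measurable haar"
  shows "(\<integral>\<^sup>+w. \<integral>\<^sup>+\<xi>. f (psqrt \<xi> \<star> w) * g (pinv w \<star> psqrt \<xi>) \<partial>haar \<partial>haar)
    = (\<integral>\<^sup>+u. f u \<partial>haar) * (\<integral>\<^sup>+v. g v \<partial>haar)"
proof -
  interpret H: sigma_finite_measure haar by (rule sigma_finite_haar)
  interpret HH: pair_sigma_finite haar haar ..
  note [measurable] = measurable_sqrt_translates
  have [measurable]: "(\<lambda>(u, \<xi>). pinv u \<star> \<xi>) \<in> measurable (haar \<Otimes>\<^sub>M haar) haar"
  proof -
    show ?thesis unfolding measurable_haar_iff case_prod_beta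
      using borel_measurable_pmult[OF borel_measurable_pinv[OF measurable_fst_haar] measurable_snd_haar]
      by (auto simp: space_pair_measure intro!: pmult_closed pinv_closed)
  qed
  have m1: "(\<lambda>(w, \<xi>). f (psqrt \<xi> \<star> w) * g (pinv w \<star> psqrt \<xi>)) \<in> borel_measurable (haar \<Otimes>\<^sub>M haar)"
    using measurable_compose[OF measurable_sqrt_translates(1) f] measurable_compose[OF measurable_sqrt_translates(2) g]
    by (simp add: case_prod_beta)
  have m2: "(\<lambda>(u, \<xi>). f u * g (pinv u \<star> \<xi>)) \<in> borel_measurable (haar \<Otimes>\<^sub>M haar)"
    using measurable_compose[OF \<open>(\<lambda>(u, \<xi>). pinv u \<star> \<xi>) \<in> _\<close> g] by (simp add: case_prod_beta)
  have "(\<integral>\<^sup>+w. \<integral>\<^sup>+\<xi>. f (psqrt \<xi> \<star> w) * g (pinv w \<star> psqrt \<xi>) \<partial>haar \<partial>haar)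
      = (\<integral>\<^sup>+\<xi>. \<integral>\<^sup>+w. f (psqrt \<xi> \<star> w) * g (pinv w \<star> psqrt \<xi>) \<partial>haar \<partial>haar)"
    using HH.Fubini'[OF m1] by simp
  also have "\<dots> = (\<integral>\<^sup>+\<xi>. \<integral>\<^sup>+u. f u * g (pinv u \<star> \<xi>) \<partial>haar \<partial>haar)"
  proof (rule nn_integral_cong)
    fix \<xi> assume "\<xi> \<in> space haar"
    then have \<xi>: "\<xi> \<in> poincare_group" by simp
    have "(\<integral>\<^sup>+w. f (psqrt \<xi> \<star> w) * g (pinv w \<star> psqrt \<xi>) \<partial>haar)
        = (\<integral>\<^sup>+w. f (psqrt \<xi> \<star> w) * g (pinv (psqrt \<xi> \<star> w) \<star> \<xi>) \<partial>haar)"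
      by (rule nn_integral_cong) (simp add: pinv_mult_sqrt \<xi>)
    also have "\<dots> = (\<integral>\<^sup>+u. f u * g (pinv u \<star> \<xi>) \<partial>haar)"
      by (rule nn_integral_haar_left_invariant[where h = "\<lambda>u. f u * g (pinv u \<star> \<xi>)"])
        (use measurable_compose[OF measurable_Pair1' m2, of \<xi>] \<xi> psqrt_closed in \<open>auto simp: case_prod_beta\<close>)
    finally show "(\<integral>\<^sup>+w. f (psqrt \<xi> \<star> w) * g (pinv w \<star> psqrt \<xi>) \<partial>haar) = (\<integral>\<^sup>+u. f u * g (pinv u \<star> \<xi>) \<partial>haar)" .
  qed
  also have "\<dots> = (\<integral>\<^sup>+u. \<integral>\<^sup>+\<xi>. f u * g (pinv u \<star> \<xi>) \<partial>haar \<partial>haar)"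
    using HH.Fubini'[OF m2] by simp
  also have "\<dots> = (\<integral>\<^sup>+u. f u * (\<integral>\<^sup>+\<xi>. g \<xi> \<partial>haar) \<partial>haar)"
  proof (rule nn_integral_cong)
    fix u assume "u \<in> space haar"
    then have u: "pinv u \<in> poincare_group" by (simp add: pinv_closed)
    have [measurable]: "(\<lambda>\<xi>. pinv u \<star> \<xi>) \<in> measurable haar haar"
      unfolding measurable_haar_iff using ident_haar_borel u by (auto intro: pmult_closed)
    have "(\<integral>\<^sup>+\<xi>. f u * g (pinv u \<star> \<xi>) \<partial>haar) = f u * (\<integral>\<^sup>+\<xi>. g (pinv u \<star> \<xi>) \<partial>haar)"
      by (rule nn_integral_cmult) measurable
    also have "(\<integral>\<^sup>+\<xi>. g (pinv u \<star> \<xi>) \<partial>haar) = (\<integral>\<^sup>+\<xi>. g \<xi> \<partial>haar)"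
      by (rule nn_integral_haar_left_invariant[OF g u])
    finally show "(\<integral>\<^sup>+\<xi>. f u * g (pinv u \<star> \<xi>) \<partial>haar) = f u * (\<integral>\<^sup>+\<xi>. g \<xi> \<partial>haar)" .
  qed
  also have "\<dots> = (\<integral>\<^sup>+u. f u \<partial>haar) * (\<integral>\<^sup>+v. g v \<partial>haar)"
    by (rule nn_integral_multc) measurable
  finally show ?thesis .
qed

section \<open>The Plancherel inequality in the plane\<close>

lemma norm_integral_le_nn_integral:
  fixes f :: "'a \<Rightarrow> complex"
  shows "ennreal (cmod (\<integral>x. f x \<partial>M)) \<le> (\<integral>\<^sup>+x. ennreal (cmod (f x)) \<partial>M)"
  by (cases "integrable M f") (auto intro: integral_norm_bound_ennreal simp: not_integrable_integral_eq)

definition character :: "plane \<Rightarrow> plane \<Rightarrow> complex" where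
  "character x b = exp (\<i> * of_real (minkowski x b))"

lemma norm_character [simp]: "cmod (character x b) = 1"
  by (simp add: character_def)

lemma borel_measurable_character [measurable (raw)]:
  assumes [measurable]: "f \<in> borel_measurable M" "g \<in> borel_measurable M"
  shows "(\<lambda>x. character (f x) (g x)) \<in> borel_measurable M"
  unfolding character_def minkowski_def by measurable

lemma cnj_character: "cnj (character x b) = character x (- b)"
  by (simp add: character_def minkowski_def exp_cnj algebra_simps)

lemma character_add: "character x (b + c) = character x b * character x c"
  by (simp add: character_def minkowski_def exp_add[symmetric] algebra_simps)

definition plane_fourier :: "(plane \<Rightarrow> complex) \<Rightarrow> plane \<Rightarrow> complex" where
  "plane_fourier F x = (\<integral>b. F b * character x b \<partial>lborel)"

text \<open>The Plancherel integral is regularised by a Gaussian of width \<open>n\<close>.  The Fourier transform of this weight is a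
  positive kernel of total mass \<open>2\<pi>\<close> for every \<open>n\<close>, which makes the regularised estimates uniform.\<close>

definition gauss_weight :: "real \<Rightarrow> plane \<Rightarrow> real" where
  "gauss_weight n x = std_normal_density (fst x / n) * std_normal_density (snd x / n)"

definition gauss_kernel :: "real \<Rightarrow> plane \<Rightarrow> real" where
  "gauss_kernel n b = 2 * pi * (n * std_normal_density (n * fst b)) * (n * std_normal_density (n * snd b))"

lemma borel_measurable_std_normal [measurable]: "std_normal_density \<in> borel_measurable borel"
  by (rule borel_measurable_normal_density)

lemma borel_measurable_gauss_weight [measurable]: "gauss_weight n \<in> borel_measurable borel"
  unfolding gauss_weight_def by measurable

lemma borel_measurable_gauss_kernel [measurable]: "gauss_kernel n \<in> borel_measurable borel"
  unfolding gauss_kernel_def by measurable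

lemma gauss_weight_nonneg: "0 \<le> gauss_weight n x"
  by (simp add: gauss_weight_def)

lemma gauss_kernel_nonneg: "0 < n \<Longrightarrow> 0 \<le> gauss_kernel n x"
  by (simp add: gauss_kernel_def)

lemma gauss_kernel_even: "gauss_kernel n (- x) = gauss_kernel n x"
  by (simp add: gauss_kernel_def normal_density_def)

lemma integrable_std_normal: "integrable lborel std_normal_density"
  by (rule integrable_normal_density) simp

lemma integrable_gauss_weight:
  assumes "n > 0" shows "integrable lborel (gauss_weight n)"
proof -
  have 1: "integrable lborel (\<lambda>t. std_normal_density (t / n))"
    using lborel_integrable_real_affine[OF integrable_std_normal, of "1 / n" 0] assms by simp
  have "integrable (lborel \<Otimes>\<^sub>M lborel) (\<lambda>(s, t). std_normal_density (s / n) * std_normal_density (t / n))"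
  proof (rule lborel_pair.Fubini_integrable)
    show "integrable lborel (\<lambda>s. \<integral>t. norm ((\<lambda>(s, t). std_normal_density (s / n) * std_normal_density (t / n)) (s, t)) \<partial>lborel)"
      using 1 by simp
    show "AE s in lborel. integrable lborel (\<lambda>t. (\<lambda>(s, t). std_normal_density (s / n) * std_normal_density (t / n)) (s, t))"
      using 1 by simp
  qed measurable
  then show ?thesis unfolding lborel_prod gauss_weight_def by (simp add: case_prod_beta')
qed

lemma std_normal_fourier:
  assumes n: "n > 0"
  shows "(\<integral>t. of_real (std_normal_density (t / n)) * exp (\<i> * of_real (s * t)) \<partial>lborel)
    = complex_of_real (sqrt (2 * pi) * (n * std_normal_density (n * s)))"
proof -
  have "(\<integral>t. of_real (std_normal_density (t / n)) * exp (\<i> * of_real (s * t)) \<partial>lborel)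
    = \<bar>n\<bar> *\<^sub>R (\<integral>t. of_real (std_normal_density ((0 + n * t) / n)) * exp (\<i> * of_real (s * (0 + n * t))) \<partial>lborel)"
    by (rule lborel_integral_real_affine) (use n in simp)
  also have "(\<integral>t. of_real (std_normal_density ((0 + n * t) / n)) * exp (\<i> * of_real (s * (0 + n * t))) \<partial>lborel)
      = char std_normal_distribution (n * s)"
    unfolding char_def
    by (subst integral_density) (use n in \<open>auto simp: scaleR_conv_of_real ac_simps\<close>)
  also have "\<dots> = of_real (exp (- (n * s)\<^sup>2 / 2))" by (simp add: char_std_normal_distribution)
  also have "\<bar>n\<bar> *\<^sub>R \<dots> = complex_of_real (sqrt (2 * pi) * (n * std_normal_density (n * s)))"
    using n by (simp add: std_normal_density_def scaleR_conv_of_real)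
  finally show ?thesis .
qed

lemma gauss_weight_fourier:
  assumes n: "n > 0"
  shows "(\<integral>x. of_real (gauss_weight n x) * character x b \<partial>lborel) = of_real (gauss_kernel n b)"
proof -
  have i: "integrable lborel (\<lambda>x. complex_of_real (gauss_weight n x) * character x b)"
    by (rule Bochner_Integration.integrable_bound[OF integrable_gauss_weight[OF n]]) (auto simp: norm_mult)
  let ?f = "\<lambda>s. complex_of_real (std_normal_density (s / n)) * exp (\<i> * of_real (fst b * s))"
  let ?g = "\<lambda>t. complex_of_real (std_normal_density (t / n)) * exp (\<i> * of_real ((- snd b) * t))"
  have "(\<integral>x. of_real (gauss_weight n x) * character x b \<partial>lborel)
      = (\<integral>s. \<integral>t. of_real (gauss_weight n (s, t)) * character (s, t) b \<partial>lborel \<partial>lborel)"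
    using lborel_pair.integral_fst'[of "\<lambda>x. complex_of_real (gauss_weight n x) * character x b"] i
    by (simp add: lborel_prod)
  also have "\<dots> = (\<integral>s. \<integral>t. ?f s * ?g t \<partial>lborel \<partial>lborel)"
    by (simp add: gauss_weight_def character_def minkowski_def exp_diff exp_minus field_simps)
  also have "\<dots> = (\<integral>s. ?f s \<partial>lborel) * (\<integral>t. ?g t \<partial>lborel)"
    by (simp only: integral_mult_right_zero integral_mult_left_zero)
  also have "\<dots> = complex_of_real ((sqrt (2 * pi) * (n * std_normal_density (n * fst b)))
      * (sqrt (2 * pi) * (n * std_normal_density (n * (- snd b)))))"
    unfolding std_normal_fourier[OF n] by (simp only: of_real_mult)
  also have "(sqrt (2 * pi) * (n * std_normal_density (n * fst b)))
      * (sqrt (2 * pi) * (n * std_normal_density (n * (- snd b)))) = gauss_kernel n b"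
  proof -
    have s: "sqrt (2 * pi) * sqrt (2 * pi) = 2 * pi" by simp
    have e: "std_normal_density (n * (- snd b)) = std_normal_density (n * snd b)"
      by (simp add: normal_density_def)
    have "(sqrt (2 * pi) * (n * std_normal_density (n * fst b))) * (sqrt (2 * pi) * (n * std_normal_density (n * snd b)))
      = (sqrt (2 * pi) * sqrt (2 * pi)) * (n * std_normal_density (n * fst b)) * (n * std_normal_density (n * snd b))"
      by (simp only: ac_simps)
    then show ?thesis unfolding e s gauss_kernel_def .
  qed
  finally show ?thesis .
qed

lemma nn_integral_gauss_kernel:
  assumes n: "n > 0"
  shows "(\<integral>\<^sup>+b. ennreal (gauss_kernel n (c - b)) \<partial>lborel) = ennreal (2 * pi)"
proof -
  have 1: "(\<integral>\<^sup>+t. ennreal (n * std_normal_density (n * t)) \<partial>lborel) = 1"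
  proof -
    have "(\<integral>\<^sup>+t. ennreal (n * std_normal_density (n * t)) \<partial>lborel)
        = ennreal \<bar>n\<bar> * (\<integral>\<^sup>+t. ennreal (std_normal_density (0 + n * t)) \<partial>lborel)"
      using n by (simp add: ennreal_mult nn_integral_cmult)
    also have "\<dots> = (\<integral>\<^sup>+t. ennreal (std_normal_density t) \<partial>lborel)"
      by (rule nn_integral_real_affine[symmetric]) (use n in auto)
    also have "\<dots> = ennreal (\<integral>t. std_normal_density t \<partial>lborel)"
      by (rule nn_integral_eq_integral) (auto intro: integrable_std_normal)
    also have "\<dots> = 1" by simp
    finally show ?thesis .
  qed
  have "(\<integral>\<^sup>+b. ennreal (gauss_kernel n (c - b)) \<partial>lborel) = (\<integral>\<^sup>+b. ennreal (gauss_kernel n (- c + b)) \<partial>lborel)"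
    using gauss_kernel_even[of n "c - _"] by simp
  also have "\<dots> = (\<integral>\<^sup>+b. ennreal (gauss_kernel n b) \<partial>lborel)"
    using nn_integral_dilation_boost[of "\<lambda>b. ennreal (gauss_kernel n b)" 1 "- c" 0] by (simp add: boost_0)
  also have "\<dots> = (\<integral>\<^sup>+s. \<integral>\<^sup>+t. ennreal (2 * pi * (n * std_normal_density (n * s))) * ennreal (n * std_normal_density (n * t)) \<partial>lborel \<partial>lborel)"
    using n
    by (subst lborel_prod[symmetric], subst lborel.nn_integral_fst[symmetric])
      (auto simp: gauss_kernel_def ennreal_mult lborel_prod mult.assoc)
  also have "\<dots> = (\<integral>\<^sup>+s. ennreal (2 * pi * (n * std_normal_density (n * s))) \<partial>lborel)"
    by (simp add: nn_integral_cmult 1)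
  also have "\<dots> = ennreal (2 * pi) * (\<integral>\<^sup>+s. ennreal (n * std_normal_density (n * s)) \<partial>lborel)"
    using n by (subst nn_integral_cmult[symmetric]) (auto simp: ennreal_mult[symmetric])
  finally show ?thesis by (simp add: 1)
qed

lemma integral_swap_bounded_kernel:
  fixes p q :: "plane \<Rightarrow> complex"
  assumes p: "integrable lborel p" and q: "integrable lborel q"
    and k [measurable]: "case_prod k \<in> borel_measurable (borel \<Otimes>\<^sub>M borel)" and b: "\<And>x y. cmod (k x y) \<le> 1"
  shows "(\<integral>x. p x * (\<integral>y. q y * k x y \<partial>lborel) \<partial>lborel) = (\<integral>y. q y * (\<integral>x. p x * k x y \<partial>lborel) \<partial>lborel)"
proof -
  have [measurable]: "p \<in> borel_measurable borel" "q \<in> borel_measurable borel"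
    using borel_measurable_integrable[OF p] borel_measurable_integrable[OF q] by simp_all
  have "integrable (lborel \<Otimes>\<^sub>M lborel) (\<lambda>(x, y). p x * q y)"
  proof (rule lborel_pair.Fubini_integrable)
    show "integrable lborel (\<lambda>x. \<integral>y. norm ((\<lambda>(x, y). p x * q y) (x, y)) \<partial>lborel)"
      using p by (simp add: norm_mult)
    show "AE x in lborel. integrable lborel (\<lambda>y. (\<lambda>(x, y). p x * q y) (x, y))"
      using q by simp
  qed measurable
  then have i: "integrable (lborel \<Otimes>\<^sub>M lborel) (\<lambda>(x, y). p x * q y * k x y)"
  proof (rule Bochner_Integration.integrable_bound)
    have "norm (case z of (x, y) \<Rightarrow> p x * q y * k x y) \<le> norm (case z of (x, y) \<Rightarrow> p x * q y)" for z
      using b by (auto simp: norm_mult intro!: mult_left_le split: prod.split)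
    then show "AE z in lborel \<Otimes>\<^sub>M lborel. norm (case z of (x, y) \<Rightarrow> p x * q y * k x y) \<le> norm (case z of (x, y) \<Rightarrow> p x * q y)"
      by (intro AE_I2)
  qed (use k in \<open>simp add: split_beta'\<close>)
  have "(\<integral>x. p x * (\<integral>y. q y * k x y \<partial>lborel) \<partial>lborel) = (\<integral>x. \<integral>y. p x * q y * k x y \<partial>lborel \<partial>lborel)"
    by (simp only: mult.assoc integral_mult_right_zero)
  also have "\<dots> = (\<integral>y. \<integral>x. p x * q y * k x y \<partial>lborel \<partial>lborel)"
    using lborel_pair.Fubini_integral[OF i] by simp
  also have "\<dots> = (\<integral>y. q y * (\<integral>x. p x * k x y \<partial>lborel) \<partial>lborel)"
    by (simp only: integral_mult_right_zero[symmetric]) (simp only: ac_simps)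
  finally show ?thesis .
qed

lemma borel_measurable_plane_fourier [measurable]:
  assumes [measurable]: "F \<in> borel_measurable borel"
  shows "plane_fourier F \<in> borel_measurable borel"
proof -
  have "(\<lambda>x. \<integral>b. F b * character x b \<partial>lborel) \<in> borel_measurable lborel"
    by (rule lborel.borel_measurable_lebesgue_integral) measurable
  then show ?thesis by (simp add: plane_fourier_def[abs_def])
qed

text \<open>Exchanging the integrals turns the left-hand side into the quadratic form of \<open>F\<close> with the translation-invariant
  kernel \<open>gauss_kernel\<close>, and \<open>|F(b) F(c)| \<le> (|F(b)|\<^sup>2 + |F(c)|\<^sup>2) / 2\<close> bounds this form by the mass of the kernel.\<close>

lemma gauss_weighted_Plancherel:
  assumes n: "n > 0" and F: "integrable lborel F"
  shows "(\<integral>\<^sup>+x. ennreal (gauss_weight n x * (cmod (plane_fourier F x))\<^sup>2) \<partial>lborel)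
    \<le> ennreal (2 * pi) * (\<integral>\<^sup>+b. ennreal ((cmod (F b))\<^sup>2) \<partial>lborel)"
proof -
  have [measurable]: "F \<in> borel_measurable borel" using borel_measurable_integrable[OF F] by simp
  define B where "B = (\<integral>b. cmod (F b) \<partial>lborel)"
  have bound: "cmod (plane_fourier F x) \<le> B" for x
    unfolding plane_fourier_def B_def
    using integral_norm_bound[of lborel "\<lambda>b. F b * character x b"] by (simp add: norm_mult)
  have B0: "0 \<le> B" unfolding B_def by simp
  let ?w = "\<lambda>x. complex_of_real (gauss_weight n x)"
  have wi: "integrable lborel (\<lambda>x. gauss_weight n x * C)" for C
    using integrable_gauss_weight[OF n] by simp
  have i1: "integrable lborel (\<lambda>x. ?w x * cnj (plane_fourier F x))"
    by (rule Bochner_Integration.integrable_bound[OF wi[of B]])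
      (auto simp: norm_mult B0 gauss_weight_nonneg intro!: mult_left_mono bound)
  have i2: "integrable lborel (\<lambda>x. gauss_weight n x * (cmod (plane_fourier F x))\<^sup>2)"
    by (rule Bochner_Integration.integrable_bound[OF wi[of "B\<^sup>2"]])
      (auto simp: norm_mult B0 gauss_weight_nonneg intro!: mult_left_mono bound power_mono)
  have i3: "integrable lborel (\<lambda>x. ?w x * character x b)" for b
    by (rule Bochner_Integration.integrable_bound[OF integrable_gauss_weight[OF n]]) (auto simp: norm_mult)
  have Fc: "integrable lborel (\<lambda>b. cnj (F b))" using F by simp
  have cf: "cnj (plane_fourier F x) = (\<integral>b. cnj (F b) * character x (- b) \<partial>lborel)" for x
    unfolding plane_fourier_def by (simp add: cnj_character flip: Bochner_Integration.integral_cnj)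
  have inner: "(\<integral>x. ?w x * cnj (plane_fourier F x) * character x b \<partial>lborel)
        = (\<integral>c. cnj (F c) * of_real (gauss_kernel n (b - c)) \<partial>lborel)" for b
  proof -
    have "(\<integral>x. ?w x * cnj (plane_fourier F x) * character x b \<partial>lborel)
        = (\<integral>x. (?w x * character x b) * (\<integral>c. cnj (F c) * character x (- c) \<partial>lborel) \<partial>lborel)"
      by (simp add: cf ac_simps)
    also have "\<dots> = (\<integral>c. cnj (F c) * (\<integral>x. (?w x * character x b) * character x (- c) \<partial>lborel) \<partial>lborel)"
      by (rule integral_swap_bounded_kernel[OF i3 Fc]) auto
    also have "\<dots> = (\<integral>c. cnj (F c) * (\<integral>x. ?w x * character x (b - c) \<partial>lborel) \<partial>lborel)"
      by (simp add: mult.assoc flip: character_add)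
    finally show "(\<integral>x. ?w x * cnj (plane_fourier F x) * character x b \<partial>lborel)
        = (\<integral>c. cnj (F c) * of_real (gauss_kernel n (b - c)) \<partial>lborel)"
      by (simp only: gauss_weight_fourier[OF n])
  qed
  have "complex_of_real (\<integral>x. gauss_weight n x * (cmod (plane_fourier F x))\<^sup>2 \<partial>lborel)
      = (\<integral>x. ?w x * cnj (plane_fourier F x) * plane_fourier F x \<partial>lborel)"
    unfolding integral_complex_of_real[symmetric]
    by (rule Bochner_Integration.integral_cong) (auto simp: complex_norm_square mult.commute mult.assoc simp del: of_real_power)
  also have "\<dots> = (\<integral>b. F b * (\<integral>x. ?w x * cnj (plane_fourier F x) * character x b \<partial>lborel) \<partial>lborel)"
    unfolding plane_fourier_def[of F "_"] using integral_swap_bounded_kernel[OF i1 F, of character]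
    unfolding plane_fourier_def[of F "_"] by simp
  also have "\<dots> = (\<integral>b. F b * (\<integral>c. cnj (F c) * of_real (gauss_kernel n (b - c)) \<partial>lborel) \<partial>lborel)"
    by (simp only: inner)
  finally have eq: "complex_of_real (\<integral>x. gauss_weight n x * (cmod (plane_fourier F x))\<^sup>2 \<partial>lborel)
    = (\<integral>b. F b * (\<integral>c. cnj (F c) * of_real (gauss_kernel n (b - c)) \<partial>lborel) \<partial>lborel)" .
  let ?N = "\<lambda>b. ennreal ((cmod (F b))\<^sup>2)" and ?g = "\<lambda>b c. ennreal (gauss_kernel n (b - c))"
  have g0: "0 \<le> gauss_kernel n x" for x by (rule gauss_kernel_nonneg[OF n])
  have "(\<integral>\<^sup>+x. ennreal (gauss_weight n x * (cmod (plane_fourier F x))\<^sup>2) \<partial>lborel)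
      = ennreal (\<integral>x. gauss_weight n x * (cmod (plane_fourier F x))\<^sup>2 \<partial>lborel)"
    by (rule nn_integral_eq_integral[OF i2]) (simp add: gauss_weight_nonneg)
  also have "\<dots> \<le> ennreal (cmod (\<integral>b. F b * (\<integral>c. cnj (F c) * of_real (gauss_kernel n (b - c)) \<partial>lborel) \<partial>lborel))"
    unfolding eq[symmetric] by (rule ennreal_leI) simp
  also have "\<dots> \<le> (\<integral>\<^sup>+b. ennreal (cmod (F b * (\<integral>c. cnj (F c) * of_real (gauss_kernel n (b - c)) \<partial>lborel))) \<partial>lborel)"
    by (rule norm_integral_le_nn_integral)
  also have "\<dots> \<le> (\<integral>\<^sup>+b. \<integral>\<^sup>+c. (ennreal (1/2) * ?N b) * ?g b c + (ennreal (1/2) * ?N c) * ?g b c \<partial>lborel \<partial>lborel)"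
  proof (rule nn_integral_mono)
    fix b
    have "ennreal (cmod (F b * (\<integral>c. cnj (F c) * of_real (gauss_kernel n (b - c)) \<partial>lborel)))
        = ennreal (cmod (\<integral>c. F b * (cnj (F c) * of_real (gauss_kernel n (b - c))) \<partial>lborel))"
      by (simp only: integral_mult_right_zero)
    also have "\<dots> \<le> (\<integral>\<^sup>+c. ennreal (cmod (F b * (cnj (F c) * of_real (gauss_kernel n (b - c))))) \<partial>lborel)"
      by (rule norm_integral_le_nn_integral)
    also have "\<dots> \<le> (\<integral>\<^sup>+c. (ennreal (1/2) * ?N b) * ?g b c + (ennreal (1/2) * ?N c) * ?g b c \<partial>lborel)"
    proof (rule nn_integral_mono)
      fix c
      have "cmod (F b) * cmod (F c) \<le> 1/2 * (cmod (F b))\<^sup>2 + 1/2 * (cmod (F c))\<^sup>2"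
        using sum_squares_bound[of "cmod (F b)" "cmod (F c)"] by simp
      from mult_right_mono[OF this g0[of "b - c"]]
      have "cmod (F b * (cnj (F c) * of_real (gauss_kernel n (b - c))))
          \<le> 1/2 * (cmod (F b))\<^sup>2 * gauss_kernel n (b - c) + 1/2 * (cmod (F c))\<^sup>2 * gauss_kernel n (b - c)"
        using g0[of "b - c"] by (simp add: norm_mult algebra_simps)
      from ennreal_leI[OF this]
      show "ennreal (cmod (F b * (cnj (F c) * of_real (gauss_kernel n (b - c)))))
          \<le> (ennreal (1/2) * ?N b) * ?g b c + (ennreal (1/2) * ?N c) * ?g b c"
        using g0[of "b - c"] by (simp only: ennreal_plus ennreal_mult mult_nonneg_nonneg zero_le_power2 zero_le_divide_1_iff zero_le_numeral)
    qed
    finally show "ennreal (cmod (F b * (\<integral>c. cnj (F c) * of_real (gauss_kernel n (b - c)) \<partial>lborel)))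
      \<le> (\<integral>\<^sup>+c. (ennreal (1/2) * ?N b) * ?g b c + (ennreal (1/2) * ?N c) * ?g b c \<partial>lborel)" .
  qed
  also have "\<dots> = (\<integral>\<^sup>+b. \<integral>\<^sup>+c. (ennreal (1/2) * ?N b) * ?g b c \<partial>lborel \<partial>lborel)
      + (\<integral>\<^sup>+b. \<integral>\<^sup>+c. (ennreal (1/2) * ?N c) * ?g b c \<partial>lborel \<partial>lborel)"
    by (subst nn_integral_add[symmetric]) (auto intro!: nn_integral_cong nn_integral_add)
  also have "(\<integral>\<^sup>+b. \<integral>\<^sup>+c. (ennreal (1/2) * ?N c) * ?g b c \<partial>lborel \<partial>lborel)
      = (\<integral>\<^sup>+c. \<integral>\<^sup>+b. (ennreal (1/2) * ?N c) * ?g b c \<partial>lborel \<partial>lborel)"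
    by (rule lborel_pair.Fubini') measurable
  also have "\<dots> = (\<integral>\<^sup>+b. \<integral>\<^sup>+c. (ennreal (1/2) * ?N b) * ?g b c \<partial>lborel \<partial>lborel)"
    using gauss_kernel_even[of n "_ - _"] by simp
  also have "(\<integral>\<^sup>+b. \<integral>\<^sup>+c. (ennreal (1/2) * ?N b) * ?g b c \<partial>lborel \<partial>lborel)
      = (\<integral>\<^sup>+b. ennreal (2 * pi) * (ennreal (1/2) * ?N b) \<partial>lborel)"
    by (intro nn_integral_cong) (subst nn_integral_cmult, measurable, simp only: nn_integral_gauss_kernel[OF n] mult.commute)
  also have "\<dots> = ennreal (2 * pi) * (ennreal (1/2) * (\<integral>\<^sup>+b. ?N b \<partial>lborel))"
    by (subst nn_integral_cmult, measurable) (subst nn_integral_cmult, measurable)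
  also have "\<dots> + \<dots> = ennreal (2 * pi) * ((ennreal (1/2) + ennreal (1/2)) * (\<integral>\<^sup>+b. ?N b \<partial>lborel))"
    by (simp only: distrib_left distrib_right)
  also have "ennreal (1/2) + ennreal (1/2) = 1" by (subst ennreal_plus[symmetric]) auto
  finally show ?thesis by simp
qed

text \<open>The Gaussian weights converge to \<open>1 / 2\<pi>\<close>, so Fatou's lemma removes the regularisation.  If \<open>F\<close> is not integrable, then
  neither is \<open>F\<close> times a character, and the transform is the default value \<open>0\<close> of the integral.\<close>

theorem plane_Plancherel:
  assumes [measurable]: "F \<in> borel_measurable borel"
  shows "(\<integral>\<^sup>+x. ennreal ((cmod (plane_fourier F x))\<^sup>2) \<partial>lborel)
    \<le> ennreal (4 * pi\<^sup>2) * (\<integral>\<^sup>+b. ennreal ((cmod (F b))\<^sup>2) \<partial>lborel)"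
proof (cases "integrable lborel F")
  case False
  have "\<not> integrable lborel (\<lambda>b. F b * character x b)" for x
  proof
    assume "integrable lborel (\<lambda>b. F b * character x b)"
    then have "integrable lborel F" by (rule Bochner_Integration.integrable_bound) (auto simp: norm_mult)
    then show False using False by simp
  qed
  then have "plane_fourier F x = 0" for x by (simp add: plane_fourier_def not_integrable_integral_eq)
  then show ?thesis by simp
next
  case True
  let ?u = "\<lambda>n x. 2 * pi * (gauss_weight (real (Suc n)) x * (cmod (plane_fourier F x))\<^sup>2)"
  have lim: "(\<lambda>n. ennreal (?u n x)) \<longlonglongrightarrow> ennreal ((cmod (plane_fourier F x))\<^sup>2)" for x
  proof -
    have c: "isCont std_normal_density 0" unfolding normal_density_def by (intro continuous_intros) auto
    have z: "(\<lambda>n. t / real (Suc n)) \<longlonglongrightarrow> 0" for t :: real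
      using tendsto_mult_right[OF LIMSEQ_inverse_real_of_nat, of t] by (simp add: field_simps)
    have s: "(\<lambda>n. std_normal_density (t / real (Suc n))) \<longlonglongrightarrow> std_normal_density 0" for t
      by (rule isCont_tendsto_compose[OF c z])
    have "(\<lambda>n. ?u n x) \<longlonglongrightarrow> 2 * pi * ((std_normal_density 0 * std_normal_density 0) * (cmod (plane_fourier F x))\<^sup>2)"
      unfolding gauss_weight_def by (intro tendsto_intros s)
    also have "2 * pi * ((std_normal_density 0 * std_normal_density 0) * (cmod (plane_fourier F x))\<^sup>2) = (cmod (plane_fourier F x))\<^sup>2"
    proof -
      have "std_normal_density 0 * std_normal_density 0 = 1 / (2 * pi)" by (simp add: normal_density_def)
      then show ?thesis by simp
    qed
    finally show ?thesis by (rule tendsto_ennrealI)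
  qed
  have "(\<integral>\<^sup>+x. ennreal ((cmod (plane_fourier F x))\<^sup>2) \<partial>lborel) = (\<integral>\<^sup>+x. liminf (\<lambda>n. ennreal (?u n x)) \<partial>lborel)"
    using lim_imp_Liminf[OF _ lim] by simp
  also have "\<dots> \<le> liminf (\<lambda>n. \<integral>\<^sup>+x. ennreal (?u n x) \<partial>lborel)"
    by (rule nn_integral_liminf) measurable
  also have "\<dots> \<le> ennreal (4 * pi\<^sup>2) * (\<integral>\<^sup>+b. ennreal ((cmod (F b))\<^sup>2) \<partial>lborel)"
  proof (rule Liminf_le)
    show "\<forall>\<^sub>F n in sequentially. (\<integral>\<^sup>+x. ennreal (?u n x) \<partial>lborel) \<le> ennreal (4 * pi\<^sup>2) * (\<integral>\<^sup>+b. ennreal ((cmod (F b))\<^sup>2) \<partial>lborel)"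
    proof (intro always_eventually allI)
      fix n
      have "(\<integral>\<^sup>+x. ennreal (?u n x) \<partial>lborel)
          = ennreal (2 * pi) * (\<integral>\<^sup>+x. ennreal (gauss_weight (real (Suc n)) x * (cmod (plane_fourier F x))\<^sup>2) \<partial>lborel)"
        by (subst nn_integral_cmult[symmetric]) (auto simp: ennreal_mult[symmetric] gauss_weight_nonneg)
      also have "\<dots> \<le> ennreal (2 * pi) * (ennreal (2 * pi) * (\<integral>\<^sup>+b. ennreal ((cmod (F b))\<^sup>2) \<partial>lborel))"
        by (intro mult_left_mono gauss_weighted_Plancherel True) auto
      also have "\<dots> = ennreal (4 * pi\<^sup>2) * (\<integral>\<^sup>+b. ennreal ((cmod (F b))\<^sup>2) \<partial>lborel)"
        by (simp add: mult.assoc[symmetric] ennreal_mult[symmetric] power2_eq_square)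
      finally show "(\<integral>\<^sup>+x. ennreal (?u n x) \<partial>lborel) \<le> ennreal (4 * pi\<^sup>2) * (\<integral>\<^sup>+b. ennreal ((cmod (F b))\<^sup>2) \<partial>lborel)" .
    qed
  qed simp
  finally show ?thesis .
qed

section \<open>Operators with kernels on cone times dilations and boosts\<close>

lemma measurable_cone_measure_iff:
  "f \<in> measurable M (cone_measure i j) \<longleftrightarrow> f \<in> borel_measurable M \<and> f \<in> space M \<rightarrow> cone i j"
proof -
  have "measurable M (cone_measure i j) = measurable M (restrict_space borel (cone i j))"
    by (rule measurable_cong_sets) (simp_all add: cone_measure_def sets_restrict_space)
  then show ?thesis by (auto simp: measurable_restrict_space2_iff)
qed

lemma ident_cone_borel: "(\<lambda>x. x) \<in> borel_measurable (cone_measure i j)"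
  by (rule borel_measurable_cone_measure) simp

lemma ident_dilation_boost_borel: "(\<lambda>x. x) \<in> borel_measurable dilation_boost_measure"
  by (rule borel_measurable_dilation_boost_measure) simp

definition orbit :: "plane \<Rightarrow> real \<times> real \<Rightarrow> plane" where
  "orbit x p = fst p *\<^sub>R boost (- snd p) x"

text \<open>This is \<open>(\<pi>(b, a, \<theta>) D \<phi>)(x)\<close> without its character, as a function of \<open>p = (a, \<theta>)\<close>.\<close>

definition orbit_lift :: "(plane \<Rightarrow> complex) \<Rightarrow> plane \<Rightarrow> real \<times> real \<Rightarrow> complex" where
  "orbit_lift \<phi> x p = of_real (fst p) * duflo_moore \<phi> (orbit x p)"

definition kernel_op :: "(plane \<times> real \<times> real \<Rightarrow> complex) \<Rightarrow> (plane \<Rightarrow> complex) \<Rightarrow> plane \<Rightarrow> complex" where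
  "kernel_op G \<phi> x = (\<integral>p. G (x, p) * orbit_lift \<phi> x p \<partial>dilation_boost_measure)"

lemma borel_measurable_minkowski [measurable (raw)]:
  assumes [measurable]: "f \<in> borel_measurable M" "g \<in> borel_measurable M"
  shows "(\<lambda>x. minkowski (f x) (g x)) \<in> borel_measurable M"
  unfolding minkowski_def by measurable

lemma borel_measurable_duflo_moore:
  assumes "\<phi> \<in> borel_measurable (cone_measure i j)"
  shows "duflo_moore \<phi> \<in> borel_measurable (cone_measure i j)"
proof -
  have [measurable]: "(\<lambda>x. of_real (1 / (2 * pi) * sqrt \<bar>minkowski x x\<bar>) :: complex) \<in> borel_measurable (cone_measure i j)"
    by (rule borel_measurable_cone_measure) measurable
  note [measurable] = assms
  show ?thesis unfolding duflo_moore_def[abs_def] by measurable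
qed

lemma orbit_in_cone:
  assumes "i \<in> {1, 2}" "j \<in> {1, 2}" "x \<in> cone i j" "p \<in> {0<..} \<times> UNIV"
  shows "orbit x p \<in> cone i j"
  unfolding orbit_def using cone_dilation_boost[OF assms(1,2), of "fst p" "- snd p" x] assms(3,4) by auto

lemma minkowski_orbit: "minkowski (orbit x p) (orbit x p) = (fst p)\<^sup>2 * minkowski x x"
  unfolding orbit_def by (rule minkowski_dilation_boost)

lemma borel_measurable_orbit [measurable (raw)]:
  assumes [measurable]: "f \<in> borel_measurable M" "g \<in> borel_measurable M"
  shows "(\<lambda>x. orbit (f x) (g x)) \<in> borel_measurable M"
  unfolding orbit_def by measurable

text \<open>Cut-offs to the regions where the Minkowski form is bounded lie in the domain of the Duflo--Moore operator.\<close>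

lemma duflo_moore_domain_dense:
  fixes i j :: nat
  defines "C \<equiv> cone_measure i j"
  assumes \<phi>: "\<phi> \<in> L2 C"
  shows "\<exists>\<psi>. (\<forall>n::nat. \<psi> n \<in> L2 C \<and> duflo_moore (\<psi> n) \<in> L2 C) \<and> (\<lambda>n. L2_norm C (\<lambda>x. \<psi> n x - \<phi> x)) \<longlonglongrightarrow> 0"
proof -
  define A where "A n = {x \<in> space C. \<bar>minkowski x x\<bar> \<le> real n}" for n
  have mm: "(\<lambda>x. minkowski x x) \<in> borel_measurable C"
    unfolding C_def by (rule borel_measurable_cone_measure) measurable
  have A: "A n \<in> sets C" for n unfolding A_def using mm by measurable
  define \<psi> where "\<psi> n x = indicator (A n) x * \<phi> x" for n x
  have \<psi>m: "\<psi> n \<in> borel_measurable C" for n unfolding \<psi>_def using A L2_D(1)[OF \<phi>] by measurable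
  have \<psi>: "\<psi> n \<in> L2 C" for n
    by (rule L2_dominated[OF \<phi> \<psi>m]) (auto simp: \<psi>_def indicator_def)
  have D\<psi>: "duflo_moore (\<psi> n) \<in> L2 C" for n
  proof (rule L2_dominated[OF L2_cmult[OF \<phi>, of "of_real (1 / (2 * pi) * sqrt (real n))"]])
    show "duflo_moore (\<psi> n) \<in> borel_measurable C"
      unfolding C_def by (rule borel_measurable_duflo_moore[OF \<psi>m[unfolded C_def]])
    fix x assume x: "x \<in> space C"
    show "cmod (duflo_moore (\<psi> n) x) \<le> cmod (of_real (1 / (2 * pi) * sqrt (real n)) * \<phi> x)"
    proof (cases "x \<in> A n")
      case True
      then have "1 / (2 * pi) * sqrt \<bar>minkowski x x\<bar> \<le> 1 / (2 * pi) * sqrt (real n)"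
        by (intro mult_left_mono) (auto simp: A_def)
      then have "\<bar>1 / (2 * pi) * sqrt \<bar>minkowski x x\<bar>\<bar> * cmod (\<phi> x) \<le> \<bar>1 / (2 * pi) * sqrt (real n)\<bar> * cmod (\<phi> x)"
        by (intro mult_right_mono) auto
      moreover have "duflo_moore (\<psi> n) x = of_real (1 / (2 * pi) * sqrt \<bar>minkowski x x\<bar>) * \<phi> x"
        using True by (simp add: duflo_moore_def \<psi>_def)
      ultimately show ?thesis by (simp only: norm_mult norm_of_real)
    qed (simp add: duflo_moore_def \<psi>_def)
  qed
  have "(\<lambda>n. L2_norm C (\<lambda>x. \<psi> n x - \<phi> x)) \<longlonglongrightarrow> 0"
    unfolding \<psi>_def
  proof (rule L2_cutoff_tendsto[OF \<phi> A])
    fix x assume x: "x \<in> space C"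
    obtain m :: nat where "\<bar>minkowski x x\<bar> \<le> real m" using real_arch_simple by blast
    then have "x \<in> A n" if "m \<le> n" for n using that x by (simp add: A_def)
    then show "\<forall>\<^sub>F n in sequentially. x \<in> A n"
      unfolding eventually_sequentially by blast
  qed
  then show ?thesis using \<psi> D\<psi> by blast
qed

locale cone_index =
  fixes i j :: nat and C :: "plane measure" and N :: "(real \<times> real) measure"
  assumes ij: "i \<in> {1, 2}" "j \<in> {1, 2}"
    and C_def: "C = cone_measure i j" and N_def: "N = dilation_boost_measure"
begin

lemma space_C: "space C = cone i j" by (simp add: C_def)
lemma space_N: "space N = {0<..} \<times> UNIV" by (simp add: N_def)

lemma pair_sigma_finite_CN: "pair_sigma_finite C N"
  unfolding C_def N_def
  by (intro pair_sigma_finite.intro sigma_finite_cone_measure sigma_finite_dilation_boost_measure)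

lemma measurable_orbit_pair: "(\<lambda>(x, p). orbit x p) \<in> measurable (C \<Otimes>\<^sub>M N) C"
proof -
  have 1: "fst \<in> borel_measurable (C \<Otimes>\<^sub>M N)"
    using measurable_compose[OF measurable_fst[of C N]] ident_cone_borel[of i j] unfolding C_def by blast
  have 2: "snd \<in> borel_measurable (C \<Otimes>\<^sub>M N)"
    using measurable_compose[OF measurable_snd[of C N]] ident_dilation_boost_borel unfolding N_def by blast
  show ?thesis
    using borel_measurable_orbit[OF 1 2]
    by (subst (2) C_def, unfold measurable_cone_measure_iff)
      (auto simp: space_pair_measure space_C space_N split_beta' intro!: orbit_in_cone[OF ij])
qed

lemma measurable_orbit:
  assumes "x \<in> cone i j" shows "orbit x \<in> measurable N C"
  using measurable_compose[OF measurable_Pair1' measurable_orbit_pair, of x] assms by (simp add: space_C)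

lemma measurable_orbit_lift_pair:
  assumes "\<phi> \<in> borel_measurable C"
  shows "(\<lambda>(x, p). orbit_lift \<phi> x p) \<in> borel_measurable (C \<Otimes>\<^sub>M N)"
proof -
  have "(\<lambda>z. duflo_moore \<phi> (case z of (x, p) \<Rightarrow> orbit x p)) \<in> borel_measurable (C \<Otimes>\<^sub>M N)"
    using measurable_compose[OF measurable_orbit_pair borel_measurable_duflo_moore[OF assms[unfolded C_def], folded C_def]] .
  moreover have "(\<lambda>z. complex_of_real (fst (snd z))) \<in> borel_measurable (C \<Otimes>\<^sub>M N)"
  proof -
    have "(\<lambda>p. complex_of_real (fst p)) \<in> borel_measurable N"
      unfolding N_def by (rule borel_measurable_dilation_boost_measure) measurable
    from measurable_compose[OF measurable_snd this] show ?thesis .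
  qed
  ultimately have "(\<lambda>z. complex_of_real (fst (snd z)) * duflo_moore \<phi> (case z of (x, p) \<Rightarrow> orbit x p)) \<in> borel_measurable (C \<Otimes>\<^sub>M N)"
    by measurable
  then show ?thesis by (simp add: orbit_lift_def split_beta')
qed

lemma measurable_orbit_lift:
  assumes "\<phi> \<in> borel_measurable C" "x \<in> cone i j"
  shows "orbit_lift \<phi> x \<in> borel_measurable N"
  using measurable_compose[OF measurable_Pair1' measurable_orbit_lift_pair[OF assms(1)], of x] assms(2)
  by (simp add: space_C)

text \<open>The orbit map of a point of the cone is a measure isomorphism once the group carries the weight \<open>a\<^sup>4 |\<langle>x;x\<rangle>|\<close>.
  This weight is what the factors \<open>a\<close> and \<open>|\<langle>x;x\<rangle>|\<^sup>1\<^sup>/\<^sup>2\<close> in \<open>orbit_lift\<close> produce, so that \<open>2\<pi> orbit_lift\<close> is isometric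
  at every point separately; that is the purpose of the Duflo--Moore operator.\<close>

lemma nn_integral_orbit_weighted:
  assumes x: "x \<in> cone i j" and h: "h \<in> borel_measurable C"
  shows "(\<integral>\<^sup>+p. ennreal ((fst p) ^ 4 * \<bar>minkowski x x\<bar>) * h (orbit x p) \<partial>N) = (\<integral>\<^sup>+y. h y \<partial>C)"
proof -
  define k where "k y = h y * indicator (cone i j) y" for y
  have [measurable]: "k \<in> borel_measurable borel"
    using h unfolding C_def cone_measure_def k_def[abs_def]
    by (subst (asm) borel_measurable_restrict_space_iff_ennreal) simp_all
  have "(\<integral>\<^sup>+p. ennreal ((fst p) ^ 4 * \<bar>minkowski x x\<bar>) * h (orbit x p) \<partial>N)
      = (\<integral>\<^sup>+p. ennreal ((fst p) ^ 4 * \<bar>minkowski x x\<bar>) * k (orbit x p) \<partial>N)"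
    by (rule nn_integral_cong) (use orbit_in_cone[OF ij x] in \<open>auto simp: k_def space_N\<close>)
  also have "\<dots> = (\<integral>\<^sup>+a. \<integral>\<^sup>+\<theta>. (ennreal (a ^ 4 * \<bar>minkowski x x\<bar>) * k (a *\<^sub>R boost (- \<theta>) x))
      * (ennreal (1 / a ^ 3) * indicator {0<..} a) \<partial>lborel \<partial>lborel)"
    unfolding N_def by (subst nn_integral_dilation_boost_measure) (auto simp: orbit_def)
  also have "\<dots> = (\<integral>\<^sup>+a. \<integral>\<^sup>+\<theta>. k (a *\<^sub>R boost (- \<theta>) x) * ennreal (a * \<bar>minkowski x x\<bar>) * indicator {0<..} a \<partial>lborel \<partial>lborel)"
  proof (intro nn_integral_cong)
    fix a \<theta> :: real
    show "(ennreal (a ^ 4 * \<bar>minkowski x x\<bar>) * k (a *\<^sub>R boost (- \<theta>) x)) * (ennreal (1 / a ^ 3) * indicator {0<..} a)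
      = k (a *\<^sub>R boost (- \<theta>) x) * ennreal (a * \<bar>minkowski x x\<bar>) * indicator {0<..} a"
    proof (cases "a > 0")
      case True
      have "a ^ 4 * \<bar>minkowski x x\<bar> * (1 / a ^ 3) = a * \<bar>minkowski x x\<bar>"
        using True by (simp add: power4_eq_xxxx power3_eq_cube)
      then have "ennreal (a ^ 4 * \<bar>minkowski x x\<bar>) * ennreal (1 / a ^ 3) = ennreal (a * \<bar>minkowski x x\<bar>)"
        using True by (subst ennreal_mult[symmetric]) auto
      then show ?thesis using True by (simp add: ac_simps)
    qed simp
  qed
  also have "\<dots> = (\<integral>\<^sup>+y. k y \<partial>C)" unfolding C_def by (rule nn_integral_orbit[OF ij x]) simp
  also have "\<dots> = (\<integral>\<^sup>+y. h y \<partial>C)" by (rule nn_integral_cong) (simp add: k_def space_C)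
  finally show ?thesis .
qed

lemma borel_measurable_orbit_weight: "(\<lambda>p. ennreal ((fst p) ^ 4 * \<bar>minkowski x x\<bar>)) \<in> borel_measurable N"
  unfolding N_def by (rule borel_measurable_dilation_boost_measure) measurable

lemma distr_orbit:
  assumes x: "x \<in> cone i j"
  shows "distr (density N (\<lambda>p. ennreal ((fst p) ^ 4 * \<bar>minkowski x x\<bar>))) C (orbit x) = C"
proof (rule measure_eqI)
  fix A assume "A \<in> sets (distr (density N (\<lambda>p. ennreal ((fst p) ^ 4 * \<bar>minkowski x x\<bar>))) C (orbit x))"
  then have A: "A \<in> sets C" by simp
  have m: "orbit x \<in> measurable (density N (\<lambda>p. ennreal ((fst p) ^ 4 * \<bar>minkowski x x\<bar>))) C"
    using measurable_orbit[OF x] by simp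
  have "emeasure (distr (density N (\<lambda>p. ennreal ((fst p) ^ 4 * \<bar>minkowski x x\<bar>))) C (orbit x)) A
      = (\<integral>\<^sup>+y. indicator A y \<partial>distr (density N (\<lambda>p. ennreal ((fst p) ^ 4 * \<bar>minkowski x x\<bar>))) C (orbit x))"
    using A by simp
  also have "\<dots> = (\<integral>\<^sup>+p. indicator A (orbit x p) \<partial>density N (\<lambda>p. ennreal ((fst p) ^ 4 * \<bar>minkowski x x\<bar>)))"
    by (rule nn_integral_distr[OF m]) (use A in simp)
  also have "\<dots> = (\<integral>\<^sup>+p. ennreal ((fst p) ^ 4 * \<bar>minkowski x x\<bar>) * indicator A (orbit x p) \<partial>N)"
    by (rule nn_integral_density[OF borel_measurable_orbit_weight])
      (rule measurable_compose[OF measurable_orbit[OF x]], use A in simp)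
  also have "\<dots> = (\<integral>\<^sup>+y. indicator A y \<partial>C)" by (rule nn_integral_orbit_weighted[OF x]) (use A in simp)
  finally show "emeasure (distr (density N (\<lambda>p. ennreal ((fst p) ^ 4 * \<bar>minkowski x x\<bar>))) C (orbit x)) A = emeasure C A"
    using A by simp
qed simp

lemma orbit_lift_mult:
  assumes p: "p \<in> space N"
  shows "orbit_lift \<phi> x p * cnj (orbit_lift \<psi> x p)
    = ((fst p) ^ 4 * \<bar>minkowski x x\<bar>) *\<^sub>R (of_real (1 / (4 * pi\<^sup>2)) * (\<phi> (orbit x p) * cnj (\<psi> (orbit x p))))"
proof -
  have s: "sqrt ((fst p)\<^sup>2 * \<bar>minkowski x x\<bar>) * sqrt ((fst p)\<^sup>2 * \<bar>minkowski x x\<bar>) = (fst p)\<^sup>2 * \<bar>minkowski x x\<bar>" by simp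
  have m: "\<bar>minkowski (orbit x p) (orbit x p)\<bar> = (fst p)\<^sup>2 * \<bar>minkowski x x\<bar>"
    by (simp add: minkowski_orbit abs_mult)
  let ?r = "1 / (2 * pi) * sqrt \<bar>minkowski (orbit x p) (orbit x p)\<bar>"
  have mult: "(of_real c * (of_real r * y)) * cnj (of_real c * (of_real r * z)) = of_real ((c * r) * (c * r)) * (y * cnj z)"
    for c r :: real and y z :: complex
    by (simp add: ac_simps)
  have "orbit_lift \<phi> x p * cnj (orbit_lift \<psi> x p)
    = of_real ((fst p * ?r) * (fst p * ?r)) * (\<phi> (orbit x p) * cnj (\<psi> (orbit x p)))"
    unfolding orbit_lift_def duflo_moore_def by (rule mult)
  also have "(fst p * ?r) * (fst p * ?r) = (fst p)\<^sup>2 * (1 / (4 * pi\<^sup>2)) * (sqrt \<bar>minkowski (orbit x p) (orbit x p)\<bar> * sqrt \<bar>minkowski (orbit x p) (orbit x p)\<bar>)"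
    by (simp add: power2_eq_square)
  also have "\<dots> = ((fst p) ^ 4 * \<bar>minkowski x x\<bar>) * (1 / (4 * pi\<^sup>2))"
    unfolding m s by (simp add: power4_eq_xxxx power2_eq_square)
  finally show ?thesis by (simp only: scaleR_conv_of_real of_real_mult mult.assoc)
qed

lemma orbit_lift_L2:
  assumes x: "x \<in> cone i j" and \<phi>: "\<phi> \<in> L2 C"
  shows "orbit_lift \<phi> x \<in> L2 N" and "(L2_norm N (orbit_lift \<phi> x))\<^sup>2 = (L2_norm C \<phi>)\<^sup>2 / (4 * pi\<^sup>2)"
proof -
  have \<phi>m: "\<phi> \<in> borel_measurable C" by (rule L2_D[OF \<phi>])
  note om = measurable_compose[OF measurable_orbit[OF x] \<phi>m]
  have sq: "(cmod (orbit_lift \<phi> x p))\<^sup>2 = ((fst p) ^ 4 * \<bar>minkowski x x\<bar>) * ((cmod (\<phi> (orbit x p)))\<^sup>2 / (4 * pi\<^sup>2))"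
    if "p \<in> space N" for p
  proof -
    have "complex_of_real ((cmod (orbit_lift \<phi> x p))\<^sup>2)
      = complex_of_real (((fst p) ^ 4 * \<bar>minkowski x x\<bar>) * ((cmod (\<phi> (orbit x p)))\<^sup>2 / (4 * pi\<^sup>2)))"
      using orbit_lift_mult[OF that, of \<phi> x \<phi>]
      by (simp add: complex_norm_square[symmetric] scaleR_conv_of_real del: of_real_power)
    then show ?thesis unfolding of_real_eq_iff .
  qed
  have "(\<integral>\<^sup>+p. ennreal ((cmod (orbit_lift \<phi> x p))\<^sup>2) \<partial>N)
      = (\<integral>\<^sup>+p. ennreal ((fst p) ^ 4 * \<bar>minkowski x x\<bar>) * ennreal ((cmod (\<phi> (orbit x p)))\<^sup>2 / (4 * pi\<^sup>2)) \<partial>N)"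
    by (intro nn_integral_cong) (simp only: sq, subst ennreal_mult, auto)
  also have "\<dots> = (\<integral>\<^sup>+y. ennreal ((cmod (\<phi> y))\<^sup>2 / (4 * pi\<^sup>2)) \<partial>C)"
    by (rule nn_integral_orbit_weighted[OF x]) (use \<phi>m in measurable)
  also have "\<dots> = (\<integral>\<^sup>+y. ennreal (1 / (4 * pi\<^sup>2)) * ennreal ((cmod (\<phi> y))\<^sup>2) \<partial>C)"
    by (intro nn_integral_cong) (subst ennreal_mult[symmetric], auto)
  also have "\<dots> = ennreal (1 / (4 * pi\<^sup>2)) * (\<integral>\<^sup>+y. ennreal ((cmod (\<phi> y))\<^sup>2) \<partial>C)"
    by (rule nn_integral_cmult) (use \<phi>m in measurable)
  also have "\<dots> = ennreal ((L2_norm C \<phi>)\<^sup>2 / (4 * pi\<^sup>2))"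
    unfolding L2_norm_sq_nn_integral[OF \<phi>] by (subst ennreal_mult[symmetric]) auto
  finally have *: "(\<integral>\<^sup>+p. ennreal ((cmod (orbit_lift \<phi> x p))\<^sup>2) \<partial>N) = ennreal ((L2_norm C \<phi>)\<^sup>2 / (4 * pi\<^sup>2))" .
  show L: "orbit_lift \<phi> x \<in> L2 N"
    unfolding L2_iff_nn_integral * using measurable_orbit_lift[OF \<phi>m x] by simp
  show "(L2_norm N (orbit_lift \<phi> x))\<^sup>2 = (L2_norm C \<phi>)\<^sup>2 / (4 * pi\<^sup>2)"
    using * unfolding L2_norm_sq_nn_integral[OF L] by simp
qed

lemma orbit_lift_inner:
  assumes x: "x \<in> cone i j" and \<phi>: "\<phi> \<in> L2 C" and \<psi>: "\<psi> \<in> L2 C"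
  shows "L2_inner N (orbit_lift \<phi> x) (orbit_lift \<psi> x) = of_real (1 / (4 * pi\<^sup>2)) * L2_inner C \<phi> \<psi>"
proof -
  let ?w = "\<lambda>p. (fst p) ^ 4 * \<bar>minkowski x x\<bar>" and ?f = "\<lambda>y. complex_of_real (1 / (4 * pi\<^sup>2)) * (\<phi> y * cnj (\<psi> y))"
  have fm: "?f \<in> borel_measurable C" using L2_D(1)[OF \<phi>] L2_D(1)[OF \<psi>] by measurable
  have m: "orbit x \<in> measurable (density N (\<lambda>p. ennreal (?w p))) C"
    using measurable_orbit[OF x] by simp
  have wm: "?w \<in> borel_measurable N"
    unfolding N_def by (rule borel_measurable_dilation_boost_measure) measurable
  have "L2_inner N (orbit_lift \<phi> x) (orbit_lift \<psi> x) = (\<integral>p. ?w p *\<^sub>R ?f (orbit x p) \<partial>N)"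
    unfolding L2_inner_def by (rule Bochner_Integration.integral_cong) (simp_all add: orbit_lift_mult)
  also have "\<dots> = (\<integral>p. ?f (orbit x p) \<partial>density N (\<lambda>p. ennreal (?w p)))"
    by (rule integral_density[symmetric]) (use measurable_compose[OF measurable_orbit[OF x] fm] wm in auto)
  also have "\<dots> = (\<integral>y. ?f y \<partial>distr (density N (\<lambda>p. ennreal (?w p))) C (orbit x))"
    by (rule integral_distr[OF m fm, symmetric])
  also have "\<dots> = of_real (1 / (4 * pi\<^sup>2)) * L2_inner C \<phi> \<psi>"
    unfolding distr_orbit[OF x] L2_inner_def by (rule integral_mult_right_zero)
  finally show ?thesis .
qed

lemma L2_sections:
  assumes G: "G \<in> L2 (C \<Otimes>\<^sub>M N)"
  shows "(\<integral>\<^sup>+x. \<integral>\<^sup>+p. ennreal ((cmod (G (x, p)))\<^sup>2) \<partial>N \<partial>C) = ennreal ((L2_norm (C \<Otimes>\<^sub>M N) G)\<^sup>2)"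
    and "AE x in C. (\<lambda>p. G (x, p)) \<in> L2 N"
proof -
  interpret pair_sigma_finite C N by (rule pair_sigma_finite_CN)
  have Gm: "G \<in> borel_measurable (C \<Otimes>\<^sub>M N)" by (rule L2_D[OF G])
  have m: "(\<lambda>z. ennreal ((cmod (G z))\<^sup>2)) \<in> borel_measurable (C \<Otimes>\<^sub>M N)" using Gm by measurable
  show *: "(\<integral>\<^sup>+x. \<integral>\<^sup>+p. ennreal ((cmod (G (x, p)))\<^sup>2) \<partial>N \<partial>C) = ennreal ((L2_norm (C \<Otimes>\<^sub>M N) G)\<^sup>2)"
    using M2.nn_integral_fst[OF m] L2_norm_sq_nn_integral[OF G] by simp
  have "AE x in C. (\<integral>\<^sup>+p. ennreal ((cmod (G (x, p)))\<^sup>2) \<partial>N) \<noteq> \<infinity>"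
    by (rule nn_integral_PInf_AE) (use * M2.borel_measurable_nn_integral_fst[OF m] in auto)
  then show "AE x in C. (\<lambda>p. G (x, p)) \<in> L2 N"
  proof (rule AE_mp, intro AE_I2 impI)
    fix x assume x: "x \<in> space C" and f: "(\<integral>\<^sup>+p. ennreal ((cmod (G (x, p)))\<^sup>2) \<partial>N) \<noteq> \<infinity>"
    show "(\<lambda>p. G (x, p)) \<in> L2 N"
      unfolding L2_iff_nn_integral using f measurable_compose[OF measurable_Pair1'[OF x] Gm]
      by (simp add: top.not_eq_extremum)
  qed
qed

lemma measurable_kernel_op:
  assumes "G \<in> borel_measurable (C \<Otimes>\<^sub>M N)" "\<phi> \<in> borel_measurable C"
  shows "kernel_op G \<phi> \<in> borel_measurable C"
proof -
  interpret pair_sigma_finite C N by (rule pair_sigma_finite_CN)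
  have "(\<lambda>(x, p). G (x, p) * orbit_lift \<phi> x p) \<in> borel_measurable (C \<Otimes>\<^sub>M N)"
    using assms(1) measurable_orbit_lift_pair[OF assms(2)] by (simp add: split_beta')
  then have "(\<lambda>x. \<integral>p. G (x, p) * orbit_lift \<phi> x p \<partial>N) \<in> borel_measurable C"
    by (rule M2.borel_measurable_lebesgue_integral)
  then show ?thesis unfolding kernel_op_def[abs_def] N_def .
qed

lemma kernel_op_L2:
  assumes G: "G \<in> L2 (C \<Otimes>\<^sub>M N)" and \<phi>: "\<phi> \<in> L2 C"
  shows "kernel_op G \<phi> \<in> L2 C"
    and "L2_norm C (kernel_op G \<phi>) \<le> L2_norm (C \<Otimes>\<^sub>M N) G * L2_norm C \<phi> / (2 * pi)"
proof -
  let ?c = "(L2_norm C \<phi>)\<^sup>2 / (4 * pi\<^sup>2)"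
  have "(\<integral>\<^sup>+x. ennreal ((cmod (kernel_op G \<phi> x))\<^sup>2) \<partial>C)
      \<le> (\<integral>\<^sup>+x. ennreal ?c * (\<integral>\<^sup>+p. ennreal ((cmod (G (x, p)))\<^sup>2) \<partial>N) \<partial>C)"
  proof (rule nn_integral_mono_AE)
    show "AE x in C. ennreal ((cmod (kernel_op G \<phi> x))\<^sup>2) \<le> ennreal ?c * (\<integral>\<^sup>+p. ennreal ((cmod (G (x, p)))\<^sup>2) \<partial>N)"
      using L2_sections(2)[OF G] AE_space
    proof eventually_elim
      case (elim x)
      then have x: "x \<in> cone i j" by (simp add: space_C)
      have "cmod (kernel_op G \<phi> x) \<le> L2_norm N (\<lambda>p. G (x, p)) * L2_norm N (orbit_lift \<phi> x)"
        unfolding kernel_op_def N_def[symmetric] by (rule L2_integral_mult_le[OF elim(1) orbit_lift_L2(1)[OF x \<phi>]])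
      then have "(cmod (kernel_op G \<phi> x))\<^sup>2 \<le> (L2_norm N (\<lambda>p. G (x, p)) * L2_norm N (orbit_lift \<phi> x))\<^sup>2"
        by (rule power_mono) simp
      also have "\<dots> = ?c * (L2_norm N (\<lambda>p. G (x, p)))\<^sup>2"
        by (simp add: power_mult_distrib orbit_lift_L2(2)[OF x \<phi>])
      finally show ?case
        unfolding L2_norm_sq_nn_integral[OF elim(1)] by (subst ennreal_mult[symmetric]) (auto intro: ennreal_leI)
    qed
  qed
  also have "\<dots> = ennreal ?c * (\<integral>\<^sup>+x. \<integral>\<^sup>+p. ennreal ((cmod (G (x, p)))\<^sup>2) \<partial>N \<partial>C)"
  proof (rule nn_integral_cmult)
    interpret pair_sigma_finite C N by (rule pair_sigma_finite_CN)
    have "(\<lambda>z. ennreal ((cmod (G z))\<^sup>2)) \<in> borel_measurable (C \<Otimes>\<^sub>M N)" using L2_D(1)[OF G] by measurable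
    from M2.borel_measurable_nn_integral_fst[OF this]
    show "(\<lambda>x. \<integral>\<^sup>+p. ennreal ((cmod (G (x, p)))\<^sup>2) \<partial>N) \<in> borel_measurable C" .
  qed
  also have "\<dots> = ennreal (?c * (L2_norm (C \<Otimes>\<^sub>M N) G)\<^sup>2)"
    unfolding L2_sections(1)[OF G] by (subst ennreal_mult[symmetric]) auto
  finally have *: "(\<integral>\<^sup>+x. ennreal ((cmod (kernel_op G \<phi> x))\<^sup>2) \<partial>C) \<le> ennreal (?c * (L2_norm (C \<Otimes>\<^sub>M N) G)\<^sup>2)" .
  have m: "kernel_op G \<phi> \<in> borel_measurable C" by (rule measurable_kernel_op[OF L2_D(1)[OF G] L2_D(1)[OF \<phi>]])
  show "kernel_op G \<phi> \<in> L2 C" by (rule L2_I_nn_integral(1)[OF m *]) simp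
  have "(L2_norm C (kernel_op G \<phi>))\<^sup>2 \<le> ?c * (L2_norm (C \<Otimes>\<^sub>M N) G)\<^sup>2"
    by (rule L2_I_nn_integral(2)[OF m *]) simp
  also have "\<dots> = (L2_norm (C \<Otimes>\<^sub>M N) G * L2_norm C \<phi> / (2 * pi))\<^sup>2"
    by (simp add: power_mult_distrib power_divide)
  finally show "L2_norm C (kernel_op G \<phi>) \<le> L2_norm (C \<Otimes>\<^sub>M N) G * L2_norm C \<phi> / (2 * pi)"
    by (rule power2_le_imp_le) simp
qed

lemma orbit_lift_lincomb: "orbit_lift (\<lambda>y. c * \<phi> y + d * \<psi> y) x p = c * orbit_lift \<phi> x p + d * orbit_lift \<psi> x p"
  by (simp add: orbit_lift_def duflo_moore_def algebra_simps add_divide_distrib)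

lemma kernel_op_lincomb:
  assumes G: "G \<in> L2 (C \<Otimes>\<^sub>M N)" and \<phi>: "\<phi> \<in> L2 C" and \<psi>: "\<psi> \<in> L2 C"
  shows "AE x in C. kernel_op G (\<lambda>y. c * \<phi> y + d * \<psi> y) x = c * kernel_op G \<phi> x + d * kernel_op G \<psi> x"
  using L2_sections(2)[OF G] AE_space
proof eventually_elim
  case (elim x)
  then have x: "x \<in> cone i j" by (simp add: space_C)
  note i = L2_mult_integrable[OF elim(1) orbit_lift_L2(1)[OF x \<phi>]] L2_mult_integrable[OF elim(1) orbit_lift_L2(1)[OF x \<psi>]]
  show ?case
    unfolding kernel_op_def orbit_lift_lincomb N_def[symmetric]
    using i by (simp add: distrib_left mult.left_commute)
qed

lemma kernel_op_lincomb_kernel: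
  assumes G: "G \<in> L2 (C \<Otimes>\<^sub>M N)" and H: "H \<in> L2 (C \<Otimes>\<^sub>M N)" and \<phi>: "\<phi> \<in> L2 C"
  shows "AE x in C. kernel_op (\<lambda>z. c * G z + d * H z) \<phi> x = c * kernel_op G \<phi> x + d * kernel_op H \<phi> x"
  using L2_sections(2)[OF G] L2_sections(2)[OF H] AE_space
proof eventually_elim
  case (elim x)
  then have x: "x \<in> cone i j" by (simp add: space_C)
  note i = L2_mult_integrable[OF elim(1) orbit_lift_L2(1)[OF x \<phi>]] L2_mult_integrable[OF elim(2) orbit_lift_L2(1)[OF x \<phi>]]
  show ?case
    unfolding kernel_op_def N_def[symmetric]
    using i by (simp add: distrib_right mult.assoc)
qed

lemma kernel_op_cong_AE:
  assumes G: "G \<in> borel_measurable (C \<Otimes>\<^sub>M N)" and H: "H \<in> borel_measurable (C \<Otimes>\<^sub>M N)" and \<phi>: "\<phi> \<in> borel_measurable C"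
    and eq: "AE z in C \<Otimes>\<^sub>M N. G z = H z"
  shows "AE x in C. kernel_op G \<phi> x = kernel_op H \<phi> x"
proof -
  interpret pair_sigma_finite C N by (rule pair_sigma_finite_CN)
  from AE_pair[OF eq] AE_space show ?thesis
  proof eventually_elim
    case (elim x)
    then have x: "x \<in> cone i j" by (simp add: space_C)
    show ?case
      unfolding kernel_op_def N_def[symmetric]
      by (rule integral_cong_AE)
        (use elim measurable_compose[OF measurable_Pair1'[OF elim(2)] G]
          measurable_compose[OF measurable_Pair1'[OF elim(2)] H] measurable_orbit_lift[OF \<phi> x] in auto)
  qed
qed

text \<open>At every \<open>x\<close> the functions \<open>2\<pi> orbit_lift e\<^sub>n x\<close> are orthonormal, and \<open>kernel_op G e\<^sub>n x\<close> is, up to the factor \<open>2\<pi>\<close> and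
  conjugation, a coefficient of the conjugate of \<open>G(x, _)\<close> in this family; Bessel's inequality is then integrated over \<open>x\<close>.\<close>

lemma kernel_op_hs_sum:
  assumes G: "G \<in> L2 (C \<Otimes>\<^sub>M N)" and e: "orthonormal_family C (UNIV :: nat set) e"
  shows "(\<Sum>n. ennreal ((L2_norm C (kernel_op G (e n)))\<^sup>2)) \<le> ennreal ((L2_norm (C \<Otimes>\<^sub>M N) G)\<^sup>2 / (4 * pi\<^sup>2))"
proof -
  have eL: "e n \<in> L2 C" for n using e by (simp add: orthonormal_family_def)
  have m: "kernel_op G (e n) \<in> borel_measurable C" for n
    by (rule measurable_kernel_op[OF L2_D(1)[OF G] L2_D(1)[OF eL]])
  have "(\<Sum>n. ennreal ((L2_norm C (kernel_op G (e n)))\<^sup>2)) = (\<Sum>n. (\<integral>\<^sup>+x. ennreal ((cmod (kernel_op G (e n) x))\<^sup>2) \<partial>C))"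
    by (simp add: L2_norm_sq_nn_integral[OF kernel_op_L2(1)[OF G eL]])
  also have "\<dots> = (\<integral>\<^sup>+x. (\<Sum>n. ennreal ((cmod (kernel_op G (e n) x))\<^sup>2)) \<partial>C)"
    by (rule nn_integral_suminf[symmetric]) (use m in measurable)
  also have "\<dots> \<le> (\<integral>\<^sup>+x. ennreal (1 / (4 * pi\<^sup>2)) * (\<integral>\<^sup>+p. ennreal ((cmod (G (x, p)))\<^sup>2) \<partial>N) \<partial>C)"
  proof (rule nn_integral_mono_AE)
    show "AE x in C. (\<Sum>n. ennreal ((cmod (kernel_op G (e n) x))\<^sup>2))
        \<le> ennreal (1 / (4 * pi\<^sup>2)) * (\<integral>\<^sup>+p. ennreal ((cmod (G (x, p)))\<^sup>2) \<partial>N)"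
      using L2_sections(2)[OF G] AE_space
    proof eventually_elim
      case (elim x)
      then have x: "x \<in> cone i j" by (simp add: space_C)
      define u where "u n p = complex_of_real (2 * pi) * orbit_lift (e n) x p" for n p
      have uL: "u n \<in> L2 N" for n unfolding u_def by (rule L2_cmult[OF orbit_lift_L2(1)[OF x eL]])
      have "L2_inner N (u n) (u m) = (if n = m then 1 else 0)" for n m
        unfolding u_def L2_inner_cmult_left L2_inner_cmult_right orbit_lift_inner[OF x eL eL]
          orthonormal_family_inner[OF e UNIV_I UNIV_I]
        by (simp add: power2_eq_square)
      then have u: "orthonormal_family N UNIV u" using uL by (simp add: orthonormal_family_def)
      let ?g = "\<lambda>p. cnj (G (x, p))"
      have g: "?g \<in> L2 N" by (rule L2_cnj[OF elim(1)])
      have c: "L2_inner N ?g (u n) = complex_of_real (2 * pi) * cnj (kernel_op G (e n) x)" for n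
        unfolding u_def L2_inner_cmult_right unfolding L2_inner_def kernel_op_def N_def[symmetric]
        by (simp flip: Bochner_Integration.integral_cnj)
      have "(\<Sum>n. ennreal ((cmod (kernel_op G (e n) x))\<^sup>2))
          = (\<Sum>n. ennreal (1 / (4 * pi\<^sup>2)) * ennreal ((cmod (L2_inner N ?g (u n)))\<^sup>2))"
        unfolding c by (intro suminf_cong, subst ennreal_mult[symmetric]) (auto simp: norm_mult power_mult_distrib)
      also have "\<dots> = ennreal (1 / (4 * pi\<^sup>2)) * (\<Sum>n. ennreal ((cmod (L2_inner N ?g (u n)))\<^sup>2))"
        by (rule ennreal_suminf_cmult)
      also have "\<dots> \<le> ennreal (1 / (4 * pi\<^sup>2)) * ennreal ((L2_norm N ?g)\<^sup>2)"
        by (intro mult_left_mono Bessel_ennreal[OF u g]) simp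
      also have "\<dots> = ennreal (1 / (4 * pi\<^sup>2)) * (\<integral>\<^sup>+p. ennreal ((cmod (G (x, p)))\<^sup>2) \<partial>N)"
        unfolding L2_norm_cnj L2_norm_sq_nn_integral[OF elim(1)] ..
      finally show ?case .
    qed
  qed
  also have "\<dots> = ennreal (1 / (4 * pi\<^sup>2)) * (\<integral>\<^sup>+x. \<integral>\<^sup>+p. ennreal ((cmod (G (x, p)))\<^sup>2) \<partial>N \<partial>C)"
  proof (rule nn_integral_cmult)
    interpret pair_sigma_finite C N by (rule pair_sigma_finite_CN)
    have "(\<lambda>z. ennreal ((cmod (G z))\<^sup>2)) \<in> borel_measurable (C \<Otimes>\<^sub>M N)" using L2_D(1)[OF G] by measurable
    from M2.borel_measurable_nn_integral_fst[OF this]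
    show "(\<lambda>x. \<integral>\<^sup>+p. ennreal ((cmod (G (x, p)))\<^sup>2) \<partial>N) \<in> borel_measurable C" .
  qed
  also have "\<dots> = ennreal ((L2_norm (C \<Otimes>\<^sub>M N) G)\<^sup>2 / (4 * pi\<^sup>2))"
    unfolding L2_sections(1)[OF G] by (subst ennreal_mult[symmetric]) auto
  finally show ?thesis .
qed

lemma kernel_op_bounded:
  assumes "G \<in> L2 (C \<Otimes>\<^sub>M N)" shows "L2_bounded_operator C (kernel_op G)"
  unfolding L2_bounded_operator_def
proof (intro conjI ballI allI exI)
  show "L2_norm C (kernel_op G f) \<le> L2_norm (C \<Otimes>\<^sub>M N) G / (2 * pi) * L2_norm C f" if "f \<in> L2 C" for f
    using kernel_op_L2(2)[OF assms that] by simp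
qed (use assms in \<open>auto intro: kernel_op_L2 kernel_op_lincomb\<close>)

lemma basis_C: "orthonormal_basis C (some_basis C)"
  unfolding C_def by (rule some_basis_cone[OF ij])

lemma kernel_op_hilbert_schmidt:
  assumes G: "G \<in> L2 (C \<Otimes>\<^sub>M N)"
  shows "hilbert_schmidt C (kernel_op G)" and "hs_norm C (kernel_op G) \<le> L2_norm (C \<Otimes>\<^sub>M N) G / (2 * pi)"
proof -
  note le = kernel_op_hs_sum[OF G orthonormal_basis_family[OF basis_C]]
  have "summable (\<lambda>n. (L2_norm C (kernel_op G (some_basis C n)))\<^sup>2)"
    by (rule summable_suminf_not_top) (use le in \<open>auto simp: top_unique\<close>)
  then show hs: "hilbert_schmidt C (kernel_op G)"
    by (simp add: hilbert_schmidt_def kernel_op_bounded[OF G])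
  have "(hs_norm C (kernel_op G))\<^sup>2 \<le> (L2_norm (C \<Otimes>\<^sub>M N) G)\<^sup>2 / (4 * pi\<^sup>2)"
    using le unfolding hs_norm_sq_sums[OF hs] by simp
  also have "\<dots> = (L2_norm (C \<Otimes>\<^sub>M N) G / (2 * pi))\<^sup>2" by (simp add: power_divide power_mult_distrib)
  finally show "hs_norm C (kernel_op G) \<le> L2_norm (C \<Otimes>\<^sub>M N) G / (2 * pi)"
    by (rule power2_le_imp_le) simp
qed

end

section \<open>The group Fourier transform\<close>

text \<open>The partial Fourier transform in the translation variable is the kernel of the group Fourier transform of an
  integrable function.\<close>

definition fibre_fourier :: "(poincare \<Rightarrow> complex) \<Rightarrow> plane \<times> real \<times> real \<Rightarrow> complex" where
  "fibre_fourier F = (\<lambda>(x, p). plane_fourier (\<lambda>b. F (b, p)) x)"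

lemma rep_duflo_moore: "rep (b, p) (duflo_moore \<phi>) x = character x b * orbit_lift \<phi> x p"
  by (cases p) (simp add: rep_def character_def orbit_lift_def orbit_def ac_simps)

context cone_index
begin

lemma haar_pair: "haar = lborel \<Otimes>\<^sub>M N"
  by (simp add: N_def haar_eq_pair)

lemma pair_sigma_finite_LN: "pair_sigma_finite lborel N"
  unfolding N_def
  by (intro pair_sigma_finite.intro sigma_finite_dilation_boost_measure) (rule lborel.sigma_finite_measure_axioms)

lemmas CN_fold = C_def[symmetric] N_def[symmetric]

lemma basis_C_L2: "some_basis C n \<in> L2 C"
  by (rule some_basis_L2[OF basis_C])

lemma hilbert_schmidt_basis_L2: "hilbert_schmidt C T \<Longrightarrow> T (some_basis C n) \<in> L2 C"
  by (simp add: hilbert_schmidt_def L2_bounded_operator_L2 basis_C_L2)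

lemma measurable_section_translations:
  assumes "F \<in> borel_measurable haar" "p \<in> space N"
  shows "(\<lambda>b. F (b, p)) \<in> borel_measurable borel"
  using measurable_compose[OF measurable_Pair2'[OF assms(2), of lborel], of F borel] assms(1)
  by (simp add: haar_pair)

lemma measurable_fibre_integrand:
  assumes F: "F \<in> borel_measurable haar"
  shows "(\<lambda>((x, p), b). F (b, p) * character x b) \<in> borel_measurable ((C \<Otimes>\<^sub>M N) \<Otimes>\<^sub>M lborel)"
proof -
  let ?M = "(C \<Otimes>\<^sub>M N) \<Otimes>\<^sub>M lborel"
  have b: "snd \<in> borel_measurable ?M" using measurable_snd[of "C \<Otimes>\<^sub>M N" "lborel :: plane measure"] by simp
  have p: "(\<lambda>z. snd (fst z)) \<in> measurable ?M N" by measurable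
  have "(\<lambda>z. fst (fst z)) \<in> measurable ?M C" by measurable
  from measurable_compose[OF this ident_cone_borel[of i j, unfolded CN_fold]]
  have x: "(\<lambda>z. fst (fst z)) \<in> borel_measurable ?M" .
  have "(\<lambda>z. (snd z, snd (fst z))) \<in> measurable ?M (lborel \<Otimes>\<^sub>M N)"
    by (rule measurable_Pair) (use b p in simp_all)
  from measurable_compose[OF this, of F] F have "(\<lambda>z. F (snd z, snd (fst z))) \<in> borel_measurable ?M"
    by (simp add: haar_pair)
  moreover have "(\<lambda>z. character (fst (fst z)) (snd z)) \<in> borel_measurable ?M"
    by (rule borel_measurable_character[OF x b])
  ultimately show ?thesis by (simp add: split_beta')
qed

lemma measurable_fibre_fourier:
  assumes F: "F \<in> borel_measurable haar"
  shows "fibre_fourier F \<in> borel_measurable (C \<Otimes>\<^sub>M N)"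
proof -
  have "(\<lambda>z. \<integral>b. F (b, snd z) * character (fst z) b \<partial>lborel) \<in> borel_measurable (C \<Otimes>\<^sub>M N)"
    by (rule lborel.borel_measurable_lebesgue_integral)
      (use measurable_fibre_integrand[OF F] in \<open>simp add: split_beta'\<close>)
  then show ?thesis by (simp add: fibre_fourier_def plane_fourier_def split_beta')
qed

text \<open>The Plancherel inequality in the plane, applied for each dilation and boost separately.\<close>

lemma fibre_fourier_L2:
  assumes F: "F \<in> L2 haar"
  shows "fibre_fourier F \<in> L2 (C \<Otimes>\<^sub>M N)" and "L2_norm (C \<Otimes>\<^sub>M N) (fibre_fourier F) \<le> 2 * pi * L2_norm haar F"
proof -
  interpret CN: pair_sigma_finite C N by (rule pair_sigma_finite_CN)
  interpret LN: pair_sigma_finite lborel N by (rule pair_sigma_finite_LN)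
  have Fm: "F \<in> borel_measurable haar" by (rule L2_D[OF F])
  have m: "fibre_fourier F \<in> borel_measurable (C \<Otimes>\<^sub>M N)" by (rule measurable_fibre_fourier[OF Fm])
  have m2: "(\<lambda>z. ennreal ((cmod (fibre_fourier F z))\<^sup>2)) \<in> borel_measurable (C \<Otimes>\<^sub>M N)" using m by measurable
  have m3: "(\<lambda>z. ennreal ((cmod (F z))\<^sup>2)) \<in> borel_measurable (lborel \<Otimes>\<^sub>M N)" using Fm unfolding haar_pair by measurable
  have "(\<integral>\<^sup>+z. ennreal ((cmod (fibre_fourier F z))\<^sup>2) \<partial>(C \<Otimes>\<^sub>M N))
      = (\<integral>\<^sup>+p. \<integral>\<^sup>+x. ennreal ((cmod (fibre_fourier F (x, p)))\<^sup>2) \<partial>C \<partial>N)"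
    by (rule CN.nn_integral_snd[symmetric]) (use m2 in simp)
  also have "\<dots> \<le> (\<integral>\<^sup>+p. ennreal (4 * pi\<^sup>2) * (\<integral>\<^sup>+b. ennreal ((cmod (F (b, p)))\<^sup>2) \<partial>lborel) \<partial>N)"
  proof (rule nn_integral_mono)
    fix p assume p: "p \<in> space N"
    let ?f = "\<lambda>b. F (b, p)"
    have fm: "?f \<in> borel_measurable borel" by (rule measurable_section_translations[OF Fm p])
    have "(\<integral>\<^sup>+x. ennreal ((cmod (fibre_fourier F (x, p)))\<^sup>2) \<partial>C)
        = (\<integral>\<^sup>+x. ennreal ((cmod (plane_fourier ?f x))\<^sup>2) * indicator (cone i j) x \<partial>lborel)"
      unfolding C_def nn_integral_cone_measure by (simp add: fibre_fourier_def)
    also have "\<dots> \<le> (\<integral>\<^sup>+x. ennreal ((cmod (plane_fourier ?f x))\<^sup>2) \<partial>lborel)"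
      by (intro nn_integral_mono) (auto simp: indicator_def)
    also have "\<dots> \<le> ennreal (4 * pi\<^sup>2) * (\<integral>\<^sup>+b. ennreal ((cmod (F (b, p)))\<^sup>2) \<partial>lborel)"
      by (rule plane_Plancherel[OF fm])
    finally show "(\<integral>\<^sup>+x. ennreal ((cmod (fibre_fourier F (x, p)))\<^sup>2) \<partial>C)
      \<le> ennreal (4 * pi\<^sup>2) * (\<integral>\<^sup>+b. ennreal ((cmod (F (b, p)))\<^sup>2) \<partial>lborel)" .
  qed
  also have "\<dots> = ennreal (4 * pi\<^sup>2) * (\<integral>\<^sup>+p. \<integral>\<^sup>+b. ennreal ((cmod (F (b, p)))\<^sup>2) \<partial>lborel \<partial>N)"
    by (rule nn_integral_cmult, rule lborel.borel_measurable_nn_integral)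
      (use measurable_pair_swap[OF m3] in \<open>simp add: split_beta'\<close>)
  also have "(\<integral>\<^sup>+p. \<integral>\<^sup>+b. ennreal ((cmod (F (b, p)))\<^sup>2) \<partial>lborel \<partial>N) = (\<integral>\<^sup>+\<xi>. ennreal ((cmod (F \<xi>))\<^sup>2) \<partial>haar)"
    unfolding haar_pair by (rule LN.nn_integral_snd) (use m3 in simp)
  also have "\<dots> = ennreal ((L2_norm haar F)\<^sup>2)" by (rule L2_norm_sq_nn_integral[OF F])
  also have "ennreal (4 * pi\<^sup>2) * \<dots> = ennreal (4 * pi\<^sup>2 * (L2_norm haar F)\<^sup>2)"
    by (subst ennreal_mult) auto
  finally have *: "(\<integral>\<^sup>+z. ennreal ((cmod (fibre_fourier F z))\<^sup>2) \<partial>(C \<Otimes>\<^sub>M N)) \<le> ennreal (4 * pi\<^sup>2 * (L2_norm haar F)\<^sup>2)" .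
  show "fibre_fourier F \<in> L2 (C \<Otimes>\<^sub>M N)" by (rule L2_I_nn_integral(1)[OF m *]) simp
  have "(L2_norm (C \<Otimes>\<^sub>M N) (fibre_fourier F))\<^sup>2 \<le> 4 * pi\<^sup>2 * (L2_norm haar F)\<^sup>2"
    by (rule L2_I_nn_integral(2)[OF m *]) simp
  also have "\<dots> = (2 * pi * L2_norm haar F)\<^sup>2" by (simp add: power_mult_distrib)
  finally show "L2_norm (C \<Otimes>\<^sub>M N) (fibre_fourier F) \<le> 2 * pi * L2_norm haar F"
    by (rule power2_le_imp_le) simp
qed

lemma AE_snd_pair:
  assumes "AE p in N. P p"
  shows "AE z in C \<Otimes>\<^sub>M N. P (snd z)"
proof -
  interpret CN: pair_sigma_finite C N by (rule pair_sigma_finite_CN)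
  obtain A where A: "{p \<in> space N. \<not> P p} \<subseteq> A" "emeasure N A = 0" "A \<in> sets N"
    using assms by (rule AE_E)
  show ?thesis
  proof (rule AE_I)
    show "{z \<in> space (C \<Otimes>\<^sub>M N). \<not> P (snd z)} \<subseteq> space C \<times> A" using A(1) by (auto simp: space_pair_measure)
    show "emeasure (C \<Otimes>\<^sub>M N) (space C \<times> A) = 0"
      using A by (simp add: CN.M2.emeasure_pair_measure_Times)
    show "space C \<times> A \<in> sets (C \<Otimes>\<^sub>M N)" using A by auto
  qed
qed

lemma fibre_fourier_lincomb:
  assumes F: "integrable haar F" and G: "integrable haar G"
  shows "AE z in C \<Otimes>\<^sub>M N. fibre_fourier (\<lambda>\<xi>. c * F \<xi> + d * G \<xi>) z = c * fibre_fourier F z + d * fibre_fourier G z"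
proof -
  interpret LN: pair_sigma_finite lborel N by (rule pair_sigma_finite_LN)
  have 1: "AE p in N. integrable lborel (\<lambda>b. F (b, p))"
    by (rule LN.AE_integrable_snd) (use F in \<open>simp add: haar_pair split_beta'\<close>)
  have 2: "AE p in N. integrable lborel (\<lambda>b. G (b, p))"
    by (rule LN.AE_integrable_snd) (use G in \<open>simp add: haar_pair split_beta'\<close>)
  have "AE p in N. \<forall>x. fibre_fourier (\<lambda>\<xi>. c * F \<xi> + d * G \<xi>) (x, p) = c * fibre_fourier F (x, p) + d * fibre_fourier G (x, p)"
    using 1 2
  proof eventually_elim
    case (elim p)
    show ?case
    proof
      fix x
      have i: "integrable lborel (\<lambda>b. H b * character x b)" if "integrable lborel H" for H
        by (rule Bochner_Integration.integrable_bound[OF that])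
          (use borel_measurable_integrable[OF that] in \<open>auto simp: norm_mult\<close>)
      show "fibre_fourier (\<lambda>\<xi>. c * F \<xi> + d * G \<xi>) (x, p) = c * fibre_fourier F (x, p) + d * fibre_fourier G (x, p)"
        using i[OF elim(1)] i[OF elim(2)]
        by (simp add: fibre_fourier_def plane_fourier_def distrib_right mult.assoc)
    qed
  qed
  from AE_snd_pair[OF this] show ?thesis by (rule AE_mp) (rule AE_I2, auto)
qed

text \<open>The operators \<open>\<pi>(\<xi>)\<close> are isometric, applied to the vector \<open>D \<phi>\<close>.\<close>

lemma nn_integral_orbit_lift_sq:
  assumes p: "p \<in> space N" and \<phi>: "\<phi> \<in> borel_measurable C"
  shows "(\<integral>\<^sup>+x. ennreal ((cmod (orbit_lift \<phi> x p))\<^sup>2) \<partial>C) = (\<integral>\<^sup>+x. ennreal ((cmod (duflo_moore \<phi> x))\<^sup>2) \<partial>C)"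
proof -
  obtain a \<theta> where p': "p = (a, \<theta>)" and a: "a > 0" using p by (cases p) (auto simp: N_def)
  define k where "k y = ennreal ((cmod (duflo_moore \<phi> y))\<^sup>2) * indicator (cone i j) y" for y
  have "duflo_moore \<phi> \<in> borel_measurable C"
    using borel_measurable_duflo_moore[of \<phi> i j] \<phi> unfolding CN_fold by simp
  then have "(\<lambda>y. ennreal ((cmod (duflo_moore \<phi> y))\<^sup>2)) \<in> borel_measurable C" by measurable
  then have [measurable]: "k \<in> borel_measurable borel"
    unfolding C_def cone_measure_def k_def[abs_def]
    by (subst (asm) borel_measurable_restrict_space_iff_ennreal) simp_all
  have "(\<integral>\<^sup>+x. ennreal ((cmod (orbit_lift \<phi> x p))\<^sup>2) \<partial>C)
      = (\<integral>\<^sup>+x. ennreal (a\<^sup>2) * k (0 + a *\<^sub>R boost (- \<theta>) x) \<partial>lborel)"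
    unfolding C_def nn_integral_cone_measure
    by (intro nn_integral_cong)
      (simp add: k_def p' orbit_lift_def orbit_def norm_mult power_mult_distrib ennreal_mult mult.assoc
        indicator_def cone_dilation_boost[OF ij a])
  also have "\<dots> = ennreal (a\<^sup>2) * (\<integral>\<^sup>+x. k (0 + a *\<^sub>R boost (- \<theta>) x) \<partial>lborel)"
    by (rule nn_integral_cmult) measurable
  also have "\<dots> = (\<integral>\<^sup>+x. k x \<partial>lborel)" by (rule nn_integral_dilation_boost[symmetric]) (use a in auto)
  also have "\<dots> = (\<integral>\<^sup>+x. ennreal ((cmod (duflo_moore \<phi> x))\<^sup>2) \<partial>C)"
    unfolding C_def nn_integral_cone_measure k_def ..
  finally show ?thesis .
qed

text \<open>Since \<open>t \<le> 1 + t\<^sup>2\<close>, the integrand is dominated by \<open>|F| + |F| |\<pi>(\<xi>) D \<phi>|\<^sup>2\<close>, and the integral of the second summand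
  over \<open>\<xi>\<close> and \<open>x\<close> is \<open>\<parallel>F\<parallel>\<^sub>1 \<parallel>D \<phi>\<parallel>\<^sup>2\<close> because \<open>\<pi>(\<xi>)\<close> is isometric.\<close>

lemma AE_integrable_fourier_integrand:
  assumes F: "integrable haar F" and \<phi>: "\<phi> \<in> L2 C" and D\<phi>: "duflo_moore \<phi> \<in> L2 C"
  shows "AE x in C. integrable haar (\<lambda>\<xi>. F \<xi> * rep \<xi> (duflo_moore \<phi>) x)"
proof -
  interpret CN: pair_sigma_finite C N by (rule pair_sigma_finite_CN)
  interpret H: sigma_finite_measure haar by (rule sigma_finite_haar)
  interpret CH: pair_sigma_finite C haar
    by (intro pair_sigma_finite.intro CN.M1.sigma_finite_measure_axioms H.sigma_finite_measure_axioms)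
  have Fm: "F \<in> borel_measurable haar" using F by simp
  have sndm: "snd \<in> measurable haar N" unfolding haar_pair by simp
  have um: "(\<lambda>z. orbit_lift \<phi> (fst z) (snd (snd z))) \<in> borel_measurable (C \<Otimes>\<^sub>M haar)"
  proof -
    have "(\<lambda>z. (fst z, snd (snd z))) \<in> measurable (C \<Otimes>\<^sub>M haar) (C \<Otimes>\<^sub>M N)"
      by (rule measurable_Pair) (use measurable_compose[OF measurable_snd sndm, of C] in auto)
    from measurable_compose[OF this measurable_orbit_lift_pair[OF L2_D(1)[OF \<phi>]]]
    show ?thesis by simp
  qed
  have Fm2: "(\<lambda>z. F (snd z)) \<in> borel_measurable (C \<Otimes>\<^sub>M haar)" using Fm by measurable
  have pm: "(\<lambda>z. ennreal (cmod (F (snd z)) * (cmod (orbit_lift \<phi> (fst z) (snd (snd z))))\<^sup>2)) \<in> borel_measurable (C \<Otimes>\<^sub>M haar)"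
    using um Fm2 by measurable
  have "(\<integral>\<^sup>+x. \<integral>\<^sup>+\<xi>. ennreal (cmod (F \<xi>) * (cmod (orbit_lift \<phi> x (snd \<xi>)))\<^sup>2) \<partial>haar \<partial>C)
      = (\<integral>\<^sup>+\<xi>. \<integral>\<^sup>+x. ennreal (cmod (F \<xi>) * (cmod (orbit_lift \<phi> x (snd \<xi>)))\<^sup>2) \<partial>C \<partial>haar)"
    using CH.Fubini'[of "\<lambda>x \<xi>. ennreal (cmod (F \<xi>) * (cmod (orbit_lift \<phi> x (snd \<xi>)))\<^sup>2)"] pm
    by (simp add: split_beta')
  also have "\<dots> = (\<integral>\<^sup>+\<xi>. ennreal (cmod (F \<xi>)) * ennreal ((L2_norm C (duflo_moore \<phi>))\<^sup>2) \<partial>haar)"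
  proof (rule nn_integral_cong)
    fix \<xi> assume "\<xi> \<in> space haar"
    then have p: "snd \<xi> \<in> space N" using measurable_space[OF sndm] by simp
    have m: "(\<lambda>x. ennreal ((cmod (orbit_lift \<phi> x (snd \<xi>)))\<^sup>2)) \<in> borel_measurable C"
      using measurable_compose[OF measurable_Pair2'[OF p, of C] measurable_orbit_lift_pair[OF L2_D(1)[OF \<phi>]]]
      by simp
    have "(\<integral>\<^sup>+x. ennreal (cmod (F \<xi>) * (cmod (orbit_lift \<phi> x (snd \<xi>)))\<^sup>2) \<partial>C)
        = ennreal (cmod (F \<xi>)) * (\<integral>\<^sup>+x. ennreal ((cmod (orbit_lift \<phi> x (snd \<xi>)))\<^sup>2) \<partial>C)"
      using m by (simp add: ennreal_mult nn_integral_cmult)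
    then show "(\<integral>\<^sup>+x. ennreal (cmod (F \<xi>) * (cmod (orbit_lift \<phi> x (snd \<xi>)))\<^sup>2) \<partial>C)
        = ennreal (cmod (F \<xi>)) * ennreal ((L2_norm C (duflo_moore \<phi>))\<^sup>2)"
      by (simp only: nn_integral_orbit_lift_sq[OF p L2_D(1)[OF \<phi>]] L2_norm_sq_nn_integral[OF D\<phi>])
  qed
  also have "\<dots> = (\<integral>\<^sup>+\<xi>. ennreal (cmod (F \<xi>)) \<partial>haar) * ennreal ((L2_norm C (duflo_moore \<phi>))\<^sup>2)"
    by (rule nn_integral_multc) (use Fm in measurable)
  also have "\<dots> < \<infinity>"
    using F by (simp add: integrable_iff_bounded ennreal_mult_less_top)
  finally have "AE x in C. (\<integral>\<^sup>+\<xi>. ennreal (cmod (F \<xi>) * (cmod (orbit_lift \<phi> x (snd \<xi>)))\<^sup>2) \<partial>haar) \<noteq> \<infinity>"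
    by (intro nn_integral_PInf_AE H.borel_measurable_nn_integral) (use pm in \<open>auto simp: split_beta'\<close>)
  then show ?thesis
    using AE_space
  proof eventually_elim
    case (elim x)
    have x: "(\<lambda>\<xi>. (x, \<xi>)) \<in> measurable haar (C \<Otimes>\<^sub>M haar)" by (rule measurable_Pair1'[OF elim(2)])
    have um': "(\<lambda>\<xi>. orbit_lift \<phi> x (snd \<xi>)) \<in> borel_measurable haar" using measurable_compose[OF x um] by simp
    have cm: "(\<lambda>\<xi>. character x (fst \<xi>)) \<in> borel_measurable haar"
      by (rule borel_measurable_haar) measurable
    have i: "integrable haar (\<lambda>\<xi>. cmod (F \<xi>) + cmod (F \<xi>) * (cmod (orbit_lift \<phi> x (snd \<xi>)))\<^sup>2)"
    proof (rule Bochner_Integration.integrable_add)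
      show "integrable haar (\<lambda>\<xi>. cmod (F \<xi>))" using F by simp
      show "integrable haar (\<lambda>\<xi>. cmod (F \<xi>) * (cmod (orbit_lift \<phi> x (snd \<xi>)))\<^sup>2)"
        unfolding integrable_iff_bounded using elim(1) Fm um' by (auto simp: top.not_eq_extremum)
    qed
    have "integrable haar (\<lambda>\<xi>. F \<xi> * (character x (fst \<xi>) * orbit_lift \<phi> x (snd \<xi>)))"
    proof (rule Bochner_Integration.integrable_bound[OF i])
      show "(\<lambda>\<xi>. F \<xi> * (character x (fst \<xi>) * orbit_lift \<phi> x (snd \<xi>))) \<in> borel_measurable haar"
        using Fm cm um' by measurable
      have "cmod (F \<xi> * (character x (fst \<xi>) * orbit_lift \<phi> x (snd \<xi>)))
          \<le> cmod (F \<xi>) + cmod (F \<xi>) * (cmod (orbit_lift \<phi> x (snd \<xi>)))\<^sup>2" for \<xi>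
      proof -
        have "t \<le> 1 + t\<^sup>2" if "0 \<le> t" for t :: real
          using sum_squares_bound[of t 1] that by (simp add: power2_eq_square)
        from mult_left_mono[OF this[OF norm_ge_zero[of "orbit_lift \<phi> x (snd \<xi>)"]] norm_ge_zero[of "F \<xi>"]]
        show ?thesis by (simp add: norm_mult distrib_left)
      qed
      then show "AE \<xi> in haar. norm (F \<xi> * (character x (fst \<xi>) * orbit_lift \<phi> x (snd \<xi>)))
          \<le> norm (cmod (F \<xi>) + cmod (F \<xi>) * (cmod (orbit_lift \<phi> x (snd \<xi>)))\<^sup>2)"
        by (intro AE_I2) (simp add: abs_of_nonneg)
    qed
    moreover have "F \<xi> * (character x (fst \<xi>) * orbit_lift \<phi> x (snd \<xi>)) = F \<xi> * rep \<xi> (duflo_moore \<phi>) x" for \<xi>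
      by (cases \<xi>) (simp add: rep_duflo_moore)
    ultimately show ?case by simp
  qed
qed

text \<open>Fubini's theorem: the translations are integrated first.\<close>

lemma kernel_op_fourier_L1_L2:
  assumes F: "integrable haar F" "F \<in> L2 haar"
  shows "is_fourier_L1_L2 i j F (kernel_op (fibre_fourier F))"
  unfolding is_fourier_L1_L2_def CN_fold
proof (intro conjI ballI impI F kernel_op_hilbert_schmidt(1) fibre_fourier_L2(1))
  interpret LN: pair_sigma_finite lborel N by (rule pair_sigma_finite_LN)
  fix \<phi> assume \<phi>: "\<phi> \<in> L2 C" "duflo_moore \<phi> \<in> L2 C"
  show "AE x in C. integrable haar (\<lambda>\<xi>. F \<xi> * rep \<xi> (duflo_moore \<phi>) x) \<and>
      kernel_op (fibre_fourier F) \<phi> x = (\<integral>\<xi>. F \<xi> * rep \<xi> (duflo_moore \<phi>) x \<partial>haar)"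
    using AE_integrable_fourier_integrand[OF F(1) \<phi>]
  proof eventually_elim
    case (elim x)
    let ?h = "\<lambda>b p. F (b, p) * rep (b, p) (duflo_moore \<phi>) x"
    have "(\<integral>\<xi>. F \<xi> * rep \<xi> (duflo_moore \<phi>) x \<partial>haar) = (\<integral>p. \<integral>b. ?h b p \<partial>lborel \<partial>N)"
      using LN.integral_snd[of ?h] elim by (simp add: haar_pair split_beta')
    also have "\<dots> = (\<integral>p. fibre_fourier F (x, p) * orbit_lift \<phi> x p \<partial>N)"
      by (simp add: rep_duflo_moore fibre_fourier_def plane_fourier_def mult.assoc[symmetric])
    finally show ?case using elim by (simp add: kernel_op_def N_def)
  qed
qed

text \<open>The defining formula determines the transform on the domain of the Duflo--Moore operator, and that domain is dense.\<close>

lemma fourier_L1_L2_unique: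
  assumes T: "is_fourier_L1_L2 i j F T" and \<phi>: "\<phi> \<in> L2 C"
  shows "AE x in C. T \<phi> x = kernel_op (fibre_fourier F) \<phi> x"
proof -
  have F: "integrable haar F" "F \<in> L2 haar" and TB: "L2_bounded_operator C T"
    using T by (auto simp: is_fourier_L1_L2_def CN_fold hilbert_schmidt_def)
  let ?K = "kernel_op (fibre_fourier F)"
  have K: "is_fourier_L1_L2 i j F ?K" by (rule kernel_op_fourier_L1_L2[OF F])
  have KB: "L2_bounded_operator C ?K" by (rule kernel_op_bounded[OF fibre_fourier_L2(1)[OF F(2)]])
  obtain \<psi> where \<psi>: "\<And>n::nat. \<psi> n \<in> L2 C" and D\<psi>: "\<And>n. duflo_moore (\<psi> n) \<in> L2 C"
    and lim: "(\<lambda>n. L2_norm C (\<lambda>x. \<psi> n x - \<phi> x)) \<longlonglongrightarrow> 0"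
    using duflo_moore_domain_dense[of \<phi> i j] \<phi> unfolding CN_fold by blast
  have eq: "AE x in C. T (\<psi> n) x = ?K (\<psi> n) x" for n
  proof -
    have "AE x in C. T (\<psi> n) x = (\<integral>\<xi>. F \<xi> * rep \<xi> (duflo_moore (\<psi> n)) x \<partial>haar)"
      using T \<psi>[of n] D\<psi>[of n] unfolding is_fourier_L1_L2_def CN_fold by (auto elim!: AE_mp)
    moreover have "AE x in C. ?K (\<psi> n) x = (\<integral>\<xi>. F \<xi> * rep \<xi> (duflo_moore (\<psi> n)) x \<partial>haar)"
      using K \<psi>[of n] D\<psi>[of n] unfolding is_fourier_L1_L2_def CN_fold by (auto elim!: AE_mp)
    ultimately show ?thesis by eventually_elim simp
  qed
  note TL = L2_bounded_operator_L2[OF TB] and KL = L2_bounded_operator_L2[OF KB]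
  have "L2_norm C (\<lambda>x. T \<phi> x - ?K \<phi> x) \<le> L2_norm C (\<lambda>x. T (\<psi> n) x - T \<phi> x) + L2_norm C (\<lambda>x. ?K (\<psi> n) x - ?K \<phi> x)" for n
  proof -
    have "L2_norm C (\<lambda>x. T (\<psi> n) x - ?K \<phi> x) = L2_norm C (\<lambda>x. ?K (\<psi> n) x - ?K \<phi> x)"
      by (rule L2_norm_cong_AE) (use eq[of n] TL KL \<psi> \<phi> in \<open>auto intro!: L2_D(1)[OF L2_diff]\<close>)
    then show ?thesis
      using L2_norm_diff_triangle[OF TL[OF \<phi>] TL[OF \<psi>] KL[OF \<phi>], of n] L2_norm_diff_commute[of C "T \<phi>"] by simp
  qed
  note le = this
  have "(\<lambda>n. L2_norm C (\<lambda>x. T (\<psi> n) x - T \<phi> x) + L2_norm C (\<lambda>x. ?K (\<psi> n) x - ?K \<phi> x)) \<longlonglongrightarrow> 0 + 0"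
    by (intro tendsto_add L2_bounded_operator_tendsto[OF TB \<psi> \<phi> lim] L2_bounded_operator_tendsto[OF KB \<psi> \<phi> lim])
  then have "L2_norm C (\<lambda>x. T \<phi> x - ?K \<phi> x) \<le> 0 + 0"
    by (rule LIMSEQ_le_const) (use le in blast)
  then have "L2_norm C (\<lambda>x. T \<phi> x - ?K \<phi> x) = 0" using L2_norm_nonneg[of C "\<lambda>x. T \<phi> x - ?K \<phi> x"] by linarith
  then show ?thesis
    using L2_norm_eq_0_iff[OF L2_diff[OF TL[OF \<phi>] KL[OF \<phi>]]] by simp
qed

text \<open>Cutting off to \<open>|F| > 1 / n\<close> makes \<open>F\<close> integrable, since \<open>|F| \<le> n |F|\<^sup>2\<close> there.\<close>

lemma L1_L2_cutoffs:
  assumes F: "F \<in> L2 haar"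
  shows "\<exists>Fn. (\<forall>n::nat. integrable haar (Fn n) \<and> Fn n \<in> L2 haar) \<and> (\<lambda>n. L2_norm haar (\<lambda>\<xi>. Fn n \<xi> - F \<xi>)) \<longlonglongrightarrow> 0"
proof -
  have Fm [measurable]: "F \<in> borel_measurable haar" by (rule L2_D[OF F])
  define A where "A n = {\<xi> \<in> space haar. cmod (F \<xi>) > 1 / real (Suc n)}" for n
  have A [measurable]: "A n \<in> sets haar" for n unfolding A_def by measurable
  define Fn where "Fn n \<xi> = indicator (A n) \<xi> * F \<xi>" for n \<xi>
  have Fnm: "Fn n \<in> borel_measurable haar" for n unfolding Fn_def by measurable
  have L: "Fn n \<in> L2 haar" for n
    by (rule L2_dominated[OF F Fnm]) (auto simp: Fn_def indicator_def)
  have I: "integrable haar (Fn n)" for n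
  proof (rule Bochner_Integration.integrable_bound)
    show "integrable haar (\<lambda>\<xi>. real (Suc n) * (cmod (F \<xi>))\<^sup>2)" using L2_D(2)[OF F] by simp
    have "cmod (Fn n \<xi>) \<le> real (Suc n) * (cmod (F \<xi>))\<^sup>2" for \<xi>
    proof (cases "\<xi> \<in> A n")
      case True
      then have "1 \<le> real (Suc n) * cmod (F \<xi>)" by (simp add: A_def field_simps)
      from mult_right_mono[OF this norm_ge_zero[of "F \<xi>"]] True
      show ?thesis by (simp add: Fn_def power2_eq_square mult.assoc)
    qed (simp add: Fn_def)
    then show "AE \<xi> in haar. norm (Fn n \<xi>) \<le> norm (real (Suc n) * (cmod (F \<xi>))\<^sup>2)"
      by (intro AE_I2) (simp add: abs_of_nonneg)
  qed (rule Fnm)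
  have "(\<lambda>n. L2_norm haar (\<lambda>\<xi>. Fn n \<xi> - F \<xi>)) \<longlonglongrightarrow> 0"
    unfolding Fn_def
  proof (rule L2_cutoff_tendsto[OF F A])
    fix \<xi> assume \<xi>: "\<xi> \<in> space haar" "F \<xi> \<noteq> 0"
    then obtain m where m: "1 / real (Suc m) < cmod (F \<xi>)"
      using reals_Archimedean[of "cmod (F \<xi>)"] by (auto simp: inverse_eq_divide)
    show "\<forall>\<^sub>F n in sequentially. \<xi> \<in> A n"
      using eventually_ge_at_top[of m]
    proof eventually_elim
      case (elim n)
      have "1 / real (Suc n) \<le> 1 / real (Suc m)" using elim by (intro divide_left_mono) auto
      then show ?case using m \<xi> by (simp add: A_def)
    qed
  qed
  then show ?thesis using L I by blast
qed

text \<open>The kernels of the cut-offs form a Cauchy sequence; the operator with the limit kernel is the transform.\<close>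

lemma fourier_exists:
  assumes F: "F \<in> L2 haar"
  shows "\<exists>T. is_fourier i j F T"
proof -
  obtain Fn where I: "\<And>n::nat. integrable haar (Fn n)" and L: "\<And>n. Fn n \<in> L2 haar"
    and lim: "(\<lambda>n. L2_norm haar (\<lambda>\<xi>. Fn n \<xi> - F \<xi>)) \<longlonglongrightarrow> 0"
    using L1_L2_cutoffs[OF F] by blast
  let ?P = "C \<Otimes>\<^sub>M N"
  define G where "G n = fibre_fourier (Fn n)" for n
  have GL: "G n \<in> L2 ?P" for n unfolding G_def by (rule fibre_fourier_L2(1)[OF L])
  have dist: "L2_norm ?P (\<lambda>z. G n z - G m z) \<le> 2 * pi * L2_norm haar (\<lambda>\<xi>. Fn n \<xi> - Fn m \<xi>)" for n m
  proof -
    have d: "(\<lambda>\<xi>. Fn n \<xi> - Fn m \<xi>) \<in> L2 haar" by (rule L2_diff[OF L L])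
    have "L2_norm ?P (\<lambda>z. G n z - G m z) = L2_norm ?P (fibre_fourier (\<lambda>\<xi>. Fn n \<xi> - Fn m \<xi>))"
      by (rule L2_norm_cong_AE)
        (use fibre_fourier_lincomb[OF I I, of 1 n "-1" m] L2_D(1)[OF L2_diff[OF GL GL]] L2_D(1)[OF fibre_fourier_L2(1)[OF d]]
          in \<open>auto simp: G_def elim!: AE_mp\<close>)
    then show ?thesis using fibre_fourier_L2(2)[OF d] by simp
  qed
  have "\<exists>g\<in>L2 ?P. (\<lambda>n. L2_norm ?P (\<lambda>z. G n z - g z)) \<longlonglongrightarrow> 0"
  proof (rule L2_complete[OF GL])
    fix e :: real assume e: "e > 0"
    then have "e / (4 * pi) > 0" by simp
    from LIMSEQ_D[OF lim this] obtain n0 where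
      n0: "\<And>n. n \<ge> n0 \<Longrightarrow> L2_norm haar (\<lambda>\<xi>. Fn n \<xi> - F \<xi>) < e / (4 * pi)" by auto
    show "\<exists>n0. \<forall>m\<ge>n0. \<forall>n\<ge>n0. L2_norm ?P (\<lambda>z. G m z - G n z) < e"
    proof (intro exI allI impI)
      fix m n assume mn: "m \<ge> n0" "n \<ge> n0"
      have "L2_norm haar (\<lambda>\<xi>. Fn m \<xi> - Fn n \<xi>) < e / (4 * pi) + e / (4 * pi)"
        using L2_norm_diff_triangle[OF L[of m] F L[of n]] n0[OF mn(1)] n0[OF mn(2)]
          L2_norm_diff_commute[of haar F "Fn n"] by linarith
      then have "2 * pi * L2_norm haar (\<lambda>\<xi>. Fn m \<xi> - Fn n \<xi>) < e" by (simp add: field_simps)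
      then show "L2_norm ?P (\<lambda>z. G m z - G n z) < e" using dist[of m n] by linarith
    qed
  qed
  then obtain g where g: "g \<in> L2 ?P" and Gg: "(\<lambda>n. L2_norm ?P (\<lambda>z. G n z - g z)) \<longlonglongrightarrow> 0" by blast
  have "is_fourier i j F (kernel_op g)"
    unfolding is_fourier_def CN_fold
  proof (intro conjI exI allI)
    show "F \<in> L2 haar" by fact
    show "hilbert_schmidt C (kernel_op g)" by (rule kernel_op_hilbert_schmidt(1)[OF g])
    show "is_fourier_L1_L2 i j (Fn n) (kernel_op (G n))" for n
      unfolding G_def by (rule kernel_op_fourier_L1_L2[OF I L])
    show "(\<lambda>n. L2_norm haar (\<lambda>\<xi>. Fn n \<xi> - F \<xi>)) \<longlonglongrightarrow> 0" by fact
    show "(\<lambda>n. hs_norm C (\<lambda>\<phi> x. kernel_op (G n) \<phi> x - kernel_op g \<phi> x)) \<longlonglongrightarrow> 0"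
    proof (rule Lim_null_comparison)
      show "(\<lambda>n. L2_norm ?P (\<lambda>z. G n z - g z) / (2 * pi)) \<longlonglongrightarrow> 0"
        using tendsto_divide[OF Gg tendsto_const[of "2 * pi"]] by simp
      have "hs_norm C (\<lambda>\<phi> x. kernel_op (G n) \<phi> x - kernel_op g \<phi> x) = hs_norm C (kernel_op (\<lambda>z. G n z - g z))" for n
      proof -
        have "L2_norm C (\<lambda>x. kernel_op (G n) (some_basis C k) x - kernel_op g (some_basis C k) x)
            = L2_norm C (kernel_op (\<lambda>z. G n z - g z) (some_basis C k))" for k
          by (rule L2_norm_cong_AE)
            (use kernel_op_lincomb_kernel[OF GL g basis_C_L2, of 1 n "-1" k] in
              \<open>auto intro!: L2_D(1)[OF L2_diff] L2_D(1)[OF kernel_op_L2(1)] kernel_op_L2(1) L2_diff GL g basis_C_L2 elim!: AE_mp\<close>)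
        then show ?thesis by (simp add: hs_norm_def)
      qed
      then have "norm (hs_norm C (\<lambda>\<phi> x. kernel_op (G n) \<phi> x - kernel_op g \<phi> x)) \<le> L2_norm ?P (\<lambda>z. G n z - g z) / (2 * pi)" for n
        using kernel_op_hilbert_schmidt(2)[OF L2_diff[OF GL g], of n] hs_norm_nonneg[OF kernel_op_hilbert_schmidt(1)[OF L2_diff[OF GL g]], of n] by simp
      then show "\<forall>\<^sub>F n in sequentially. norm (hs_norm C (\<lambda>\<phi> x. kernel_op (G n) \<phi> x - kernel_op g \<phi> x))
          \<le> L2_norm ?P (\<lambda>z. G n z - g z) / (2 * pi)" by simp
    qed
  qed
  then show ?thesis by blast
qed

lemma hs_summable_diff:
  assumes S: "hilbert_schmidt C S" and T: "hilbert_schmidt C T"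
  shows "summable (\<lambda>n. (L2_norm C (\<lambda>x. S (some_basis C n) x - T (some_basis C n) x))\<^sup>2)"
proof (rule summable_comparison_test')
  show "summable (\<lambda>n. 2 * (L2_norm C (S (some_basis C n)))\<^sup>2 + 2 * (L2_norm C (T (some_basis C n)))\<^sup>2)"
    using S T by (intro summable_add summable_mult) (auto simp: hilbert_schmidt_def)
  note SL = hilbert_schmidt_basis_L2[OF S] and TL = hilbert_schmidt_basis_L2[OF T]
  show "norm ((L2_norm C (\<lambda>x. S (some_basis C n) x - T (some_basis C n) x))\<^sup>2)
      \<le> 2 * (L2_norm C (S (some_basis C n)))\<^sup>2 + 2 * (L2_norm C (T (some_basis C n)))\<^sup>2" if "n \<ge> 0" for n
  proof -
    have "(\<lambda>x. (S (some_basis C n) x - T (some_basis C n) x) - S (some_basis C n) x) = (\<lambda>x. - 1 * T (some_basis C n) x)"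
      by auto
    then have "L2_norm C (\<lambda>x. (S (some_basis C n) x - T (some_basis C n) x) - S (some_basis C n) x) = L2_norm C (T (some_basis C n))"
      by (simp only: L2_norm_cmult) simp
    then show ?thesis
      using L2_norm_sq_le_double[OF L2_diff[OF SL[of n] TL[of n]] SL[of n]] by simp
  qed
qed

text \<open>Every admissible transform is a limit of explicit kernel operators on the basis vectors.  The norm bound
  and the matrix coefficients of the transform chosen in \<open>group_fourier\<close> are both read off from these limits.\<close>

lemma fourier_basis_limit:
  assumes T: "is_fourier i j F T"
  shows "\<exists>Fn. (\<forall>k::nat. integrable haar (Fn k) \<and> Fn k \<in> L2 haar) \<and> (\<lambda>k. L2_norm haar (\<lambda>\<xi>. Fn k \<xi> - F \<xi>)) \<longlonglongrightarrow> 0 \<and>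
    (\<forall>n. (\<lambda>k. L2_norm C (\<lambda>x. kernel_op (fibre_fourier (Fn k)) (some_basis C n) x - T (some_basis C n) x)) \<longlonglongrightarrow> 0)"
proof -
  obtain Fn Tn where HS: "hilbert_schmidt C T"
    and n: "\<And>k::nat. is_fourier_L1_L2 i j (Fn k) (Tn k)"
    and lim: "(\<lambda>k. L2_norm haar (\<lambda>\<xi>. Fn k \<xi> - F \<xi>)) \<longlonglongrightarrow> 0"
    and limT: "(\<lambda>k. hs_norm C (\<lambda>\<phi> x. Tn k \<phi> x - T \<phi> x)) \<longlonglongrightarrow> 0"
    using T unfolding is_fourier_def CN_fold by blast
  have HSn: "hilbert_schmidt C (Tn k)" and Fn: "integrable haar (Fn k)" "Fn k \<in> L2 haar" for k
    using n[of k] by (auto simp: is_fourier_L1_L2_def CN_fold)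
  have "(\<lambda>k. L2_norm C (\<lambda>x. kernel_op (fibre_fourier (Fn k)) (some_basis C n) x - T (some_basis C n) x)) \<longlonglongrightarrow> 0" for n
  proof (rule Lim_null_comparison[OF _ limT], intro always_eventually allI)
    fix k
    let ?e = "some_basis C n"
    note TL = hilbert_schmidt_basis_L2[OF HS, of n] and TnL = hilbert_schmidt_basis_L2[OF HSn, of k n]
      and KL = kernel_op_L2(1)[OF fibre_fourier_L2(1)[OF Fn(2)[of k]] basis_C_L2[of n]]
    have "L2_norm C (\<lambda>x. kernel_op (fibre_fourier (Fn k)) ?e x - T ?e x) = L2_norm C (\<lambda>x. Tn k ?e x - T ?e x)"
      by (rule L2_norm_cong_AE[OF L2_D(1)[OF L2_diff[OF KL TL]] L2_D(1)[OF L2_diff[OF TnL TL]]])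
        (use fourier_L1_L2_unique[OF n basis_C_L2, of k n] in eventually_elim, simp)
    also have "\<dots> \<le> hs_norm C (\<lambda>\<phi> x. Tn k \<phi> x - T \<phi> x)"
      using sum_le_suminf[OF hs_summable_diff[OF HSn[of k] HS], of "{n}"]
      unfolding hs_norm_def by (intro real_le_rsqrt) simp
    finally show "norm (L2_norm C (\<lambda>x. kernel_op (fibre_fourier (Fn k)) ?e x - T ?e x)) \<le> hs_norm C (\<lambda>\<phi> x. Tn k \<phi> x - T \<phi> x)"
      by simp
  qed
  then show ?thesis using Fn lim by blast
qed

text \<open>The bound for integrable functions passes to the limit in each finite partial sum of the Hilbert--Schmidt norm.\<close>

lemma fourier_hs_norm_le:
  assumes T: "is_fourier i j F T"
  shows "hs_norm C T \<le> L2_norm haar F"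
proof -
  have F: "F \<in> L2 haar" and HS: "hilbert_schmidt C T" using T by (auto simp: is_fourier_def CN_fold)
  obtain Fn where Fn: "\<And>k::nat. Fn k \<in> L2 haar"
    and lim: "(\<lambda>k. L2_norm haar (\<lambda>\<xi>. Fn k \<xi> - F \<xi>)) \<longlonglongrightarrow> 0"
    and limT: "\<And>n. (\<lambda>k. L2_norm C (\<lambda>x. kernel_op (fibre_fourier (Fn k)) (some_basis C n) x - T (some_basis C n) x)) \<longlonglongrightarrow> 0"
    using fourier_basis_limit[OF T] by blast
  let ?K = "\<lambda>k. kernel_op (fibre_fourier (Fn k))"
  have "(\<Sum>n<m. (L2_norm C (T (some_basis C n)))\<^sup>2) \<le> (L2_norm haar F)\<^sup>2" for m
  proof (rule LIMSEQ_le)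
    show "(\<lambda>k. \<Sum>n<m. (L2_norm C (?K k (some_basis C n)))\<^sup>2) \<longlonglongrightarrow> (\<Sum>n<m. (L2_norm C (T (some_basis C n)))\<^sup>2)"
      by (intro tendsto_sum tendsto_power L2_norm_tendsto[OF _ hilbert_schmidt_basis_L2[OF HS] limT]
          kernel_op_L2(1) fibre_fourier_L2(1) Fn basis_C_L2)
    show "(\<lambda>k. (L2_norm haar (Fn k))\<^sup>2) \<longlonglongrightarrow> (L2_norm haar F)\<^sup>2"
      by (intro tendsto_power L2_norm_tendsto[OF Fn F lim])
    show "\<exists>k0. \<forall>k\<ge>k0. (\<Sum>n<m. (L2_norm C (?K k (some_basis C n)))\<^sup>2) \<le> (L2_norm haar (Fn k))\<^sup>2"
    proof (intro exI allI impI)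
      fix k
      note G = fibre_fourier_L2[OF Fn[of k]]
      have s: "summable (\<lambda>n. (L2_norm C (?K k (some_basis C n)))\<^sup>2)"
        using kernel_op_hilbert_schmidt(1)[OF G(1)] by (simp add: hilbert_schmidt_def)
      have "(\<Sum>n<m. (L2_norm C (?K k (some_basis C n)))\<^sup>2) \<le> (hs_norm C (?K k))\<^sup>2"
        using sum_le_suminf[OF s, of "{..<m}"] by (simp add: hs_norm_def suminf_nonneg s)
      also have "\<dots> \<le> (L2_norm haar (Fn k))\<^sup>2"
      proof (rule power_mono)
        have "hs_norm C (?K k) \<le> L2_norm (C \<Otimes>\<^sub>M N) (fibre_fourier (Fn k)) / (2 * pi)"
          by (rule kernel_op_hilbert_schmidt(2)[OF G(1)])
        also have "\<dots> \<le> 2 * pi * L2_norm haar (Fn k) / (2 * pi)" by (intro divide_right_mono G(2)) simp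
        finally show "hs_norm C (?K k) \<le> L2_norm haar (Fn k)" by simp
      qed (rule hs_norm_nonneg[OF kernel_op_hilbert_schmidt(1)[OF G(1)]])
      finally show "(\<Sum>n<m. (L2_norm C (?K k (some_basis C n)))\<^sup>2) \<le> (L2_norm haar (Fn k))\<^sup>2" .
    qed
  qed
  then have "(\<Sum>n. (L2_norm C (T (some_basis C n)))\<^sup>2) \<le> (L2_norm haar F)\<^sup>2"
    using HS by (intro suminf_le_const) (auto simp: hilbert_schmidt_def)
  then show ?thesis unfolding hs_norm_def by (intro real_le_lsqrt) auto
qed

text \<open>On the dense subspace of integrable functions a matrix coefficient of the explicit kernel operator is a bounded linear
  functional, which the Riesz theorem represents; the representation extends by continuity.\<close>

lemma fourier_matrix_coeff:
  "\<exists>K\<in>L2 haar. \<forall>F T. is_fourier i j F T \<longrightarrow> matrix_coeff C T n m = (\<integral>\<xi>. F \<xi> * K \<xi> \<partial>haar)"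
proof -
  let ?e = "some_basis C n" and ?f = "some_basis C m"
  define V where "V = {F \<in> L2 haar. integrable haar F}"
  define \<Phi> where "\<Phi> F = L2_inner C (kernel_op (fibre_fourier F) ?e) ?f" for F
  have eL: "?e \<in> L2 C" and fL: "?f \<in> L2 C" by (rule basis_C_L2)+
  have norm1: "L2_norm C (some_basis C k) = 1" for k
  proof -
    have "complex_of_real ((L2_norm C (some_basis C k))\<^sup>2) = 1"
      using orthonormal_family_inner[OF orthonormal_basis_family[OF basis_C, of UNIV], of k k] unfolding L2_inner_self by simp
    then have "(L2_norm C (some_basis C k))\<^sup>2 = 1\<^sup>2" unfolding of_real_eq_1_iff by simp
    then show ?thesis by (rule power2_eq_imp_eq) auto
  qed
  have KL: "kernel_op (fibre_fourier F) ?e \<in> L2 C" if "F \<in> V" for F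
    using that by (intro kernel_op_L2(1) fibre_fourier_L2(1) eL) (simp add: V_def)
  have "\<exists>h\<in>L2 haar. \<forall>F\<in>V. \<Phi> F = L2_inner haar F h"
  proof (rule L2_Riesz_representation)
    show "V \<subseteq> L2 haar" by (auto simp: V_def)
    show "(\<lambda>x. 0) \<in> V" by (simp add: V_def)
    show lc: "(\<lambda>x. c * f x + d * g x) \<in> V" if "f \<in> V" "g \<in> V" for f g c d
      using that by (auto simp: V_def L2_lincomb)
    show "\<Phi> (\<lambda>x. c * f x + d * g x) = c * \<Phi> f + d * \<Phi> g" if fg: "f \<in> V" "g \<in> V" for f g c d
    proof -
      let ?h = "\<lambda>x. c * f x + d * g x"
      have f: "f \<in> L2 haar" "integrable haar f" and g: "g \<in> L2 haar" "integrable haar g" using fg by (auto simp: V_def)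
      have h: "?h \<in> L2 haar" using lc[OF fg] by (simp add: V_def)
      note ff = fibre_fourier_L2(1)[OF f(1)] and gg = fibre_fourier_L2(1)[OF g(1)] and hh = fibre_fourier_L2(1)[OF h]
      have "AE x in C. kernel_op (fibre_fourier ?h) ?e x = kernel_op (\<lambda>z. c * fibre_fourier f z + d * fibre_fourier g z) ?e x"
        by (rule kernel_op_cong_AE[OF L2_D(1)[OF hh] L2_D(1)[OF L2_lincomb[OF ff gg]] L2_D(1)[OF eL] fibre_fourier_lincomb[OF f(2) g(2)]])
      moreover have "AE x in C. kernel_op (\<lambda>z. c * fibre_fourier f z + d * fibre_fourier g z) ?e x
          = c * kernel_op (fibre_fourier f) ?e x + d * kernel_op (fibre_fourier g) ?e x"
        by (rule kernel_op_lincomb_kernel[OF ff gg eL])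
      ultimately have eq: "AE x in C. kernel_op (fibre_fourier ?h) ?e x
          = c * kernel_op (fibre_fourier f) ?e x + d * kernel_op (fibre_fourier g) ?e x"
        by eventually_elim simp
      have "\<Phi> ?h = L2_inner C (\<lambda>x. c * kernel_op (fibre_fourier f) ?e x + d * kernel_op (fibre_fourier g) ?e x) ?f"
        unfolding \<Phi>_def
        by (rule L2_inner_cong_AE[OF L2_D(1)[OF kernel_op_L2(1)[OF hh eL]] L2_D(1)[OF L2_lincomb[OF KL[OF fg(1)] KL[OF fg(2)]]]
              L2_D(1)[OF fL] L2_D(1)[OF fL] eq]) simp
      also have "\<dots> = c * \<Phi> f + d * \<Phi> g"
        unfolding \<Phi>_def by (rule L2_inner_lincomb_left[OF KL[OF fg(1)] KL[OF fg(2)] fL])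
      finally show ?thesis .
    qed
    show "cmod (\<Phi> f) \<le> 1 * L2_norm haar f" if f: "f \<in> V" for f
    proof -
      have fL2: "f \<in> L2 haar" using f by (simp add: V_def)
      have "cmod (\<Phi> f) \<le> L2_norm C (kernel_op (fibre_fourier f) ?e) * L2_norm C ?f"
        unfolding \<Phi>_def by (rule L2_Cauchy_Schwarz[OF KL[OF f] fL])
      also have "\<dots> \<le> L2_norm (C \<Otimes>\<^sub>M N) (fibre_fourier f) / (2 * pi)"
        using kernel_op_L2(2)[OF fibre_fourier_L2(1)[OF fL2] eL] by (simp add: norm1)
      also have "\<dots> \<le> L2_norm haar f" using fibre_fourier_L2(2)[OF fL2] by (simp add: field_simps)
      finally show ?thesis by simp
    qed
  qed
  then obtain h where h: "h \<in> L2 haar" and rep: "\<And>F. F \<in> V \<Longrightarrow> \<Phi> F = L2_inner haar F h" by blast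
  have "matrix_coeff C T n m = (\<integral>\<xi>. F \<xi> * cnj (h \<xi>) \<partial>haar)" if T: "is_fourier i j F T" for F T
  proof -
    have F: "F \<in> L2 haar" and HS: "hilbert_schmidt C T" using T by (auto simp: is_fourier_def CN_fold)
    obtain Fn where Fn: "\<And>k::nat. Fn k \<in> L2 haar" and FV: "\<And>k. Fn k \<in> V"
      and lim: "(\<lambda>k. L2_norm haar (\<lambda>\<xi>. Fn k \<xi> - F \<xi>)) \<longlonglongrightarrow> 0"
      and limT: "(\<lambda>k. L2_norm C (\<lambda>x. kernel_op (fibre_fourier (Fn k)) ?e x - T ?e x)) \<longlonglongrightarrow> 0"
      using fourier_basis_limit[OF T] unfolding V_def by blast
    have "(\<lambda>k. \<Phi> (Fn k)) \<longlonglongrightarrow> L2_inner C (T ?e) ?f"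
      unfolding \<Phi>_def by (rule L2_inner_tendsto[OF KL[OF FV] hilbert_schmidt_basis_L2[OF HS] fL limT])
    moreover have "(\<lambda>k. \<Phi> (Fn k)) \<longlonglongrightarrow> L2_inner haar F h"
      unfolding rep[OF FV] by (rule L2_inner_tendsto[OF Fn F h lim])
    ultimately have "L2_inner C (T ?e) ?f = L2_inner haar F h" by (rule LIMSEQ_unique)
    then show ?thesis by (simp add: matrix_coeff_def L2_inner_def)
  qed
  then show ?thesis by (intro bexI[OF _ L2_cnj[OF h]] allI impI)
qed

lemma group_fourier_is_fourier:
  assumes "F \<in> L2 haar"
  shows "is_fourier i j F (group_fourier i j F)"
  unfolding group_fourier_def if_P[OF assms] by (rule someI_ex[OF fourier_exists[OF assms]])

end

section \<open>The Wigner transform\<close>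

definition wigner_function :: "(poincare \<Rightarrow> complex) \<Rightarrow> (poincare \<Rightarrow> complex) \<Rightarrow> poincare \<Rightarrow> poincare \<Rightarrow> complex" where
  "wigner_function f g w \<xi> = f (psqrt \<xi> \<star> w) * cnj (g (pinv w \<star> psqrt \<xi>))"

lemma wigner_eq: "wigner f g w i j = group_fourier i j (wigner_function f g w)"
  by (simp add: wigner_def wigner_function_def[abs_def])

lemma measurable_wigner_function:
  assumes f: "f \<in> borel_measurable haar" and g: "g \<in> borel_measurable haar"
  shows "(\<lambda>(w, \<xi>). wigner_function f g w \<xi>) \<in> borel_measurable (haar \<Otimes>\<^sub>M haar)"
proof -
  have 1: "(\<lambda>z. f (case z of (w, \<xi>) \<Rightarrow> psqrt \<xi> \<star> w)) \<in> borel_measurable (haar \<Otimes>\<^sub>M haar)"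
    by (rule measurable_compose[OF measurable_sqrt_translates(1) f])
  have 2: "(\<lambda>z. g (case z of (w, \<xi>) \<Rightarrow> pinv w \<star> psqrt \<xi>)) \<in> borel_measurable (haar \<Otimes>\<^sub>M haar)"
    by (rule measurable_compose[OF measurable_sqrt_translates(2) g])
  show ?thesis
    using borel_measurable_times[OF 1 borel_measurable_cnj[OF 2]] by (simp add: wigner_function_def split_beta')
qed

lemma measurable_wigner_section:
  assumes "f \<in> borel_measurable haar" "g \<in> borel_measurable haar" "w \<in> poincare_group"
  shows "wigner_function f g w \<in> borel_measurable haar"
  using measurable_compose[OF measurable_Pair1' measurable_wigner_function[OF assms(1,2)], of w] assms(3) by simp

lemma nn_integral_wigner_function:
  assumes f: "f \<in> L2 haar" and g: "g \<in> L2 haar"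
  shows "(\<integral>\<^sup>+w. \<integral>\<^sup>+\<xi>. ennreal ((cmod (wigner_function f g w \<xi>))\<^sup>2) \<partial>haar \<partial>haar)
    = ennreal ((L2_norm haar f)\<^sup>2 * (L2_norm haar g)\<^sup>2)"
proof -
  note [measurable] = L2_D(1)[OF f] L2_D(1)[OF g]
  have "(\<integral>\<^sup>+w. \<integral>\<^sup>+\<xi>. ennreal ((cmod (wigner_function f g w \<xi>))\<^sup>2) \<partial>haar \<partial>haar)
      = (\<integral>\<^sup>+w. \<integral>\<^sup>+\<xi>. ennreal ((cmod (f (psqrt \<xi> \<star> w)))\<^sup>2) * ennreal ((cmod (g (pinv w \<star> psqrt \<xi>)))\<^sup>2) \<partial>haar \<partial>haar)"
    by (simp add: wigner_function_def norm_mult power_mult_distrib ennreal_mult)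
  also have "\<dots> = (\<integral>\<^sup>+u. ennreal ((cmod (f u))\<^sup>2) \<partial>haar) * (\<integral>\<^sup>+v. ennreal ((cmod (g v))\<^sup>2) \<partial>haar)"
    by (rule nn_integral_sqrt_substitution) measurable
  also have "\<dots> = ennreal ((L2_norm haar f)\<^sup>2 * (L2_norm haar g)\<^sup>2)"
    by (simp add: L2_norm_sq_nn_integral f g ennreal_mult)
  finally show ?thesis .
qed

lemma measurable_wigner_norm:
  assumes f: "f \<in> borel_measurable haar" and g: "g \<in> borel_measurable haar"
  shows "(\<lambda>w. \<integral>\<^sup>+\<xi>. ennreal ((cmod (wigner_function f g w \<xi>))\<^sup>2) \<partial>haar) \<in> borel_measurable haar"
proof -
  interpret sigma_finite_measure haar by (rule sigma_finite_haar)
  have "(\<lambda>z. case z of (w, \<xi>) \<Rightarrow> ennreal ((cmod (wigner_function f g w \<xi>))\<^sup>2)) \<in> borel_measurable (haar \<Otimes>\<^sub>M haar)"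
    using measurable_wigner_function[OF f g] by (simp add: split_beta')
  then show ?thesis by (rule borel_measurable_nn_integral)
qed

lemma AE_wigner_function_L2:
  assumes f: "f \<in> L2 haar" and g: "g \<in> L2 haar"
  shows "AE w in haar. wigner_function f g w \<in> L2 haar"
proof -
  note fg = L2_D(1)[OF f] L2_D(1)[OF g]
  have "AE w in haar. (\<integral>\<^sup>+\<xi>. ennreal ((cmod (wigner_function f g w \<xi>))\<^sup>2) \<partial>haar) \<noteq> \<infinity>"
    by (rule nn_integral_PInf_AE) (use nn_integral_wigner_function[OF f g] measurable_wigner_norm[OF fg] in auto)
  then show ?thesis
    using AE_space
  proof eventually_elim
    case (elim w)
    then show ?case
      using measurable_wigner_section[OF fg, of w] by (simp add: L2_iff_nn_integral top.not_eq_extremum)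
  qed
qed

section \<open>Measurability of the symbol\<close>

text \<open>Symbols are weakly measurable; the unbounded factor is moved to the other side of the inner product, after cutting that
  side off to the region where the Minkowski form is bounded.\<close>

lemma measurable_duflo_moore_symbol:
  assumes ij: "i \<in> {1, 2}" "j \<in> {1, 2}" and \<sigma>: "measurable_symbol \<sigma>"
    and HS: "\<And>w. w \<in> poincare_group \<Longrightarrow> hilbert_schmidt (cone_measure i j) (\<lambda>\<phi>. duflo_moore (\<sigma> w i j \<phi>))"
    and \<phi>: "\<phi> \<in> L2 (cone_measure i j)" and \<psi>: "\<psi> \<in> L2 (cone_measure i j)"
  shows "(\<lambda>w. L2_inner (cone_measure i j) (duflo_moore (\<sigma> w i j \<phi>)) \<psi>) \<in> borel_measurable haar"
proof -
  let ?C = "cone_measure i j"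
  obtain \<psi>' where \<psi>': "\<And>n::nat. \<psi>' n \<in> L2 ?C" and D\<psi>': "\<And>n. duflo_moore (\<psi>' n) \<in> L2 ?C"
    and lim: "(\<lambda>n. L2_norm ?C (\<lambda>x. \<psi>' n x - \<psi> x)) \<longlonglongrightarrow> 0"
    using duflo_moore_domain_dense[OF \<psi>] by blast
  show ?thesis
  proof (rule borel_measurable_LIMSEQ_metric)
    show "(\<lambda>w. L2_inner ?C (\<sigma> w i j \<phi>) (duflo_moore (\<psi>' n))) \<in> borel_measurable haar" for n
      using \<sigma> ij \<phi> D\<psi>'[of n] unfolding measurable_symbol_def by blast
    fix w assume "w \<in> space haar"
    then have SL: "duflo_moore (\<sigma> w i j \<phi>) \<in> L2 ?C"
      using L2_bounded_operator_L2[of ?C "\<lambda>\<phi>. duflo_moore (\<sigma> w i j \<phi>)", OF _ \<phi>] HS[of w] by (simp add: hilbert_schmidt_def)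
    have "L2_inner ?C (\<sigma> w i j \<phi>) (duflo_moore (\<psi>' n)) = L2_inner ?C (duflo_moore (\<sigma> w i j \<phi>)) (\<psi>' n)" for n
      by (simp add: L2_inner_def duflo_moore_def ac_simps)
    moreover have "(\<lambda>n. L2_inner ?C (\<psi>' n) (duflo_moore (\<sigma> w i j \<phi>))) \<longlonglongrightarrow> L2_inner ?C \<psi> (duflo_moore (\<sigma> w i j \<phi>))"
      by (rule L2_inner_tendsto[OF \<psi>' \<psi> SL lim])
    then have "(\<lambda>n. L2_inner ?C (duflo_moore (\<sigma> w i j \<phi>)) (\<psi>' n)) \<longlonglongrightarrow> L2_inner ?C (duflo_moore (\<sigma> w i j \<phi>)) \<psi>"
      unfolding L2_inner_commute[of ?C "duflo_moore (\<sigma> w i j \<phi>)"] by (rule tendsto_cnj)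
    ultimately show "(\<lambda>n. L2_inner ?C (\<sigma> w i j \<phi>) (duflo_moore (\<psi>' n))) \<longlonglongrightarrow> L2_inner ?C (duflo_moore (\<sigma> w i j \<phi>)) \<psi>"
      by simp
  qed
qed

section \<open>One summand of the Weyl pairing\<close>

definition weyl_term :: "symbol \<Rightarrow> (poincare \<Rightarrow> complex) \<Rightarrow> (poincare \<Rightarrow> complex) \<Rightarrow> nat \<Rightarrow> nat \<Rightarrow> poincare \<Rightarrow> complex" where
  "weyl_term \<sigma> f g i j w =
     op_trace (cone_measure i j) (\<lambda>\<phi>. duflo_moore (\<sigma> w i j (wigner f g w i j \<phi>)))"

text \<open>One irreducible representation at a time: \<open>S w\<close> is the symbol at \<open>w\<close> composed with the Duflo--Moore operator, and \<open>K n m\<close>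
  represents the matrix coefficients of the Fourier transform.\<close>

locale weyl_symbol = cone_index +
  fixes \<sigma> :: symbol and S :: "poincare \<Rightarrow> (plane \<Rightarrow> complex) \<Rightarrow> plane \<Rightarrow> complex"
    and K :: "nat \<Rightarrow> nat \<Rightarrow> poincare \<Rightarrow> complex"
  assumes \<sigma>: "measurable_symbol \<sigma>"
    and S_def: "S = (\<lambda>w \<phi>. duflo_moore (\<sigma> w i j \<phi>))"
    and HS: "\<And>w. w \<in> poincare_group \<Longrightarrow> hilbert_schmidt C (S w)"
    and fin: "(\<integral>\<^sup>+w. ennreal ((hs_norm C (S w))\<^sup>2) \<partial>haar) < \<infinity>"
    and K_L2: "\<And>n m. K n m \<in> L2 haar"
    and K: "\<And>n m F T. is_fourier i j F T \<Longrightarrow> matrix_coeff C T n m = (\<integral>\<xi>. F \<xi> * K n m \<xi> \<partial>haar)"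
begin

lemma measurable_matrix_symbol: "(\<lambda>w. matrix_coeff C (S w) n m) \<in> borel_measurable haar"
  unfolding matrix_coeff_def C_def S_def
  by (rule measurable_duflo_moore_symbol[OF ij \<sigma>])
    (use HS some_basis_L2[OF basis_C] in \<open>simp_all add: C_def S_def\<close>)

text \<open>By Parseval's identity the norm is a double series of squared matrix coefficients.\<close>

lemma measurable_hs_norm_symbol: "(\<lambda>w. ennreal (hs_norm C (S w))) \<in> borel_measurable haar"
proof -
  have "(\<lambda>w. \<Sum>n. \<Sum>m. ennreal ((cmod (matrix_coeff C (S w) n m))\<^sup>2)) \<in> borel_measurable haar"
    using measurable_matrix_symbol by measurable
  then have "(\<lambda>w. ennreal (sqrt (enn2real (\<Sum>n. \<Sum>m. ennreal ((cmod (matrix_coeff C (S w) n m))\<^sup>2))))) \<in> borel_measurable haar"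
    by measurable
  then show ?thesis
  proof (rule measurable_cong[THEN iffD1, rotated])
    fix w assume "w \<in> space haar"
    then have w: "w \<in> poincare_group" by simp
    show "ennreal (sqrt (enn2real (\<Sum>n. \<Sum>m. ennreal ((cmod (matrix_coeff C (S w) n m))\<^sup>2)))) = ennreal (hs_norm C (S w))"
      unfolding hs_norm_sq_matrix[OF basis_C HS[OF w]] using hs_norm_nonneg[OF HS[OF w]] by simp
  qed
qed

lemma weyl_term_series:
  assumes w: "w \<in> poincare_group" and F: "wigner_function f g w \<in> L2 haar"
  shows "weyl_term \<sigma> f g i j w
      = (\<Sum>n. \<Sum>m. (\<integral>\<xi>. wigner_function f g w \<xi> * K n m \<xi> \<partial>haar) * matrix_coeff C (S w) m n)"
    and "ennreal (cmod (weyl_term \<sigma> f g i j w)) \<le> ennreal (hs_norm C (S w) * L2_norm haar (wigner_function f g w))"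
    and "summable (\<lambda>m. (\<integral>\<xi>. wigner_function f g w \<xi> * K n m \<xi> \<partial>haar) * matrix_coeff C (S w) m n)"
    and "summable (\<lambda>n. \<Sum>m. (\<integral>\<xi>. wigner_function f g w \<xi> * K n m \<xi> \<partial>haar) * matrix_coeff C (S w) m n)"
proof -
  let ?F = "wigner_function f g w"
  let ?T = "group_fourier i j ?F"
  have T: "is_fourier i j ?F ?T" by (rule group_fourier_is_fourier[OF F])
  have HT: "hilbert_schmidt C ?T" using T by (simp add: is_fourier_def C_def)
  have mT: "matrix_coeff C ?T n m = (\<integral>\<xi>. ?F \<xi> * K n m \<xi> \<partial>haar)" for n m by (rule K[OF T])
  have eq: "weyl_term \<sigma> f g i j w = op_trace C (\<lambda>\<phi>. S w (?T \<phi>))"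
    by (simp add: weyl_term_def S_def C_def wigner_eq)
  note tr = op_trace_compose[OF basis_C HS[OF w] HT]
  show series: "weyl_term \<sigma> f g i j w = (\<Sum>n. \<Sum>m. (\<integral>\<xi>. ?F \<xi> * K n m \<xi> \<partial>haar) * matrix_coeff C (S w) m n)"
    unfolding eq tr(1) mT ..
  show "summable (\<lambda>m. (\<integral>\<xi>. ?F \<xi> * K n m \<xi> \<partial>haar) * matrix_coeff C (S w) m n)"
    using tr(3)[of n] unfolding mT .
  have le: "(\<Sum>n. ennreal (cmod (\<Sum>m. (\<integral>\<xi>. ?F \<xi> * K n m \<xi> \<partial>haar) * matrix_coeff C (S w) m n)))
      \<le> ennreal (hs_norm C ?T * hs_norm C (S w))"
    using tr(2) unfolding mT .
  then have "summable (\<lambda>n. cmod (\<Sum>m. (\<integral>\<xi>. ?F \<xi> * K n m \<xi> \<partial>haar) * matrix_coeff C (S w) m n))"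
    by (intro summable_suminf_not_top) (auto simp: top_unique)
  then show "summable (\<lambda>n. \<Sum>m. (\<integral>\<xi>. ?F \<xi> * K n m \<xi> \<partial>haar) * matrix_coeff C (S w) m n)"
    by (rule summable_norm_cancel)
  have "hs_norm C ?T \<le> L2_norm haar ?F" by (rule fourier_hs_norm_le[OF T])
  then have "hs_norm C ?T * hs_norm C (S w) \<le> hs_norm C (S w) * L2_norm haar ?F"
    using hs_norm_nonneg[OF HS[OF w]] by (simp add: mult.commute mult_left_mono)
  then show "ennreal (cmod (weyl_term \<sigma> f g i j w)) \<le> ennreal (hs_norm C (S w) * L2_norm haar ?F)"
    unfolding series by (intro order_trans[OF norm_suminf_le_ennreal order_trans[OF le]] ennreal_leI)
qed

text \<open>Outside \<open>L\<^sup>2\<close> the Wigner transform is the zero operator by convention.\<close>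

lemma weyl_term_outside:
  assumes w: "w \<in> poincare_group" and F: "wigner_function f g w \<notin> L2 haar"
  shows "weyl_term \<sigma> f g i j w = 0"
proof -
  have B: "L2_bounded_operator C (S w)" using HS[OF w] by (simp add: hilbert_schmidt_def)
  have "weyl_term \<sigma> f g i j w = (\<Sum>n. L2_inner C (S w (\<lambda>x. 0)) (some_basis C n))"
    using F by (simp add: weyl_term_def op_trace_def S_def C_def wigner_eq group_fourier_def)
  also have "\<dots> = 0"
  proof -
    have "L2_inner C (S w (\<lambda>x. 0)) (some_basis C n) = L2_inner C (\<lambda>x. 0) (some_basis C n)" for n
      by (rule L2_inner_cong_AE)
        (use L2_bounded_operator_zero[OF B] L2_D(1)[OF L2_bounded_operator_L2[OF B L2_zero]] L2_D(1)[OF some_basis_L2[OF basis_C]] in auto)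
    then show ?thesis by simp
  qed
  finally show ?thesis .
qed

text \<open>The set of \<open>w\<close> for which the Wigner integrand is square-integrable is measurable by Tonelli's theorem; on it the
  double series applies, and off it the term vanishes.\<close>

lemma measurable_weyl_term:
  assumes f: "f \<in> L2 haar" and g: "g \<in> L2 haar"
  shows "weyl_term \<sigma> f g i j \<in> borel_measurable haar"
proof -
  interpret sigma_finite_measure haar by (rule sigma_finite_haar)
  note fg = L2_D(1)[OF f] L2_D(1)[OF g]
  have m1 [measurable]: "(\<lambda>w. \<integral>\<xi>. wigner_function f g w \<xi> * K n m \<xi> \<partial>haar) \<in> borel_measurable haar" for n m
  proof (rule borel_measurable_lebesgue_integral)
    have "(\<lambda>z. K n m (snd z)) \<in> borel_measurable (haar \<Otimes>\<^sub>M haar)"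
      by (rule measurable_compose[OF measurable_snd L2_D(1)[OF K_L2]])
    from borel_measurable_times[OF measurable_wigner_function[OF fg] this]
    show "(\<lambda>(w, \<xi>). wigner_function f g w \<xi> * K n m \<xi>) \<in> borel_measurable (haar \<Otimes>\<^sub>M haar)" by (simp add: split_beta')
  qed
  note [measurable] = measurable_matrix_symbol measurable_wigner_norm[OF fg]
  let ?s = "\<lambda>w. \<Sum>n. \<Sum>m. (\<integral>\<xi>. wigner_function f g w \<xi> * K n m \<xi> \<partial>haar) * matrix_coeff C (S w) m n"
  have "?s \<in> borel_measurable haar" by measurable
  then have "(\<lambda>w. if (\<integral>\<^sup>+\<xi>. ennreal ((cmod (wigner_function f g w \<xi>))\<^sup>2) \<partial>haar) < \<infinity> then ?s w else 0) \<in> borel_measurable haar"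
    by measurable
  then show ?thesis
  proof (rule measurable_cong[THEN iffD1, rotated])
    fix w assume "w \<in> space haar"
    then have w: "w \<in> poincare_group" by simp
    have "(\<integral>\<^sup>+\<xi>. ennreal ((cmod (wigner_function f g w \<xi>))\<^sup>2) \<partial>haar) < \<infinity> \<longleftrightarrow> wigner_function f g w \<in> L2 haar"
      using measurable_wigner_section[OF fg w] by (simp add: L2_iff_nn_integral)
    then show "(if (\<integral>\<^sup>+\<xi>. ennreal ((cmod (wigner_function f g w \<xi>))\<^sup>2) \<partial>haar) < \<infinity> then ?s w else 0) = weyl_term \<sigma> f g i j w"
      using weyl_term_series(1)[OF w] weyl_term_outside[OF w] by simp
  qed
qed

text \<open>The Cauchy--Schwarz inequality in \<open>w\<close>, between the norms of the symbol and of the Wigner integrand.\<close>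

lemma nn_integral_weyl_term:
  assumes f: "f \<in> L2 haar" and g: "g \<in> L2 haar"
  shows "(\<integral>\<^sup>+w. ennreal (cmod (weyl_term \<sigma> f g i j w)) \<partial>haar)
    \<le> ennreal (sqrt (enn2real (\<integral>\<^sup>+w. ennreal ((hs_norm C (S w))\<^sup>2) \<partial>haar)) * (L2_norm haar f * L2_norm haar g))"
proof -
  note fg = L2_D(1)[OF f] L2_D(1)[OF g]
  let ?W = "\<lambda>w. \<integral>\<^sup>+\<xi>. ennreal ((cmod (wigner_function f g w \<xi>))\<^sup>2) \<partial>haar"
  let ?r = "\<lambda>w. ennreal (sqrt (enn2real (?W w)))"
  define B where "B = enn2real (\<integral>\<^sup>+w. ennreal ((hs_norm C (S w))\<^sup>2) \<partial>haar)"
  have B: "(\<integral>\<^sup>+w. ennreal ((hs_norm C (S w))\<^sup>2) \<partial>haar) = ennreal B" "0 \<le> B"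
    using fin by (simp_all add: B_def)
  have rm: "?r \<in> borel_measurable haar" using measurable_wigner_norm[OF fg] by measurable
  have "(\<integral>\<^sup>+w. ennreal (cmod (weyl_term \<sigma> f g i j w)) \<partial>haar) \<le> (\<integral>\<^sup>+w. ennreal (hs_norm C (S w)) * ?r w \<partial>haar)"
  proof (rule nn_integral_mono_AE)
    show "AE w in haar. ennreal (cmod (weyl_term \<sigma> f g i j w)) \<le> ennreal (hs_norm C (S w)) * ?r w"
      using AE_wigner_function_L2[OF f g] AE_space
    proof eventually_elim
      case (elim w)
      then have w: "w \<in> poincare_group" by simp
      have "sqrt (enn2real (?W w)) = L2_norm haar (wigner_function f g w)"
        unfolding L2_norm_sq_nn_integral[OF elim(1)] by simp
      then show ?case
        using weyl_term_series(2)[OF w elim(1)] hs_norm_nonneg[OF HS[OF w]] by (simp add: ennreal_mult)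
    qed
  qed
  also have "\<dots> \<le> ennreal (sqrt B * (L2_norm haar f * L2_norm haar g))"
  proof -
    have "(\<integral>\<^sup>+w. ennreal (hs_norm C (S w)) * ?r w \<partial>haar)\<^sup>2
        \<le> (\<integral>\<^sup>+w. (ennreal (hs_norm C (S w)))\<^sup>2 \<partial>haar) * (\<integral>\<^sup>+w. (?r w)\<^sup>2 \<partial>haar)"
      by (rule Cauchy_Schwarz_nn_integral[OF measurable_hs_norm_symbol rm])
    also have "(\<integral>\<^sup>+w. (ennreal (hs_norm C (S w)))\<^sup>2 \<partial>haar) = ennreal B"
      unfolding B(1)[symmetric] by (intro nn_integral_cong) (simp add: ennreal_power hs_norm_nonneg[OF HS])
    also have "(\<integral>\<^sup>+w. (?r w)\<^sup>2 \<partial>haar) = (\<integral>\<^sup>+w. ?W w \<partial>haar)"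
    proof (rule nn_integral_cong_AE)
      show "AE w in haar. (?r w)\<^sup>2 = ?W w"
        using AE_wigner_function_L2[OF f g]
        by eventually_elim (simp add: L2_norm_sq_nn_integral ennreal_power)
    qed
    also have "ennreal B * \<dots> = (ennreal (sqrt B * (L2_norm haar f * L2_norm haar g)))\<^sup>2"
      unfolding nn_integral_wigner_function[OF f g]
      using B(2) by (simp add: ennreal_mult[symmetric] ennreal_power power_mult_distrib)
    finally show ?thesis by (rule ennreal_le_if_sq_le) (use B(2) in simp)
  qed
  finally show ?thesis unfolding B_def .
qed

lemma integrable_weyl_term:
  assumes "f \<in> L2 haar" "g \<in> L2 haar"
  shows "integrable haar (weyl_term \<sigma> f g i j)"
  unfolding integrable_iff_bounded
  using measurable_weyl_term[OF assms] nn_integral_weyl_term[OF assms] by (auto intro: le_less_trans)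

text \<open>The summands only see the matrix coefficients of the Wigner transform, which are linear in the transformed function
  although the transform itself is picked by a choice operator.\<close>

lemma weyl_term_lincomb:
  assumes fs: "f1 \<in> L2 haar" "g1 \<in> L2 haar" "f2 \<in> L2 haar" "g2 \<in> L2 haar" "f \<in> L2 haar" "g \<in> L2 haar"
    and lin: "\<And>w \<xi>. wigner_function f g w \<xi> = c * wigner_function f1 g1 w \<xi> + d * wigner_function f2 g2 w \<xi>"
  shows "AE w in haar. weyl_term \<sigma> f g i j w = c * weyl_term \<sigma> f1 g1 i j w + d * weyl_term \<sigma> f2 g2 i j w"
  using AE_wigner_function_L2[OF fs(1,2)] AE_wigner_function_L2[OF fs(3,4)] AE_wigner_function_L2[OF fs(5,6)] AE_space
proof eventually_elim
  case (elim w)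
  then have w: "w \<in> poincare_group" by simp
  note s1 = weyl_term_series[OF w elim(1)] and s2 = weyl_term_series[OF w elim(2)] and s = weyl_term_series[OF w elim(3)]
  let ?I = "\<lambda>f g n m. \<integral>\<xi>. wigner_function f g w \<xi> * K n m \<xi> \<partial>haar"
  have I: "?I f g n m = c * ?I f1 g1 n m + d * ?I f2 g2 n m" for n m
    unfolding lin using L2_mult_integrable[OF elim(1) K_L2[of n m]] L2_mult_integrable[OF elim(2) K_L2[of n m]]
    by (simp add: distrib_right mult.assoc)
  have "(\<Sum>m. ?I f g n m * matrix_coeff C (S w) m n)
      = c * (\<Sum>m. ?I f1 g1 n m * matrix_coeff C (S w) m n) + d * (\<Sum>m. ?I f2 g2 n m * matrix_coeff C (S w) m n)" for n
    unfolding I using s1(3)[of n] s2(3)[of n]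
    by (simp add: distrib_right mult.assoc suminf_add[symmetric] suminf_mult[symmetric] summable_mult)
  then show ?case
    unfolding s(1) s1(1) s2(1) using s1(4) s2(4)
    by (simp add: suminf_add[symmetric] suminf_mult[symmetric] summable_mult)
qed

end

section \<open>Boundedness of the Weyl transform\<close>

text \<open>The Riesz theorem gives the value at each \<open>f\<close>.  It is unique up to null sets, which is why the operator picked by
  choice is linear almost everywhere.\<close>

lemma sesquilinear_form_operator:
  assumes lin1: "\<And>f g h c d. f \<in> L2 M \<Longrightarrow> g \<in> L2 M \<Longrightarrow> h \<in> L2 M \<Longrightarrow> B (\<lambda>x. c * f x + d * g x) h = c * B f h + d * B g h"
    and lin2: "\<And>f g h c d. f \<in> L2 M \<Longrightarrow> g \<in> L2 M \<Longrightarrow> h \<in> L2 M \<Longrightarrow> B h (\<lambda>x. c * f x + d * g x) = cnj c * B h f + cnj d * B h g"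
    and bdd: "\<And>f g. f \<in> L2 M \<Longrightarrow> g \<in> L2 M \<Longrightarrow> cmod (B f g) \<le> C * (L2_norm M f * L2_norm M g)"
    and T: "\<And>f. T f = (SOME h. h \<in> L2 M \<and> (\<forall>g\<in>L2 M. L2_inner M h g = B f g))"
  shows "\<forall>f\<in>L2 M. \<forall>g\<in>L2 M. L2_inner M (T f) g = B f g" and "L2_bounded_operator M T"
proof -
  have "\<exists>h. h \<in> L2 M \<and> (\<forall>g\<in>L2 M. L2_inner M h g = B f g)" if f: "f \<in> L2 M" for f
  proof -
    have "\<exists>h\<in>L2 M. \<forall>g\<in>L2 M. cnj (B f g) = L2_inner M g h"
    proof (rule L2_Riesz_representation)
      show "cnj (B f (\<lambda>x. c * g x + d * g' x)) = c * cnj (B f g) + d * cnj (B f g')"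
        if "g \<in> L2 M" "g' \<in> L2 M" for g g' c d
        by (simp add: lin2[OF that f])
      show "cmod (cnj (B f g)) \<le> (C * L2_norm M f) * L2_norm M g" if "g \<in> L2 M" for g
        using bdd[OF f that] by (simp add: mult.assoc)
    qed (auto intro: L2_lincomb)
    then obtain h where h: "h \<in> L2 M" and eq: "\<And>g. g \<in> L2 M \<Longrightarrow> cnj (B f g) = L2_inner M g h" by blast
    have "L2_inner M h g = B f g" if "g \<in> L2 M" for g
      unfolding L2_inner_commute[of M h g] eq[OF that, symmetric] by simp
    then show ?thesis using h by blast
  qed
  note ex = this
  have T': "T f \<in> L2 M \<and> (\<forall>g\<in>L2 M. L2_inner M (T f) g = B f g)" if "f \<in> L2 M" for f
    unfolding T by (rule someI_ex[OF ex[OF that]])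
  then show "\<forall>f\<in>L2 M. \<forall>g\<in>L2 M. L2_inner M (T f) g = B f g" by blast
  have TL: "T f \<in> L2 M" if "f \<in> L2 M" for f using T'[OF that] by blast
  have TB: "L2_inner M (T f) g = B f g" if "f \<in> L2 M" "g \<in> L2 M" for f g using T'[OF that(1)] that(2) by blast
  show "L2_bounded_operator M T"
    unfolding L2_bounded_operator_def
  proof (intro conjI ballI allI exI)
    show "T f \<in> L2 M" if "f \<in> L2 M" for f by (rule TL[OF that])
  next
    fix f g c d assume f: "f \<in> L2 M" and g: "g \<in> L2 M"
    let ?h = "\<lambda>y. c * f y + d * g y" and ?k = "\<lambda>x. c * T f x + d * T g x"
    have h: "?h \<in> L2 M" by (rule L2_lincomb[OF f g])
    have k: "?k \<in> L2 M" by (rule L2_lincomb[OF TL[OF f] TL[OF g]])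
    let ?u = "\<lambda>x. T ?h x - ?k x"
    have u: "?u \<in> L2 M" by (rule L2_diff[OF TL[OF h] k])
    have "L2_inner M ?u ?u = L2_inner M (T ?h) ?u - (c * L2_inner M (T f) ?u + d * L2_inner M (T g) ?u)"
      unfolding L2_inner_diff_left[OF TL[OF h] k u] L2_inner_lincomb_left[OF TL[OF f] TL[OF g] u] ..
    also have "\<dots> = 0" unfolding TB[OF h u] TB[OF f u] TB[OF g u] lin1[OF f g u] by simp
    finally have "L2_norm M ?u = 0" by (simp add: L2_inner_self)
    then show "AE x in M. T ?h x = ?k x" using L2_norm_eq_0_iff[OF u] by simp
  next
    fix f assume f: "f \<in> L2 M"
    have "complex_of_real ((L2_norm M (T f))\<^sup>2) = B f (T f)"
      unfolding L2_inner_self[symmetric] by (rule TB[OF f TL[OF f]])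
    then have "cmod (complex_of_real ((L2_norm M (T f))\<^sup>2)) \<le> C * (L2_norm M f * L2_norm M (T f))"
      using bdd[OF f TL[OF f]] by simp
    then have sq: "(L2_norm M (T f))\<^sup>2 \<le> (C * L2_norm M f) * L2_norm M (T f)"
      by (simp add: mult.assoc del: of_real_power)
    show "L2_norm M (T f) \<le> \<bar>C\<bar> * L2_norm M f"
    proof (cases "L2_norm M (T f) = 0")
      case False
      then have "L2_norm M (T f) > 0" using L2_norm_nonneg[of M "T f"] by linarith
      then have "L2_norm M (T f) \<le> C * L2_norm M f" using sq by (simp add: power2_eq_square)
      also have "\<dots> \<le> \<bar>C\<bar> * L2_norm M f" by (intro mult_right_mono) auto
      finally show ?thesis .
    qed simp
  qed
qed

lemma wigner_function_lincomb:
  "wigner_function (\<lambda>x. c * f x + d * g x) h w \<xi> = c * wigner_function f h w \<xi> + d * wigner_function g h w \<xi>"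
  "wigner_function h (\<lambda>x. c * f x + d * g x) w \<xi> = cnj c * wigner_function h f w \<xi> + cnj d * wigner_function h g w \<xi>"
  by (simp_all add: wigner_function_def algebra_simps)

theorem theorem5p3:
  fixes \<sigma> :: symbol
  assumes "measurable_symbol \<sigma>"
    and "\<And>w i j. w \<in> poincare_group \<Longrightarrow> i \<in> {1, 2} \<Longrightarrow> j \<in> {1, 2} \<Longrightarrow>
           hilbert_schmidt (cone_measure i j) (\<sigma> w i j)"
    and "\<And>w i j. w \<in> poincare_group \<Longrightarrow> i \<in> {1, 2} \<Longrightarrow> j \<in> {1, 2} \<Longrightarrow>
           hilbert_schmidt (cone_measure i j) (\<lambda>\<phi>. duflo_moore (\<sigma> w i j \<phi>))"
    and "\<And>i j. i \<in> {1, 2} \<Longrightarrow> j \<in> {1, 2} \<Longrightarrow>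
           (\<integral>\<^sup>+ w. ennreal ((hs_norm (cone_measure i j) (\<lambda>\<phi>. duflo_moore (\<sigma> w i j \<phi>)))\<^sup>2) \<partial>haar) < \<infinity>"
  shows "(\<forall>f\<in>L2 haar. \<forall>g\<in>L2 haar.
            integrable haar (weyl_integrand \<sigma> f g) \<and>
            L2_inner haar (weyl_transform \<sigma> f) g = (\<integral>w. weyl_integrand \<sigma> f g w \<partial>haar))
         \<and> L2_bounded_operator haar (weyl_transform \<sigma>)"
proof -
  let ?I = "{1, 2 :: nat}"
  define D where "D i j w \<phi> = duflo_moore (\<sigma> w i j \<phi>)" for i j w \<phi>
  define B where "B i j = sqrt (enn2real (\<integral>\<^sup>+w. ennreal ((hs_norm (cone_measure i j) (D i j w))\<^sup>2) \<partial>haar))" for i j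
  have sym: "\<exists>K. weyl_symbol i j (cone_measure i j) dilation_boost_measure \<sigma> (D i j) K" if ij: "i \<in> ?I" "j \<in> ?I" for i j
  proof -
    interpret cone_index i j "cone_measure i j" dilation_boost_measure by standard (use ij in auto)
    define K where "K n m = (SOME k. k \<in> L2 haar \<and>
        (\<forall>F T. is_fourier i j F T \<longrightarrow> matrix_coeff (cone_measure i j) T n m = (\<integral>\<xi>. F \<xi> * k \<xi> \<partial>haar)))" for n m
    have K: "K n m \<in> L2 haar \<and>
        (\<forall>F T. is_fourier i j F T \<longrightarrow> matrix_coeff (cone_measure i j) T n m = (\<integral>\<xi>. F \<xi> * K n m \<xi> \<partial>haar))" for n m
      unfolding K_def by (rule someI_ex[OF fourier_matrix_coeff[unfolded Bex_def]])
    have "weyl_symbol i j (cone_measure i j) dilation_boost_measure \<sigma> (D i j) K"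
      using assms(1,3,4) ij K by unfold_locales (auto simp: D_def[abs_def])
    then show ?thesis by blast
  qed
  have int: "integrable haar (weyl_term \<sigma> f g i j)"
    if "i \<in> ?I" "j \<in> ?I" and fg: "f \<in> L2 haar" "g \<in> L2 haar" for i j f g
    using sym[OF that(1,2)] weyl_symbol.integrable_weyl_term[OF _ fg] by blast
  have le: "(\<integral>\<^sup>+w. ennreal (cmod (weyl_term \<sigma> f g i j w)) \<partial>haar) \<le> ennreal (B i j * (L2_norm haar f * L2_norm haar g))"
    if "i \<in> ?I" "j \<in> ?I" and fg: "f \<in> L2 haar" "g \<in> L2 haar" for i j f g
    using sym[OF that(1,2)] weyl_symbol.nn_integral_weyl_term[OF _ fg] unfolding B_def by blast
  have lin: "AE w in haar. weyl_term \<sigma> f g i j w = c * weyl_term \<sigma> f1 g1 i j w + d * weyl_term \<sigma> f2 g2 i j w"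
    if "i \<in> ?I" "j \<in> ?I"
      and L: "f1 \<in> L2 haar" "g1 \<in> L2 haar" "f2 \<in> L2 haar" "g2 \<in> L2 haar" "f \<in> L2 haar" "g \<in> L2 haar"
      and eq: "\<And>w \<xi>. wigner_function f g w \<xi> = c * wigner_function f1 g1 w \<xi> + d * wigner_function f2 g2 w \<xi>"
    for i j f g f1 g1 f2 g2 c d
    using sym[OF that(1,2)] weyl_symbol.weyl_term_lincomb[OF _ L eq] by blast
  define P where "P f g = (\<integral>w. weyl_integrand \<sigma> f g w \<partial>haar)" for f g
  have wi: "weyl_integrand \<sigma> f g = (\<lambda>w. \<Sum>i\<in>?I. \<Sum>j\<in>?I. weyl_term \<sigma> f g i j w)" for f g
    by (simp add: weyl_integrand_def weyl_term_def fun_eq_iff)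
  have integ: "integrable haar (weyl_integrand \<sigma> f g)" if "f \<in> L2 haar" "g \<in> L2 haar" for f g
    unfolding wi by (intro Bochner_Integration.integrable_sum int that)
  have P: "P f g = (\<Sum>i\<in>?I. \<Sum>j\<in>?I. \<integral>w. weyl_term \<sigma> f g i j w \<partial>haar)" if "f \<in> L2 haar" "g \<in> L2 haar" for f g
    unfolding P_def wi
    by (subst Bochner_Integration.integral_sum, intro Bochner_Integration.integrable_sum int that, assumption+)
      (intro sum.cong refl Bochner_Integration.integral_sum int that)
  have Plin: "P f g = c * P f1 g1 + d * P f2 g2"
    if L: "f1 \<in> L2 haar" "g1 \<in> L2 haar" "f2 \<in> L2 haar" "g2 \<in> L2 haar" "f \<in> L2 haar" "g \<in> L2 haar"
      and eq: "\<And>w \<xi>. wigner_function f g w \<xi> = c * wigner_function f1 g1 w \<xi> + d * wigner_function f2 g2 w \<xi>"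
    for f g f1 g1 f2 g2 c d
  proof -
    have "(\<integral>w. weyl_term \<sigma> f g i j w \<partial>haar) = c * (\<integral>w. weyl_term \<sigma> f1 g1 i j w \<partial>haar) + d * (\<integral>w. weyl_term \<sigma> f2 g2 i j w \<partial>haar)"
      if ij: "i \<in> ?I" "j \<in> ?I" for i j
    proof -
      note i1 = int[OF ij L(1,2)] and i2 = int[OF ij L(3,4)]
      have "(\<integral>w. weyl_term \<sigma> f g i j w \<partial>haar) = (\<integral>w. c * weyl_term \<sigma> f1 g1 i j w + d * weyl_term \<sigma> f2 g2 i j w \<partial>haar)"
        by (rule integral_cong_AE) (use int[OF ij L(5,6)] i1 i2 lin[OF ij L eq] in auto)
      also have "\<dots> = c * (\<integral>w. weyl_term \<sigma> f1 g1 i j w \<partial>haar) + d * (\<integral>w. weyl_term \<sigma> f2 g2 i j w \<partial>haar)"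
        using i1 i2 by simp
      finally show ?thesis .
    qed
    then show ?thesis
      unfolding P[OF L(1,2)] P[OF L(3,4)] P[OF L(5,6)]
      by (simp add: algebra_simps)
  qed
  have bdd: "cmod (P f g) \<le> (\<Sum>i\<in>?I. \<Sum>j\<in>?I. B i j) * (L2_norm haar f * L2_norm haar g)"
    if fg: "f \<in> L2 haar" "g \<in> L2 haar" for f g
  proof -
    have B0: "0 \<le> B i j" for i j by (simp add: B_def)
    have "cmod (\<integral>w. weyl_term \<sigma> f g i j w \<partial>haar) \<le> B i j * (L2_norm haar f * L2_norm haar g)"
      if ij: "i \<in> ?I" "j \<in> ?I" for i j
      using order_trans[OF norm_integral_le_nn_integral le[OF ij fg]] B0[of i j] by simp
    then have "cmod (P f g) \<le> (\<Sum>i\<in>?I. \<Sum>j\<in>?I. B i j * (L2_norm haar f * L2_norm haar g))"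
      unfolding P[OF fg] by (intro sum_norm_le)
    then show ?thesis by (simp only: sum_distrib_right)
  qed
  have T: "weyl_transform \<sigma> f = (SOME h. h \<in> L2 haar \<and> (\<forall>g\<in>L2 haar. L2_inner haar h g = P f g))" for f
    by (simp add: weyl_transform_def P_def)
  note op = sesquilinear_form_operator[where B = P and T = "weyl_transform \<sigma>", OF _ _ bdd T]
  have "\<forall>f\<in>L2 haar. \<forall>g\<in>L2 haar. L2_inner haar (weyl_transform \<sigma> f) g = P f g"
    by (rule op(1)) (intro Plin L2_lincomb wigner_function_lincomb, assumption+)+
  moreover have "L2_bounded_operator haar (weyl_transform \<sigma>)"
    by (rule op(2)) (intro Plin L2_lincomb wigner_function_lincomb, assumption+)+
  ultimately show ?thesis using integ by (simp add: P_def)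
qed

end
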